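(* Let $\lambda$ be an uncountable cardinal and let $\mathrm{Set}^m_{\geqslant\lambda}$ denote the category of sets of cardinality at least $\lambda$ and monomorphisms (injective maps) between them. Then $\mathrm{Set}^m_{\geqslant\lambda}$ is not equivalent to the category of points of any (Grothendieck) topos. In particular, it is not equivalent to the category of models and elementary embeddings of a theory axiomatizable in $L_{\infty,\omega}$.
   Context: A point of a Grothendieck topos $\mathcal{T}$ is a functor $p^*:\mathcal{T}\to\mathrm{Set}$ preserving all small colimits and finite limits; the category of points of $\mathcal{T}$ has these functors as objects and natural transformations as morphisms. $L_{\infty,\omega}$ is the infinitary first-order logic (with equality) over a (possibly many-sorted) small signature of function and relation symbols, allowing negation, conjunctions and disjunctions of arbitrary small sets of formulas, and quantification over finitely many variables. A theory axiomatizable in $L_{\infty,\omega}$ is given by a set of $L_{\infty,\omega}$-sentences in such a signature; an elementary embedding between models is a map of underlying (sorted) sets that preserves and reflects the truth of all $L_{\infty,\omega}$-formulas of the signature. *)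

theory Defs
  imports Main "HOL-Library.FuncSet"
begin

unbundle cardinal_syntax

section \<open>The universe of small sets\<close>

text \<open>
  The type \<open>'u\<close> plays the role of a Grothendieck universe: if its cardinality is strongly
  inaccessible, a set (over any type) is called small if its cardinality is less than that of
  \<open>'u\<close>. Every small set is then in bijection with a small subset of \<open>'u\<close>, so the small subsets
  of \<open>'u\<close> and all maps between them form the category of sets of this universe, up to
  equivalence. HOL does not prove the existence of such a type, just as ZFC does not prove the
  existence of a Grothendieck universe.
\<close>

definition small :: "'u itself \<Rightarrow> 'b set \<Rightarrow> bool" where
  "small \<U> A \<longleftrightarrow> |A| <o |UNIV :: 'u set|"

definition inaccessible :: "'u itself \<Rightarrow> bool" where
  "inaccessible \<U> \<longleftrightarrow>
     natLeq <o |UNIV :: 'u set| \<and>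
     regularCard |UNIV :: 'u set| \<and>
     (\<forall>A :: 'u set. small \<U> A \<longrightarrow> small \<U> (Pow A))"


section \<open>Categories, functors, natural transformations\<close>

text \<open>
  Hom-sets are indexed by source and target and need not be disjoint; accordingly composition
  takes the three objects as arguments: \<open>cmp C X Y Z g f\<close> is \<open>g\<close> after \<open>f\<close> for \<open>f : X \<rightarrow> Y\<close> and
  \<open>g : Y \<rightarrow> Z\<close>. The values of \<open>hom\<close>, \<open>idn\<close>, \<open>cmp\<close> and of functors outside their
  intended domains are irrelevant.
\<close>

record ('o, 'a) cat =
  obj :: "'o set"
  hom :: "'o \<Rightarrow> 'o \<Rightarrow> 'a set"
  idn :: "'o \<Rightarrow> 'a"
  cmp :: "'o \<Rightarrow> 'o \<Rightarrow> 'o \<Rightarrow> 'a \<Rightarrow> 'a \<Rightarrow> 'a"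

definition is_category :: "('o, 'a) cat \<Rightarrow> bool" where
  "is_category C \<longleftrightarrow>
     (\<forall>X\<in>obj C. idn C X \<in> hom C X X) \<and>
     (\<forall>X\<in>obj C. \<forall>Y\<in>obj C. \<forall>Z\<in>obj C. \<forall>f\<in>hom C X Y. \<forall>g\<in>hom C Y Z.
        cmp C X Y Z g f \<in> hom C X Z) \<and>
     (\<forall>X\<in>obj C. \<forall>Y\<in>obj C. \<forall>f\<in>hom C X Y.
        cmp C X X Y f (idn C X) = f \<and> cmp C X Y Y (idn C Y) f = f) \<and>
     (\<forall>W\<in>obj C. \<forall>X\<in>obj C. \<forall>Y\<in>obj C. \<forall>Z\<in>obj C.
        \<forall>f\<in>hom C W X. \<forall>g\<in>hom C X Y. \<forall>h\<in>hom C Y Z.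
          cmp C W X Z (cmp C X Y Z h g) f = cmp C W Y Z h (cmp C W X Y g f))"

definition small_category :: "'u itself \<Rightarrow> ('o, 'a) cat \<Rightarrow> bool" where
  "small_category \<U> C \<longleftrightarrow>
     is_category C \<and> small \<U> (obj C) \<and> (\<forall>X\<in>obj C. \<forall>Y\<in>obj C. small \<U> (hom C X Y))"

definition finite_category :: "('o, 'a) cat \<Rightarrow> bool" where
  "finite_category C \<longleftrightarrow>
     is_category C \<and> finite (obj C) \<and> (\<forall>X\<in>obj C. \<forall>Y\<in>obj C. finite (hom C X Y))"

definition op_cat :: "('o, 'a) cat \<Rightarrow> ('o, 'a) cat" where
  "op_cat C = \<lparr> obj = obj C, hom = (\<lambda>X Y. hom C Y X), idn = idn C,
                cmp = (\<lambda>X Y Z g f. cmp C Z Y X f g) \<rparr>"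

definition full_subcat :: "('o, 'a) cat \<Rightarrow> ('o \<Rightarrow> bool) \<Rightarrow> ('o, 'a) cat" where
  "full_subcat C P = C\<lparr> obj := {X \<in> obj C. P X} \<rparr>"

record ('o, 'a, 'p, 'b) fctr =
  fob :: "'o \<Rightarrow> 'p"
  far :: "'o \<Rightarrow> 'o \<Rightarrow> 'a \<Rightarrow> 'b"

definition is_functor :: "('o, 'a) cat \<Rightarrow> ('p, 'b) cat \<Rightarrow> ('o, 'a, 'p, 'b) fctr \<Rightarrow> bool" where
  "is_functor C D F \<longleftrightarrow>
     (\<forall>X\<in>obj C. fob F X \<in> obj D) \<and>
     (\<forall>X\<in>obj C. \<forall>Y\<in>obj C. \<forall>f\<in>hom C X Y. far F X Y f \<in> hom D (fob F X) (fob F Y)) \<and>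
     (\<forall>X\<in>obj C. far F X X (idn C X) = idn D (fob F X)) \<and>
     (\<forall>X\<in>obj C. \<forall>Y\<in>obj C. \<forall>Z\<in>obj C. \<forall>f\<in>hom C X Y. \<forall>g\<in>hom C Y Z.
        far F X Z (cmp C X Y Z g f)
          = cmp D (fob F X) (fob F Y) (fob F Z) (far F Y Z g) (far F X Y f))"

definition id_fctr :: "('o, 'a, 'o, 'a) fctr" where
  "id_fctr = \<lparr> fob = (\<lambda>X. X), far = (\<lambda>X Y f. f) \<rparr>"

definition comp_fctr ::
  "('p, 'b, 'q, 'c) fctr \<Rightarrow> ('o, 'a, 'p, 'b) fctr \<Rightarrow> ('o, 'a, 'q, 'c) fctr" where
  "comp_fctr G F = \<lparr> fob = (\<lambda>X. fob G (fob F X)),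
                     far = (\<lambda>X Y f. far G (fob F X) (fob F Y) (far F X Y f)) \<rparr>"

definition nat_trans ::
  "('o, 'a) cat \<Rightarrow> ('p, 'b) cat \<Rightarrow> ('o, 'a, 'p, 'b) fctr \<Rightarrow> ('o, 'a, 'p, 'b) fctr \<Rightarrow> ('o \<Rightarrow> 'b) set"
  where
  "nat_trans C D F G =
     {\<alpha> \<in> (\<Pi>\<^sub>E X\<in>obj C. hom D (fob F X) (fob G X)).
        \<forall>X\<in>obj C. \<forall>Y\<in>obj C. \<forall>f\<in>hom C X Y.
          cmp D (fob F X) (fob F Y) (fob G Y) (\<alpha> Y) (far F X Y f)
            = cmp D (fob F X) (fob G X) (fob G Y) (far G X Y f) (\<alpha> X)}"

definition fctr_cat ::
  "('o, 'a) cat \<Rightarrow> ('p, 'b) cat \<Rightarrow> (('o, 'a, 'p, 'b) fctr, 'o \<Rightarrow> 'b) cat" where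
  "fctr_cat C D =
     \<lparr> obj = {F. is_functor C D F},
       hom = nat_trans C D,
       idn = (\<lambda>F. \<lambda>X\<in>obj C. idn D (fob F X)),
       cmp = (\<lambda>F G H \<beta> \<alpha>. \<lambda>X\<in>obj C. cmp D (fob F X) (fob G X) (fob H X) (\<beta> X) (\<alpha> X)) \<rparr>"

definition isomorphic :: "('o, 'a) cat \<Rightarrow> 'o \<Rightarrow> 'o \<Rightarrow> bool" where
  "isomorphic C X Y \<longleftrightarrow>
     (\<exists>f\<in>hom C X Y. \<exists>g\<in>hom C Y X.
        cmp C X Y X g f = idn C X \<and> cmp C Y X Y f g = idn C Y)"

definition equivalent :: "('o, 'a) cat \<Rightarrow> ('p, 'b) cat \<Rightarrow> bool" where
  "equivalent C D \<longleftrightarrow>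
     (\<exists>F G. is_functor C D F \<and> is_functor D C G \<and>
        isomorphic (fctr_cat C C) (comp_fctr G F) id_fctr \<and>
        isomorphic (fctr_cat D D) (comp_fctr F G) id_fctr)"


section \<open>Limits and colimits\<close>

definition is_cocone ::
  "('j, 'i) cat \<Rightarrow> ('o, 'a) cat \<Rightarrow> ('j, 'i, 'o, 'a) fctr \<Rightarrow> 'o \<Rightarrow> ('j \<Rightarrow> 'a) \<Rightarrow> bool" where
  "is_cocone J C D c \<iota> \<longleftrightarrow>
     c \<in> obj C \<and>
     (\<forall>i\<in>obj J. \<iota> i \<in> hom C (fob D i) c) \<and>
     (\<forall>i\<in>obj J. \<forall>j\<in>obj J. \<forall>u\<in>hom J i j.
        cmp C (fob D i) (fob D j) c (\<iota> j) (far D i j u) = \<iota> i)"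

definition is_colimit ::
  "('j, 'i) cat \<Rightarrow> ('o, 'a) cat \<Rightarrow> ('j, 'i, 'o, 'a) fctr \<Rightarrow> 'o \<Rightarrow> ('j \<Rightarrow> 'a) \<Rightarrow> bool" where
  "is_colimit J C D c \<iota> \<longleftrightarrow>
     is_cocone J C D c \<iota> \<and>
     (\<forall>d \<kappa>. is_cocone J C D d \<kappa> \<longrightarrow>
        (\<exists>!h. h \<in> hom C c d \<and> (\<forall>j\<in>obj J. cmp C (fob D j) c d h (\<iota> j) = \<kappa> j)))"

definition is_cone ::
  "('j, 'i) cat \<Rightarrow> ('o, 'a) cat \<Rightarrow> ('j, 'i, 'o, 'a) fctr \<Rightarrow> 'o \<Rightarrow> ('j \<Rightarrow> 'a) \<Rightarrow> bool" where
  "is_cone J C D c \<pi> \<longleftrightarrow>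
     c \<in> obj C \<and>
     (\<forall>i\<in>obj J. \<pi> i \<in> hom C c (fob D i)) \<and>
     (\<forall>i\<in>obj J. \<forall>j\<in>obj J. \<forall>u\<in>hom J i j.
        cmp C c (fob D i) (fob D j) (far D i j u) (\<pi> i) = \<pi> j)"

definition is_limit ::
  "('j, 'i) cat \<Rightarrow> ('o, 'a) cat \<Rightarrow> ('j, 'i, 'o, 'a) fctr \<Rightarrow> 'o \<Rightarrow> ('j \<Rightarrow> 'a) \<Rightarrow> bool" where
  "is_limit J C D c \<pi> \<longleftrightarrow>
     is_cone J C D c \<pi> \<and>
     (\<forall>d \<kappa>. is_cone J C D d \<kappa> \<longrightarrow>
        (\<exists>!h. h \<in> hom C d c \<and> (\<forall>j\<in>obj J. cmp C d c (fob D j) (\<pi> j) h = \<kappa> j)))"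

text \<open>
  Any small (in particular any finite) category is isomorphic to one whose objects and arrows
  are elements of the infinite type \<open>'u\<close>, so it is enough to let the shapes range over those.
\<close>

definition preserves_small_colimits ::
  "'u itself \<Rightarrow> ('o, 'a) cat \<Rightarrow> ('p, 'b) cat \<Rightarrow> ('o, 'a, 'p, 'b) fctr \<Rightarrow> bool" where
  "preserves_small_colimits \<U> C E F \<longleftrightarrow>
     (\<forall>(J :: ('u, 'u) cat) D c \<iota>.
        small_category \<U> J \<and> is_functor J C D \<and> is_colimit J C D c \<iota> \<longrightarrow>
        is_colimit J E (comp_fctr F D) (fob F c) (\<lambda>j. far F (fob D j) c (\<iota> j)))"

definition preserves_finite_limits ::
  "'u itself \<Rightarrow> ('o, 'a) cat \<Rightarrow> ('p, 'b) cat \<Rightarrow> ('o, 'a, 'p, 'b) fctr \<Rightarrow> bool" where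
  "preserves_finite_limits \<U> C E F \<longleftrightarrow>
     (\<forall>(J :: ('u, 'u) cat) D c \<pi>.
        finite_category J \<and> is_functor J C D \<and> is_limit J C D c \<pi> \<longrightarrow>
        is_limit J E (comp_fctr F D) (fob F c) (\<lambda>j. far F c (fob D j) (\<pi> j)))"


section \<open>The category of sets, and the category of large sets and injections\<close>

definition set_cat :: "('u set, 'u \<Rightarrow> 'u) cat" where
  "set_cat =
     \<lparr> obj = {X. small TYPE('u) X},
       hom = (\<lambda>X Y. X \<rightarrow>\<^sub>E Y),
       idn = (\<lambda>X. \<lambda>x\<in>X. x),
       cmp = (\<lambda>X Y Z g f. compose X g f) \<rparr>"

definition set_mono_cat :: "'k rel \<Rightarrow> ('u set, 'u \<Rightarrow> 'u) cat" where
  "set_mono_cat \<kappa> =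
     set_cat\<lparr> obj := {X. small TYPE('u) X \<and> \<kappa> \<le>o |X|},
              hom := (\<lambda>X Y. {f \<in> X \<rightarrow>\<^sub>E Y. inj_on f X}) \<rparr>"


section \<open>Grothendieck toposes and their points\<close>

text \<open>A sieve on \<open>c\<close> is a set of pairs \<open>(d, f)\<close> with \<open>f : d \<rightarrow> c\<close>, closed under precomposition.\<close>

definition max_sieve :: "('o, 'a) cat \<Rightarrow> 'o \<Rightarrow> ('o \<times> 'a) set" where
  "max_sieve C c = {(d, f). d \<in> obj C \<and> f \<in> hom C d c}"

definition is_sieve :: "('o, 'a) cat \<Rightarrow> 'o \<Rightarrow> ('o \<times> 'a) set \<Rightarrow> bool" where
  "is_sieve C c S \<longleftrightarrow>
     S \<subseteq> max_sieve C c \<and>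
     (\<forall>(d, f)\<in>S. \<forall>e\<in>obj C. \<forall>g\<in>hom C e d. (e, cmp C e d c f g) \<in> S)"

definition pullback_sieve ::
  "('o, 'a) cat \<Rightarrow> 'o \<Rightarrow> 'o \<Rightarrow> 'a \<Rightarrow> ('o \<times> 'a) set \<Rightarrow> ('o \<times> 'a) set" where
  "pullback_sieve C d c h S = {(e, g). e \<in> obj C \<and> g \<in> hom C e d \<and> (e, cmp C e d c h g) \<in> S}"

definition grothendieck_topology :: "('o, 'a) cat \<Rightarrow> ('o \<Rightarrow> ('o \<times> 'a) set set) \<Rightarrow> bool" where
  "grothendieck_topology C Cov \<longleftrightarrow>
     (\<forall>c\<in>obj C. \<forall>S\<in>Cov c. is_sieve C c S) \<and>
     (\<forall>c\<in>obj C. max_sieve C c \<in> Cov c) \<and>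
     (\<forall>c\<in>obj C. \<forall>d\<in>obj C. \<forall>S\<in>Cov c. \<forall>h\<in>hom C d c. pullback_sieve C d c h S \<in> Cov d) \<and>
     (\<forall>c\<in>obj C. \<forall>S\<in>Cov c. \<forall>R.
        is_sieve C c R \<and> (\<forall>(d, h)\<in>S. pullback_sieve C d c h R \<in> Cov d) \<longrightarrow> R \<in> Cov c)"

text \<open>
  For a presheaf \<open>P\<close>, \<open>far P c d f : P c \<rightarrow> P d\<close> is restriction along \<open>f : d \<rightarrow> c\<close>.
\<close>

definition matching_family ::
  "('o, 'a) cat \<Rightarrow> ('o, 'a, 'u set, 'u \<Rightarrow> 'u) fctr \<Rightarrow> 'o \<Rightarrow> ('o \<times> 'a) set \<Rightarrow> ('o \<Rightarrow> 'a \<Rightarrow> 'u) \<Rightarrow> bool"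
  where
  "matching_family C P c S x \<longleftrightarrow>
     (\<forall>(d, f)\<in>S. x d f \<in> fob P d) \<and>
     (\<forall>(d, f)\<in>S. \<forall>e\<in>obj C. \<forall>g\<in>hom C e d. far P d e g (x d f) = x e (cmp C e d c f g))"

definition is_sheaf ::
  "('o, 'a) cat \<Rightarrow> ('o \<Rightarrow> ('o \<times> 'a) set set) \<Rightarrow> ('o, 'a, 'u set, 'u \<Rightarrow> 'u) fctr \<Rightarrow> bool" where
  "is_sheaf C Cov P \<longleftrightarrow>
     is_functor (op_cat C) set_cat P \<and>
     (\<forall>c\<in>obj C. \<forall>S\<in>Cov c. \<forall>x. matching_family C P c S x \<longrightarrow>
        (\<exists>!y. y \<in> fob P c \<and> (\<forall>(d, f)\<in>S. far P c d f y = x d f)))"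

definition sheaf_cat ::
  "('o, 'a) cat \<Rightarrow> ('o \<Rightarrow> ('o \<times> 'a) set set) \<Rightarrow>
     (('o, 'a, 'u set, 'u \<Rightarrow> 'u) fctr, 'o \<Rightarrow> 'u \<Rightarrow> 'u) cat" where
  "sheaf_cat C Cov = full_subcat (fctr_cat (op_cat C) set_cat) (is_sheaf C Cov)"

definition grothendieck_topos :: "'u itself \<Rightarrow> ('o, 'a) cat \<Rightarrow> bool" where
  "grothendieck_topos \<U> T \<longleftrightarrow>
     is_category T \<and>
     (\<exists>(C :: ('u, 'u) cat) Cov.
        small_category \<U> C \<and> grothendieck_topology C Cov \<and>
        equivalent T (sheaf_cat C Cov :: (('u, 'u, 'u set, 'u \<Rightarrow> 'u) fctr, 'u \<Rightarrow> 'u \<Rightarrow> 'u) cat))"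

definition is_point :: "('o, 'a) cat \<Rightarrow> ('o, 'a, 'u set, 'u \<Rightarrow> 'u) fctr \<Rightarrow> bool" where
  "is_point T p \<longleftrightarrow>
     is_functor T set_cat p \<and>
     preserves_small_colimits TYPE('u) T set_cat p \<and>
     preserves_finite_limits TYPE('u) T set_cat p"

definition point_cat ::
  "('o, 'a) cat \<Rightarrow> (('o, 'a, 'u set, 'u \<Rightarrow> 'u) fctr, 'o \<Rightarrow> 'u \<Rightarrow> 'u) cat" where
  "point_cat T = full_subcat (fctr_cat T set_cat) (is_point T)"


section \<open>Infinitary logic with finite quantifiers\<close>

record ('s, 'f, 'r) fo_sig =
  sorts :: "'s set"
  funs :: "'f set"
  rels :: "'r set"
  fun_args :: "'f \<Rightarrow> 's list"
  fun_res :: "'f \<Rightarrow> 's"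
  rel_args :: "'r \<Rightarrow> 's list"

definition small_signature :: "'u itself \<Rightarrow> ('s, 'f, 'r) fo_sig \<Rightarrow> bool" where
  "small_signature \<U> \<Sigma> \<longleftrightarrow>
     small \<U> (sorts \<Sigma>) \<and> small \<U> (funs \<Sigma>) \<and> small \<U> (rels \<Sigma>) \<and>
     (\<forall>f\<in>funs \<Sigma>. set (fun_args \<Sigma> f) \<subseteq> sorts \<Sigma> \<and> fun_res \<Sigma> f \<in> sorts \<Sigma>) \<and>
     (\<forall>r\<in>rels \<Sigma>. set (rel_args \<Sigma> r) \<subseteq> sorts \<Sigma>)"

text \<open>\<open>Var n s\<close> is the \<open>n\<close>-th variable of sort \<open>s\<close>.\<close>

datatype ('s, 'f) trm =
    Var nat 's
  | App 'f "('s, 'f) trm list"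

text \<open>
  \<open>Conj I \<phi>\<close> and \<open>Disj I \<phi>\<close> are the conjunction and the disjunction of the family \<open>(\<phi> i)\<close>
  indexed by \<open>i \<in> I\<close>; the values of \<open>\<phi>\<close> outside \<open>I\<close> are irrelevant. That \<open>I\<close> is small is part of
  \<open>well_formed\<close> below.
\<close>

datatype ('s, 'f, 'r, 'u) fml =
    Eq "('s, 'f) trm" "('s, 'f) trm"
  | Rel 'r "('s, 'f) trm list"
  | Neg "('s, 'f, 'r, 'u) fml"
  | Conj "'u set" "'u \<Rightarrow> ('s, 'f, 'r, 'u) fml"
  | Disj "'u set" "'u \<Rightarrow> ('s, 'f, 'r, 'u) fml"
  | Ex nat 's "('s, 'f, 'r, 'u) fml"
  | All nat 's "('s, 'f, 'r, 'u) fml"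

inductive has_sort :: "('s, 'f, 'r) fo_sig \<Rightarrow> ('s, 'f) trm \<Rightarrow> 's \<Rightarrow> bool" for \<Sigma> where
  "s \<in> sorts \<Sigma> \<Longrightarrow> has_sort \<Sigma> (Var n s) s"
| "f \<in> funs \<Sigma> \<Longrightarrow> list_all2 (has_sort \<Sigma>) ts (fun_args \<Sigma> f) \<Longrightarrow>
     has_sort \<Sigma> (App f ts) (fun_res \<Sigma> f)"

primrec well_formed :: "('s, 'f, 'r) fo_sig \<Rightarrow> ('s, 'f, 'r, 'u) fml \<Rightarrow> bool" where
  "well_formed \<Sigma> (Eq t u) \<longleftrightarrow> (\<exists>s. has_sort \<Sigma> t s \<and> has_sort \<Sigma> u s)"
| "well_formed \<Sigma> (Rel r ts) \<longleftrightarrow> r \<in> rels \<Sigma> \<and> list_all2 (has_sort \<Sigma>) ts (rel_args \<Sigma> r)"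
| "well_formed \<Sigma> (Neg \<phi>) \<longleftrightarrow> well_formed \<Sigma> \<phi>"
| "well_formed \<Sigma> (Conj I \<phi>) \<longleftrightarrow> small TYPE('u) I \<and> (\<forall>i\<in>I. well_formed \<Sigma> (\<phi> i))"
| "well_formed \<Sigma> (Disj I \<phi>) \<longleftrightarrow> small TYPE('u) I \<and> (\<forall>i\<in>I. well_formed \<Sigma> (\<phi> i))"
| "well_formed \<Sigma> (Ex n s \<phi>) \<longleftrightarrow> s \<in> sorts \<Sigma> \<and> well_formed \<Sigma> \<phi>"
| "well_formed \<Sigma> (All n s \<phi>) \<longleftrightarrow> s \<in> sorts \<Sigma> \<and> well_formed \<Sigma> \<phi>"

primrec trm_vars :: "('s, 'f) trm \<Rightarrow> (nat \<times> 's) set" where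
  "trm_vars (Var n s) = {(n, s)}"
| "trm_vars (App f ts) = \<Union> (set (map trm_vars ts))"

primrec free_vars :: "('s, 'f, 'r, 'u) fml \<Rightarrow> (nat \<times> 's) set" where
  "free_vars (Eq t u) = trm_vars t \<union> trm_vars u"
| "free_vars (Rel r ts) = \<Union> (trm_vars ` set ts)"
| "free_vars (Neg \<phi>) = free_vars \<phi>"
| "free_vars (Conj I \<phi>) = (\<Union>i\<in>I. free_vars (\<phi> i))"
| "free_vars (Disj I \<phi>) = (\<Union>i\<in>I. free_vars (\<phi> i))"
| "free_vars (Ex n s \<phi>) = free_vars \<phi> - {(n, s)}"
| "free_vars (All n s \<phi>) = free_vars \<phi> - {(n, s)}"

text \<open>
  As usual for finite quantifiers, a formula has only finitely many free variables; the same
  then holds for each of its subformulas.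
\<close>

definition is_formula :: "('s, 'f, 'r) fo_sig \<Rightarrow> ('s, 'f, 'r, 'u) fml \<Rightarrow> bool" where
  "is_formula \<Sigma> \<phi> \<longleftrightarrow> well_formed \<Sigma> \<phi> \<and> finite (free_vars \<phi>)"

definition is_sentence :: "('s, 'f, 'r) fo_sig \<Rightarrow> ('s, 'f, 'r, 'u) fml \<Rightarrow> bool" where
  "is_sentence \<Sigma> \<phi> \<longleftrightarrow> well_formed \<Sigma> \<phi> \<and> free_vars \<phi> = {}"

definition is_theory :: "('s, 'f, 'r) fo_sig \<Rightarrow> ('s, 'f, 'r, 'u) fml set \<Rightarrow> bool" where
  "is_theory \<Sigma> Th \<longleftrightarrow> small TYPE('u) Th \<and> (\<forall>\<phi>\<in>Th. is_sentence \<Sigma> \<phi>)"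

text \<open>
  Carriers may be empty. The values of a structure outside the sorts and symbols of the
  signature, or on arguments outside the carriers, are irrelevant: structures differing only
  there are isomorphic.
\<close>

record ('s, 'f, 'r, 'u) struct =
  carr :: "'s \<Rightarrow> 'u set"
  fun_int :: "'f \<Rightarrow> 'u list \<Rightarrow> 'u"
  rel_int :: "'r \<Rightarrow> 'u list set"

definition is_structure :: "('s, 'f, 'r) fo_sig \<Rightarrow> ('s, 'f, 'r, 'u) struct \<Rightarrow> bool" where
  "is_structure \<Sigma> M \<longleftrightarrow>
     (\<forall>s\<in>sorts \<Sigma>. small TYPE('u) (carr M s)) \<and>
     (\<forall>f\<in>funs \<Sigma>. \<forall>as. list_all2 (\<lambda>a s. a \<in> carr M s) as (fun_args \<Sigma> f) \<longrightarrow>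
        fun_int M f as \<in> carr M (fun_res \<Sigma> f))"

primrec trm_val :: "('s, 'f, 'r, 'u) struct \<Rightarrow> (nat \<times> 's \<Rightarrow> 'u) \<Rightarrow> ('s, 'f) trm \<Rightarrow> 'u" where
  "trm_val M v (Var n s) = v (n, s)"
| "trm_val M v (App f ts) = fun_int M f (map (trm_val M v) ts)"

primrec sat :: "('s, 'f, 'r, 'u) struct \<Rightarrow> ('s, 'f, 'r, 'u) fml \<Rightarrow> (nat \<times> 's \<Rightarrow> 'u) \<Rightarrow> bool" where
  "sat M (Eq t u) = (\<lambda>v. trm_val M v t = trm_val M v u)"
| "sat M (Rel r ts) = (\<lambda>v. map (trm_val M v) ts \<in> rel_int M r)"
| "sat M (Neg \<phi>) = (\<lambda>v. \<not> sat M \<phi> v)"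
| "sat M (Conj I \<phi>) = (\<lambda>v. \<forall>i\<in>I. sat M (\<phi> i) v)"
| "sat M (Disj I \<phi>) = (\<lambda>v. \<exists>i\<in>I. sat M (\<phi> i) v)"
| "sat M (Ex n s \<phi>) = (\<lambda>v. \<exists>a\<in>carr M s. sat M \<phi> (v((n, s) := a)))"
| "sat M (All n s \<phi>) = (\<lambda>v. \<forall>a\<in>carr M s. sat M \<phi> (v((n, s) := a)))"

text \<open>The truth value of a sentence does not depend on the valuation.\<close>

definition is_model ::
  "('s, 'f, 'r) fo_sig \<Rightarrow> ('s, 'f, 'r, 'u) fml set \<Rightarrow> ('s, 'f, 'r, 'u) struct \<Rightarrow> bool" where
  "is_model \<Sigma> Th M \<longleftrightarrow> is_structure \<Sigma> M \<and> (\<forall>\<phi>\<in>Th. \<forall>v. sat M \<phi> v)"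

definition elementary_embeddings ::
  "('s, 'f, 'r) fo_sig \<Rightarrow> ('s, 'f, 'r, 'u) struct \<Rightarrow> ('s, 'f, 'r, 'u) struct \<Rightarrow> ('s \<Rightarrow> 'u \<Rightarrow> 'u) set"
  where
  "elementary_embeddings \<Sigma> M N =
     {h \<in> (\<Pi>\<^sub>E s\<in>sorts \<Sigma>. carr M s \<rightarrow>\<^sub>E carr N s).
        \<forall>(\<phi> :: ('s, 'f, 'r, 'u) fml) v.
          is_formula \<Sigma> \<phi> \<and> (\<forall>(n, s)\<in>free_vars \<phi>. v (n, s) \<in> carr M s) \<longrightarrow>
          (sat M \<phi> v \<longleftrightarrow> sat N \<phi> (\<lambda>(n, s). h s (v (n, s))))}"

definition model_cat ::
  "('s, 'f, 'r) fo_sig \<Rightarrow> ('s, 'f, 'r, 'u) fml set \<Rightarrow>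
     (('s, 'f, 'r, 'u) struct, 's \<Rightarrow> 'u \<Rightarrow> 'u) cat" where
  "model_cat \<Sigma> Th =
     \<lparr> obj = {M. is_model \<Sigma> Th M},
       hom = elementary_embeddings \<Sigma>,
       idn = (\<lambda>M. \<lambda>s\<in>sorts \<Sigma>. \<lambda>x\<in>carr M s. x),
       cmp = (\<lambda>M N K g h. \<lambda>s\<in>sorts \<Sigma>. compose (carr M s) (g s) (h s)) \<rparr>"


section \<open>The constructions above yield categories\<close>

lemma compose_assoc_PiE: "f \<in> W \<rightarrow>\<^sub>E X \<Longrightarrow> compose W (compose X h g) f = compose W h (compose W g f)"
  by (auto simp: compose_def fun_eq_iff)

lemma compose_id_PiE:
  assumes "f \<in> X \<rightarrow>\<^sub>E Y"
  shows "compose X f (\<lambda>x\<in>X. x) = f" "compose X (\<lambda>y\<in>Y. y) f = f"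
  using assms by (intro extensionalityI[of _ X]; auto simp: compose_def PiE_iff)+

lemma inj_on_compose_PiE:
  assumes "f \<in> X \<rightarrow>\<^sub>E Y" "inj_on f X" "inj_on g Y"
  shows "inj_on (compose X g f) X"
proof (rule inj_onI)
  fix x y assume xy: "x \<in> X" "y \<in> X" "compose X g f x = compose X g f y"
  then have "f x \<in> Y" "f y \<in> Y" "g (f x) = g (f y)" using assms(1) by (auto simp: compose_def)
  then have "f x = f y" using assms(3) by (auto dest: inj_onD)
  then show "x = y" using assms(2) xy by (auto dest: inj_onD)
qed

lemma compose_in_PiE: "f \<in> X \<rightarrow>\<^sub>E Y \<Longrightarrow> g \<in> Y \<rightarrow>\<^sub>E Z \<Longrightarrow> compose X g f \<in> X \<rightarrow>\<^sub>E Z"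
  by (auto simp: compose_def)

lemma is_category_set_cat: "is_category (set_cat :: ('u set, 'u \<Rightarrow> 'u) cat)"
  by (simp add: is_category_def set_cat_def compose_assoc_PiE compose_id_PiE compose_in_PiE)

lemma is_category_set_mono_cat: "is_category (set_mono_cat \<kappa> :: ('u set, 'u \<Rightarrow> 'u) cat)"
  unfolding is_category_def
proof (intro conjI ballI)
  fix X Y Z f g
  assume "f \<in> hom (set_mono_cat \<kappa> :: ('u set, 'u \<Rightarrow> 'u) cat) X Y"
    and "g \<in> hom (set_mono_cat \<kappa> :: ('u set, 'u \<Rightarrow> 'u) cat) Y Z"
  then have "f \<in> X \<rightarrow>\<^sub>E Y" "inj_on f X" "g \<in> Y \<rightarrow>\<^sub>E Z" "inj_on g Y"
    by (simp_all add: set_mono_cat_def)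
  then show "cmp (set_mono_cat \<kappa>) X Y Z g f \<in> hom (set_mono_cat \<kappa>) X Z"
    by (simp add: set_mono_cat_def set_cat_def compose_in_PiE[of _ _ Y] inj_on_compose_PiE[of _ _ Y])
next
  fix X Y f
  assume "f \<in> hom (set_mono_cat \<kappa> :: ('u set, 'u \<Rightarrow> 'u) cat) X Y"
  then have "f \<in> X \<rightarrow>\<^sub>E Y" by (simp add: set_mono_cat_def)
  then show "cmp (set_mono_cat \<kappa>) X X Y f (idn (set_mono_cat \<kappa>) X) = f"
    and "cmp (set_mono_cat \<kappa>) X Y Y (idn (set_mono_cat \<kappa>) Y) f = f"
    by (simp_all add: set_mono_cat_def set_cat_def compose_id_PiE)
qed (simp_all add: set_mono_cat_def set_cat_def compose_assoc_PiE inj_on_restrict_eq)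

lemma is_category_op: "is_category C \<Longrightarrow> is_category (op_cat C)"
  unfolding is_category_def op_cat_def by simp

lemma is_category_full_subcat: "is_category C \<Longrightarrow> is_category (full_subcat C P)"
  unfolding is_category_def full_subcat_def by simp

lemma is_category_fctr_cat:
  assumes C: "is_category C" and D: "is_category D"
  shows "is_category (fctr_cat C D)"
proof -
  have cl: "\<And>X Y Z f g. X \<in> obj D \<Longrightarrow> Y \<in> obj D \<Longrightarrow> Z \<in> obj D \<Longrightarrow> f \<in> hom D X Y \<Longrightarrow> g \<in> hom D Y Z
     \<Longrightarrow> cmp D X Y Z g f \<in> hom D X Z"
   and idr: "\<And>X Y f. X \<in> obj D \<Longrightarrow> Y \<in> obj D \<Longrightarrow> f \<in> hom D X Y \<Longrightarrow> cmp D X X Y f (idn D X) = f"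
   and idl: "\<And>X Y f. X \<in> obj D \<Longrightarrow> Y \<in> obj D \<Longrightarrow> f \<in> hom D X Y \<Longrightarrow> cmp D X Y Y (idn D Y) f = f"
   and idh: "\<And>X. X \<in> obj D \<Longrightarrow> idn D X \<in> hom D X X"
   and as: "\<And>W X Y Z f g h. W \<in> obj D \<Longrightarrow> X \<in> obj D \<Longrightarrow> Y \<in> obj D \<Longrightarrow> Z \<in> obj D \<Longrightarrow>
      f \<in> hom D W X \<Longrightarrow> g \<in> hom D X Y \<Longrightarrow> h \<in> hom D Y Z \<Longrightarrow>
      cmp D W X Z (cmp D X Y Z h g) f = cmp D W Y Z h (cmp D W X Y g f)"
    using D unfolding is_category_def by blast+
  have F: "\<And>F X. is_functor C D F \<Longrightarrow> X \<in> obj C \<Longrightarrow> fob F X \<in> obj D"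
    and Fa: "\<And>F X Y f. is_functor C D F \<Longrightarrow> X \<in> obj C \<Longrightarrow> Y \<in> obj C \<Longrightarrow> f \<in> hom C X Y \<Longrightarrow>
      far F X Y f \<in> hom D (fob F X) (fob F Y)"
    unfolding is_functor_def by blast+
  have N: "\<And>F G \<alpha> X. \<alpha> \<in> nat_trans C D F G \<Longrightarrow> X \<in> obj C \<Longrightarrow> \<alpha> X \<in> hom D (fob F X) (fob G X)"
    and Ne: "\<And>F G \<alpha>. \<alpha> \<in> nat_trans C D F G \<Longrightarrow> \<alpha> \<in> extensional (obj C)"
    and Nn: "\<And>F G \<alpha> X Y f. \<alpha> \<in> nat_trans C D F G \<Longrightarrow> X \<in> obj C \<Longrightarrow> Y \<in> obj C \<Longrightarrow> f \<in> hom C X Y \<Longrightarrow>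
       cmp D (fob F X) (fob F Y) (fob G Y) (\<alpha> Y) (far F X Y f)
            = cmp D (fob F X) (fob G X) (fob G Y) (far G X Y f) (\<alpha> X)"
    unfolding nat_trans_def by (auto simp: PiE_iff)
  show ?thesis
    unfolding is_category_def
  proof (intro conjI ballI)
    fix F assume "F \<in> obj (fctr_cat C D)"
    then show "idn (fctr_cat C D) F \<in> hom (fctr_cat C D) F F"
      by (auto simp: fctr_cat_def nat_trans_def idh F Fa idl idr)
  next
    fix F G H \<alpha> \<beta>
    assume *: "F \<in> obj (fctr_cat C D)" "G \<in> obj (fctr_cat C D)" "H \<in> obj (fctr_cat C D)"
      "\<alpha> \<in> hom (fctr_cat C D) F G" "\<beta> \<in> hom (fctr_cat C D) G H"
    have a: "\<alpha> \<in> nat_trans C D F G" and b: "\<beta> \<in> nat_trans C D G H" 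
      and f: "is_functor C D F" "is_functor C D G" "is_functor C D H"
      using * by (auto simp: fctr_cat_def)
    have n: "cmp D (fob F X) (fob F Y) (fob H Y) (cmp D (fob F Y) (fob G Y) (fob H Y) (\<beta> Y) (\<alpha> Y)) (far F X Y u)
      = cmp D (fob F X) (fob H X) (fob H Y) (far H X Y u) (cmp D (fob F X) (fob G X) (fob H X) (\<beta> X) (\<alpha> X))"
      if x: "X \<in> obj C" "Y \<in> obj C" "u \<in> hom C X Y" for X Y u
    proof -
      note s = F[OF f(1)] F[OF f(2)] F[OF f(3)] Fa[OF f(1)] Fa[OF f(2)] Fa[OF f(3)] N[OF a] N[OF b] x
      have "cmp D (fob F X) (fob F Y) (fob H Y) (cmp D (fob F Y) (fob G Y) (fob H Y) (\<beta> Y) (\<alpha> Y)) (far F X Y u)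
        = cmp D (fob F X) (fob G Y) (fob H Y) (\<beta> Y) (cmp D (fob F X) (fob F Y) (fob G Y) (\<alpha> Y) (far F X Y u))"
        by (rule as) (simp_all add: s)
      also have "\<dots> = cmp D (fob F X) (fob G Y) (fob H Y) (\<beta> Y) (cmp D (fob F X) (fob G X) (fob G Y) (far G X Y u) (\<alpha> X))"
        by (simp add: Nn[OF a x])
      also have "\<dots> = cmp D (fob F X) (fob G X) (fob H Y) (cmp D (fob G X) (fob G Y) (fob H Y) (\<beta> Y) (far G X Y u)) (\<alpha> X)"
        by (rule as[symmetric]) (simp_all add: s)
      also have "\<dots> = cmp D (fob F X) (fob G X) (fob H Y) (cmp D (fob G X) (fob H X) (fob H Y) (far H X Y u) (\<beta> X)) (\<alpha> X)"
        by (simp add: Nn[OF b x])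
      also have "\<dots> = cmp D (fob F X) (fob H X) (fob H Y) (far H X Y u) (cmp D (fob F X) (fob G X) (fob H X) (\<beta> X) (\<alpha> X))"
        by (rule as) (simp_all add: s)
      finally show ?thesis .
    qed
    show "cmp (fctr_cat C D) F G H \<beta> \<alpha> \<in> hom (fctr_cat C D) F H"
      unfolding fctr_cat_def cat.simps nat_trans_def
      using n by (auto intro!: cl F f N[OF a] N[OF b])
  next
    fix F G \<alpha> assume *: "F \<in> obj (fctr_cat C D)" "G \<in> obj (fctr_cat C D)" "\<alpha> \<in> hom (fctr_cat C D) F G"
    then show "cmp (fctr_cat C D) F F G \<alpha> (idn (fctr_cat C D) F) = \<alpha>"
      and "cmp (fctr_cat C D) F G G (idn (fctr_cat C D) G) \<alpha> = \<alpha>"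
      using Ne[of \<alpha> F G] by (auto simp: fctr_cat_def fun_eq_iff extensional_def idl idr N F)
  next
    fix E F G H \<alpha> \<beta> \<gamma>
    assume *: "E \<in> obj (fctr_cat C D)" "F \<in> obj (fctr_cat C D)" "G \<in> obj (fctr_cat C D)" "H \<in> obj (fctr_cat C D)"
      "\<alpha> \<in> hom (fctr_cat C D) E F" "\<beta> \<in> hom (fctr_cat C D) F G" "\<gamma> \<in> hom (fctr_cat C D) G H"
    then show "cmp (fctr_cat C D) E F H (cmp (fctr_cat C D) F G H \<gamma> \<beta>) \<alpha>
       = cmp (fctr_cat C D) E G H \<gamma> (cmp (fctr_cat C D) E F G \<beta> \<alpha>)"
      by (auto simp: fctr_cat_def fun_eq_iff as N F)
  qed
qed

lemma trm_val_cong: "(\<And>x. x \<in> trm_vars t \<Longrightarrow> v x = w x) \<Longrightarrow> trm_val M v t = trm_val M w t"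
proof (induction t)
  case (App f ts)
  then have "map (trm_val M v) ts = map (trm_val M w) ts" by fastforce
  then show ?case by (simp only: trm_val.simps)
qed simp

lemma sat_cong: "(\<And>x. x \<in> free_vars \<phi> \<Longrightarrow> v x = w x) \<Longrightarrow> sat M \<phi> v = sat M \<phi> w"
proof (induction \<phi> arbitrary: v w)
  case (Eq t u)
  then show ?case using trm_val_cong[of t v w M] trm_val_cong[of u v w M] by simp
next
  case (Rel r ts)
  then have "map (trm_val M v) ts = map (trm_val M w) ts" by (auto intro!: trm_val_cong)
  then show ?case by (simp only: sat.simps)
next
  case (Neg \<phi>)
  have "sat M \<phi> v = sat M \<phi> w" by (rule Neg.IH) (use Neg.prems in auto)
  then show ?case by simp
next
  case (Conj I \<phi>)
  have "\<And>i. i \<in> I \<Longrightarrow> sat M (\<phi> i) v = sat M (\<phi> i) w" by (rule Conj.IH) (use Conj.prems in auto)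
  then show ?case by simp
next
  case (Disj I \<phi>)
  have "\<And>i. i \<in> I \<Longrightarrow> sat M (\<phi> i) v = sat M (\<phi> i) w" by (rule Disj.IH) (use Disj.prems in auto)
  then show ?case by simp
next
  case (Ex n s \<phi>)
  have "\<And>a. sat M \<phi> (v((n,s):=a)) = sat M \<phi> (w((n,s):=a))" by (rule Ex.IH) (use Ex.prems in auto)
  then show ?case by simp
next
  case (All n s \<phi>)
  have "\<And>a. sat M \<phi> (v((n,s):=a)) = sat M \<phi> (w((n,s):=a))" by (rule All.IH) (use All.prems in auto)
  then show ?case by simp
qed

lemma trm_vars_sorts: "has_sort \<Sigma> t s \<Longrightarrow> trm_vars t \<subseteq> UNIV \<times> sorts \<Sigma>"
proof (induction rule: has_sort.induct)
  case (2 f ts) then show ?case by (fastforce simp: list_all2_conv_all_nth in_set_conv_nth)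
qed auto

lemma free_vars_sorts: "well_formed \<Sigma> \<phi> \<Longrightarrow> free_vars \<phi> \<subseteq> UNIV \<times> sorts \<Sigma>"
proof (induction \<phi>)
  case (Eq t u)
  then obtain s where "has_sort \<Sigma> t s" "has_sort \<Sigma> u s" by auto
  then show ?case using trm_vars_sorts[of \<Sigma> t s] trm_vars_sorts[of \<Sigma> u s] by simp
next
  case (Rel r ts)
  have "trm_vars t \<subseteq> UNIV \<times> sorts \<Sigma>" if t: "t \<in> set ts" for t
  proof -
    obtain i where "t = ts ! i" "i < length ts" using t by (metis in_set_conv_nth)
    then have "has_sort \<Sigma> t (rel_args \<Sigma> r ! i)" using Rel by (simp add: list_all2_conv_all_nth)
    then show ?thesis by (rule trm_vars_sorts)
  qed
  then show ?case by (simp add: UN_subset_iff)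
next
  case (Conj I \<phi>)
  then have "\<And>i. i \<in> I \<Longrightarrow> free_vars (\<phi> i) \<subseteq> UNIV \<times> sorts \<Sigma>" by simp
  then show ?case by (simp add: UN_subset_iff)
next
  case (Disj I \<phi>)
  then have "\<And>i. i \<in> I \<Longrightarrow> free_vars (\<phi> i) \<subseteq> UNIV \<times> sorts \<Sigma>" by simp
  then show ?case by (simp add: UN_subset_iff)
qed auto

lemma is_category_model_cat: "is_category (model_cat \<Sigma> (Th :: ('s,'f,'r,'u) fml set))"
  unfolding is_category_def
proof (intro conjI ballI)
  fix M assume "M \<in> obj (model_cat \<Sigma> Th)"
  have "sat M \<phi> v = sat M \<phi> (\<lambda>(n,s). (\<lambda>s\<in>sorts \<Sigma>. \<lambda>x\<in>carr M s. x) s (v (n,s)))"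
    if "is_formula \<Sigma> \<phi>" "\<forall>(n,s)\<in>free_vars \<phi>. v (n,s) \<in> carr M s" for \<phi> :: "('s,'f,'r,'u) fml" and v
    by (rule sat_cong) (use that free_vars_sorts[of \<Sigma> \<phi>] in \<open>auto simp: is_formula_def restrict_def\<close>)
  then show "idn (model_cat \<Sigma> Th) M \<in> hom (model_cat \<Sigma> Th) M M"
    unfolding model_cat_def elementary_embeddings_def by (auto simp del: restrict_apply)
next
  fix M N K h g
  assume "h \<in> hom (model_cat \<Sigma> Th) M N" "g \<in> hom (model_cat \<Sigma> Th) N K"
  then have h: "h \<in> elementary_embeddings \<Sigma> M N" and g: "g \<in> elementary_embeddings \<Sigma> N K"
    by (auto simp: model_cat_def)
  have "sat M \<phi> v = sat K \<phi> (\<lambda>(n,s). (\<lambda>s\<in>sorts \<Sigma>. compose (carr M s) (g s) (h s)) s (v (n,s)))"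
    if p: "is_formula \<Sigma> \<phi>" "\<forall>(n,s)\<in>free_vars \<phi>. v (n,s) \<in> carr M s" for \<phi> :: "('s,'f,'r,'u) fml" and v
  proof -
    let ?w = "\<lambda>(n,s). h s (v (n,s))"
    have fs: "free_vars \<phi> \<subseteq> UNIV \<times> sorts \<Sigma>" using p free_vars_sorts by (auto simp: is_formula_def)
    have "sat M \<phi> v = sat N \<phi> ?w" using h p by (auto simp: elementary_embeddings_def)
    also have "\<forall>(n,s)\<in>free_vars \<phi>. ?w (n,s) \<in> carr N s"
      using h p fs by (fastforce simp: elementary_embeddings_def PiE_iff)
    then have "sat N \<phi> ?w = sat K \<phi> (\<lambda>(n,s). g s (?w (n,s)))"
      using g p unfolding elementary_embeddings_def by blast
    also have "\<dots> = sat K \<phi> (\<lambda>(n,s). (\<lambda>s\<in>sorts \<Sigma>. compose (carr M s) (g s) (h s)) s (v (n,s)))"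
      by (rule sat_cong) (use p fs in \<open>auto simp: compose_def\<close>)
    finally show ?thesis .
  qed
  moreover have "(\<lambda>s\<in>sorts \<Sigma>. compose (carr M s) (g s) (h s)) \<in> (\<Pi>\<^sub>E s\<in>sorts \<Sigma>. carr M s \<rightarrow>\<^sub>E carr K s)"
    using h g by (fastforce simp: elementary_embeddings_def PiE_iff compose_def)
  ultimately show "cmp (model_cat \<Sigma> Th) M N K g h \<in> hom (model_cat \<Sigma> Th) M K"
    unfolding model_cat_def by (simp add: elementary_embeddings_def del: restrict_apply)
next
  fix M N h assume "h \<in> hom (model_cat \<Sigma> Th) M N"
  then have h: "h \<in> extensional (sorts \<Sigma>)" "\<And>s. s \<in> sorts \<Sigma> \<Longrightarrow> h s \<in> carr M s \<rightarrow>\<^sub>E carr N s"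
    by (auto simp: model_cat_def elementary_embeddings_def PiE_iff)
  show "cmp (model_cat \<Sigma> Th) M M N h (idn (model_cat \<Sigma> Th) M) = h"
    by (rule extensionalityI[of _ "sorts \<Sigma>"], simp add: model_cat_def, rule h(1),
        rule extensionalityI[of _ "carr M _"])
       (use h(2) in \<open>auto simp: model_cat_def compose_def PiE_iff\<close>)
  show "cmp (model_cat \<Sigma> Th) M N N (idn (model_cat \<Sigma> Th) N) h = h"
    by (rule extensionalityI[of _ "sorts \<Sigma>"], simp add: model_cat_def, rule h(1),
        rule extensionalityI[of _ "carr M _"])
       (use h(2) in \<open>auto simp: model_cat_def compose_def PiE_iff\<close>)
next
  fix L M N K f g h
  assume "f \<in> hom (model_cat \<Sigma> Th) L M"
  then have f: "\<And>s x. s \<in> sorts \<Sigma> \<Longrightarrow> x \<in> carr L s \<Longrightarrow> f s x \<in> carr M s"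
    by (auto simp: model_cat_def elementary_embeddings_def PiE_iff)
  show "cmp (model_cat \<Sigma> Th) L M K (cmp (model_cat \<Sigma> Th) M N K h g) f
      = cmp (model_cat \<Sigma> Th) L N K h (cmp (model_cat \<Sigma> Th) L M N g f)"
    by (auto simp: model_cat_def compose_def fun_eq_iff f)
qed

end

theory Submission
  imports Defs "HOL-Combinatorics.Transposition"
begin

text \<open>
  Suppose \<open>F\<close> is an equivalence from the large sets and injections to a category of points, or to a
  category of models. Take \<open>Y\<close> of size \<open>\<kappa>\<close> and a countably infinite \<open>V \<subseteq> Y\<close>. The equivalence
  preserves unions of chains of large subsets of \<open>Y\<close>, and these are computed elementwise in the target, so
  every element of \<open>F Y\<close> comes from \<open>F A\<close> for some member \<open>A\<close> of the chain. As \<open>\<kappa>\<close> is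
  uncountable, removing countably many elements from \<open>Y\<close> leaves a large set; hence every element of
  \<open>F Y\<close> has a finite support, a finite \<open>W \<subseteq> Y\<close> such that all transpositions outside \<open>W\<close> fix
  the element. The elements with a support inside \<open>V\<close> form a subobject \<open>P\<close> of \<open>F Y\<close>: finitely many
  elements can be moved into \<open>P\<close> by transpositions that fix those already in \<open>P\<close>, and only finitely
  many elements matter for a finite limit, for a zigzag witnessing an identification in a colimit, or
  for the Tarski--Vaught criterion. Now \<open>P \<cong> F X\<close> for a large \<open>X\<close>, and the inclusion of \<open>P\<close> is
  induced by an injection \<open>X \<rightarrow> Y\<close> that is invariant under all transpositions outside \<open>V\<close>. Its image
  lies in \<open>V\<close>, so \<open>X\<close> is countable, a contradiction.
\<close>

section \<open>Equivalences of categories\<close>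

text \<open>An equivalence does not by itself relate the elements of \<open>fob F Y\<close> to those
  of \<open>Y\<close>. Supports recover such a relation from the action of the transpositions of
  \<open>Y\<close> alone, since \<open>F\<close> is faithful and arrows of the target are determined
  by what they do to elements.

  Uncountability enters twice: the members of the chain that produces a support lack infinitely many
  points of \<open>Y\<close> and must still be objects of the source, and the countable
  \<open>X\<close> found at the end must fail to be one. If countably infinite sets were objects,
  both steps would break down.

  That a chain in the source is preserved has to be extracted from the target side: the covered
  object \<open>Q\<close> comes with a map \<open>r\<close> back to \<open>fob F Y\<close>, both are
  pulled back along \<open>F\<close>, and a section of the resulting injection into \<open>Y\<close>
  shows that nothing of \<open>fob F Y\<close> is missed. Models and points then differ only in how
  \<open>Q\<close> and the part \<open>P\<close> are obtained: for models both are elementary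
  substructures of a given model, for points they are a pointwise directed colimit and a
  subfunctor.\<close>

lemma cat_idn: "is_category C \<Longrightarrow> X \<in> obj C \<Longrightarrow> idn C X \<in> hom C X X"
  unfolding is_category_def by blast

lemma cat_cmp:
  "is_category C \<Longrightarrow> X \<in> obj C \<Longrightarrow> Y \<in> obj C \<Longrightarrow> Z \<in> obj C \<Longrightarrow> f \<in> hom C X Y \<Longrightarrow> g \<in> hom C Y Z \<Longrightarrow>
    cmp C X Y Z g f \<in> hom C X Z"
  unfolding is_category_def by blast

lemma cat_id_right:
  "is_category C \<Longrightarrow> X \<in> obj C \<Longrightarrow> Y \<in> obj C \<Longrightarrow> f \<in> hom C X Y \<Longrightarrow> cmp C X X Y f (idn C X) = f"
  unfolding is_category_def by blast

lemma cat_id_left: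
  "is_category C \<Longrightarrow> X \<in> obj C \<Longrightarrow> Y \<in> obj C \<Longrightarrow> f \<in> hom C X Y \<Longrightarrow> cmp C X Y Y (idn C Y) f = f"
  unfolding is_category_def by blast

lemma cat_assoc:
  "is_category C \<Longrightarrow> W \<in> obj C \<Longrightarrow> X \<in> obj C \<Longrightarrow> Y \<in> obj C \<Longrightarrow> Z \<in> obj C \<Longrightarrow>
    f \<in> hom C W X \<Longrightarrow> g \<in> hom C X Y \<Longrightarrow> h \<in> hom C Y Z \<Longrightarrow>
    cmp C W X Z (cmp C X Y Z h g) f = cmp C W Y Z h (cmp C W X Y g f)"
  unfolding is_category_def by blast

lemma fctr_obj: "is_functor C D F \<Longrightarrow> X \<in> obj C \<Longrightarrow> fob F X \<in> obj D"
  unfolding is_functor_def by blast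

lemma fctr_hom:
  "is_functor C D F \<Longrightarrow> X \<in> obj C \<Longrightarrow> Y \<in> obj C \<Longrightarrow> f \<in> hom C X Y \<Longrightarrow>
    far F X Y f \<in> hom D (fob F X) (fob F Y)"
  unfolding is_functor_def by blast

lemma fctr_idn: "is_functor C D F \<Longrightarrow> X \<in> obj C \<Longrightarrow> far F X X (idn C X) = idn D (fob F X)"
  unfolding is_functor_def by blast

lemma fctr_cmp:
  "is_functor C D F \<Longrightarrow> X \<in> obj C \<Longrightarrow> Y \<in> obj C \<Longrightarrow> Z \<in> obj C \<Longrightarrow> f \<in> hom C X Y \<Longrightarrow> g \<in> hom C Y Z \<Longrightarrow>
    far F X Z (cmp C X Y Z g f) = cmp D (fob F X) (fob F Y) (fob F Z) (far F Y Z g) (far F X Y f)"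
  unfolding is_functor_def by blast

lemma nat_iso_to_id:
  assumes "isomorphic (fctr_cat C C) H id_fctr"
  obtains \<eta> \<theta> where
    "\<And>X. X \<in> obj C \<Longrightarrow> \<eta> X \<in> hom C (fob H X) X"
    "\<And>X. X \<in> obj C \<Longrightarrow> \<theta> X \<in> hom C X (fob H X)"
    "\<And>X. X \<in> obj C \<Longrightarrow> cmp C (fob H X) X (fob H X) (\<theta> X) (\<eta> X) = idn C (fob H X)"
    "\<And>X. X \<in> obj C \<Longrightarrow> cmp C X (fob H X) X (\<eta> X) (\<theta> X) = idn C X"
    "\<And>X Y f. X \<in> obj C \<Longrightarrow> Y \<in> obj C \<Longrightarrow> f \<in> hom C X Y \<Longrightarrow>
       cmp C (fob H X) (fob H Y) Y (\<eta> Y) (far H X Y f) = cmp C (fob H X) X Y f (\<eta> X)"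
proof -
  obtain \<eta> \<theta> where \<eta>: "\<eta> \<in> nat_trans C C H id_fctr" and \<theta>: "\<theta> \<in> nat_trans C C id_fctr H"
    and 1: "(\<lambda>X\<in>obj C. cmp C (fob H X) X (fob H X) (\<theta> X) (\<eta> X)) = (\<lambda>X\<in>obj C. idn C (fob H X))"
    and 2: "(\<lambda>X\<in>obj C. cmp C X (fob H X) X (\<eta> X) (\<theta> X)) = (\<lambda>X\<in>obj C. idn C X)"
    using assms by (auto simp: isomorphic_def fctr_cat_def id_fctr_def)
  show thesis
  proof (rule that[of \<eta> \<theta>])
    fix X assume X: "X \<in> obj C"
    show "\<eta> X \<in> hom C (fob H X) X" "\<theta> X \<in> hom C X (fob H X)"
      using \<eta> \<theta> X by (auto simp: nat_trans_def id_fctr_def PiE_iff)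
    show "cmp C (fob H X) X (fob H X) (\<theta> X) (\<eta> X) = idn C (fob H X)"
      using fun_cong[OF 1, of X] X by simp
    show "cmp C X (fob H X) X (\<eta> X) (\<theta> X) = idn C X"
      using fun_cong[OF 2, of X] X by simp
  next
    fix X Y f assume "X \<in> obj C" "Y \<in> obj C" "f \<in> hom C X Y"
    then show "cmp C (fob H X) (fob H Y) Y (\<eta> Y) (far H X Y f) = cmp C (fob H X) X Y f (\<eta> X)"
      using \<eta> by (simp add: nat_trans_def id_fctr_def)
  qed
qed

text \<open>Conjugating with the natural isomorphism recovers an arrow from its image:
  \<open>f\<close> is \<open>\<eta> Y\<close> after \<open>far ?H X Y f\<close> after
  \<open>\<theta> X\<close>. With the roles of \<open>F\<close> and \<open>G\<close> exchanged the
  lemma also shows that \<open>G\<close> is faithful, on which fullness of \<open>F\<close>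
  rests.\<close>

lemma faithful_if_nat_iso_to_id:
  assumes C: "is_category C" and F: "is_functor C D F" and G: "is_functor D C G"
    and iso: "isomorphic (fctr_cat C C) (comp_fctr G F) id_fctr"
    and X: "X \<in> obj C" and Y: "Y \<in> obj C" and f: "f \<in> hom C X Y" and g: "g \<in> hom C X Y"
    and eq: "far F X Y f = far F X Y g"
  shows "f = g"
proof -
  let ?H = "comp_fctr G F"
  obtain \<eta> \<theta> where
    \<eta>: "\<And>X. X \<in> obj C \<Longrightarrow> \<eta> X \<in> hom C (fob ?H X) X" and
    \<theta>: "\<And>X. X \<in> obj C \<Longrightarrow> \<theta> X \<in> hom C X (fob ?H X)" and
    \<eta>\<theta>: "\<And>X. X \<in> obj C \<Longrightarrow> cmp C X (fob ?H X) X (\<eta> X) (\<theta> X) = idn C X" and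
    nat: "\<And>X Y f. X \<in> obj C \<Longrightarrow> Y \<in> obj C \<Longrightarrow> f \<in> hom C X Y \<Longrightarrow>
       cmp C (fob ?H X) (fob ?H Y) Y (\<eta> Y) (far ?H X Y f) = cmp C (fob ?H X) X Y f (\<eta> X)"
    using nat_iso_to_id[OF iso] by metis
  have HX: "fob ?H X \<in> obj C"
    using fctr_obj[OF G fctr_obj[OF F X]] by (simp add: comp_fctr_def)
  have *: "k = cmp C X (fob ?H X) Y (cmp C (fob ?H X) (fob ?H Y) Y (\<eta> Y) (far ?H X Y k)) (\<theta> X)"
    if k: "k \<in> hom C X Y" for k
    using cat_assoc[OF C X HX X Y \<theta>[OF X] \<eta>[OF X] k] \<eta>\<theta>[OF X] cat_id_right[OF C X Y k] nat[OF X Y k]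
    by simp
  have "far ?H X Y f = far ?H X Y g"
    using eq by (simp add: comp_fctr_def)
  then show ?thesis
    using *[OF f] *[OF g] by simp
qed

text \<open>For fullness the candidate preimage of \<open>k\<close> is the image of \<open>k\<close>
  under \<open>G\<close>, conjugated by the natural isomorphism; that it works is tested after
  applying the faithful \<open>G\<close>.\<close>

lemma equivalent_imp_fully_faithful_ess_surj:
  assumes C: "is_category C" and D: "is_category D" and "equivalent C D"
  obtains F where "is_functor C D F"
    "\<And>X Y f g. X \<in> obj C \<Longrightarrow> Y \<in> obj C \<Longrightarrow> f \<in> hom C X Y \<Longrightarrow> g \<in> hom C X Y \<Longrightarrow>
       far F X Y f = far F X Y g \<Longrightarrow> f = g"
    "\<And>X Y k. X \<in> obj C \<Longrightarrow> Y \<in> obj C \<Longrightarrow> k \<in> hom D (fob F X) (fob F Y) \<Longrightarrow>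
       \<exists>f\<in>hom C X Y. far F X Y f = k"
    "\<And>Z. Z \<in> obj D \<Longrightarrow> \<exists>X\<in>obj C. isomorphic D (fob F X) Z"
proof -
  obtain F G where F: "is_functor C D F" and G: "is_functor D C G"
    and GF: "isomorphic (fctr_cat C C) (comp_fctr G F) id_fctr"
    and FG: "isomorphic (fctr_cat D D) (comp_fctr F G) id_fctr"
    using assms(3) by (auto simp: equivalent_def)
  let ?H = "comp_fctr G F"
  obtain \<eta> \<theta> where
    \<eta>: "\<And>X. X \<in> obj C \<Longrightarrow> \<eta> X \<in> hom C (fob ?H X) X" and
    \<theta>: "\<And>X. X \<in> obj C \<Longrightarrow> \<theta> X \<in> hom C X (fob ?H X)" and
    \<theta>\<eta>: "\<And>X. X \<in> obj C \<Longrightarrow> cmp C (fob ?H X) X (fob ?H X) (\<theta> X) (\<eta> X) = idn C (fob ?H X)" and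
    nat: "\<And>X Y f. X \<in> obj C \<Longrightarrow> Y \<in> obj C \<Longrightarrow> f \<in> hom C X Y \<Longrightarrow>
       cmp C (fob ?H X) (fob ?H Y) Y (\<eta> Y) (far ?H X Y f) = cmp C (fob ?H X) X Y f (\<eta> X)"
    using nat_iso_to_id[OF GF] by metis
  have HX: "fob ?H X = fob G (fob F X)" "far ?H X Y f = far G (fob F X) (fob F Y) (far F X Y f)" for X Y f
    by (simp_all add: comp_fctr_def)
  show thesis
  proof (rule that[OF F])
    show "f = g" if "X \<in> obj C" "Y \<in> obj C" "f \<in> hom C X Y" "g \<in> hom C X Y"
      "far F X Y f = far F X Y g" for X Y f g
      using faithful_if_nat_iso_to_id[OF C F G GF that] .
  next
    fix X Y k assume X: "X \<in> obj C" and Y: "Y \<in> obj C" and k: "k \<in> hom D (fob F X) (fob F Y)"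
    have FX: "fob F X \<in> obj D" and FY: "fob F Y \<in> obj D"
      by (rule fctr_obj[OF F X], rule fctr_obj[OF F Y])
    have GX: "fob ?H X \<in> obj C" and GY: "fob ?H Y \<in> obj C"
      unfolding HX by (rule fctr_obj[OF G FX], rule fctr_obj[OF G FY])
    have Gk: "far G (fob F X) (fob F Y) k \<in> hom C (fob ?H X) (fob ?H Y)"
      unfolding HX using fctr_hom[OF G FX FY k] .
    define f0 where "f0 = cmp C (fob ?H X) (fob ?H Y) Y (\<eta> Y) (far G (fob F X) (fob F Y) k)"
    define f where "f = cmp C X (fob ?H X) Y f0 (\<theta> X)"
    have f0: "f0 \<in> hom C (fob ?H X) Y"
      unfolding f0_def by (rule cat_cmp[OF C GX GY Y Gk \<eta>[OF Y]])
    have f: "f \<in> hom C X Y"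
      unfolding f_def by (rule cat_cmp[OF C X GX Y \<theta>[OF X] f0])
    have "cmp C (fob ?H X) X Y f (\<eta> X) = f0"
      unfolding f_def
      using cat_assoc[OF C GX X GX Y \<eta>[OF X] \<theta>[OF X] f0] \<theta>\<eta>[OF X] cat_id_right[OF C GX Y f0] by simp
    then have a: "cmp C (fob ?H X) (fob ?H Y) Y (\<eta> Y) (far ?H X Y f)
        = cmp C (fob ?H X) (fob ?H Y) Y (\<eta> Y) (far G (fob F X) (fob F Y) k)"
      using nat[OF X Y f] by (simp add: f0_def)
    have Hf: "far ?H X Y f \<in> hom C (fob ?H X) (fob ?H Y)"
      unfolding HX by (rule fctr_hom[OF G FX FY fctr_hom[OF F X Y f]])
    \<comment> \<open>\<open>\<theta> Y\<close> is a left inverse of \<open>\<eta> Y\<close>, so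
      composition with \<open>\<eta> Y\<close> on the left can be cancelled.\<close>
    have cancel: "cmp C (fob ?H X) Y (fob ?H Y) (\<theta> Y) (cmp C (fob ?H X) (fob ?H Y) Y (\<eta> Y) m) = m"
      if m: "m \<in> hom C (fob ?H X) (fob ?H Y)" for m
      using cat_assoc[OF C GX GY Y GY m \<eta>[OF Y] \<theta>[OF Y]] \<theta>\<eta>[OF Y] cat_id_left[OF C GX GY m] by simp
    have "far ?H X Y f = far G (fob F X) (fob F Y) k"
      by (rule trans[OF cancel[OF Hf, unfolded a, symmetric] cancel[OF Gk]])
    then have "far G (fob F X) (fob F Y) (far F X Y f) = far G (fob F X) (fob F Y) k"
      unfolding HX .
    \<comment> \<open>\<open>G\<close> is faithful because of the other natural isomorphism, from
      \<open>F\<close> after \<open>G\<close> to the identity.\<close>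
    then have "far F X Y f = k"
      by (rule faithful_if_nat_iso_to_id[OF D G F FG FX FY fctr_hom[OF F X Y f] k])
    then show "\<exists>f\<in>hom C X Y. far F X Y f = k"
      using f by blast
  next
    fix Z assume Z: "Z \<in> obj D"
    have "isomorphic D (fob F (fob G Z)) Z"
    proof -
      obtain \<epsilon> \<delta> where
        "\<And>Z. Z \<in> obj D \<Longrightarrow> \<epsilon> Z \<in> hom D (fob (comp_fctr F G) Z) Z"
        "\<And>Z. Z \<in> obj D \<Longrightarrow> \<delta> Z \<in> hom D Z (fob (comp_fctr F G) Z)"
        "\<And>Z. Z \<in> obj D \<Longrightarrow> cmp D (fob (comp_fctr F G) Z) Z (fob (comp_fctr F G) Z) (\<delta> Z) (\<epsilon> Z)
           = idn D (fob (comp_fctr F G) Z)"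
        "\<And>Z. Z \<in> obj D \<Longrightarrow> cmp D Z (fob (comp_fctr F G) Z) Z (\<epsilon> Z) (\<delta> Z) = idn D Z"
        using nat_iso_to_id[OF FG] by metis
      then show ?thesis
        using Z unfolding isomorphic_def comp_fctr_def fctr.simps by blast
    qed
    then show "\<exists>X\<in>obj C. isomorphic D (fob F X) Z"
      using fctr_obj[OF G Z] by blast
  qed
qed

lemma obj_set_mono_cat:
  "X \<in> obj (set_mono_cat \<kappa> :: ('u set, 'u \<Rightarrow> 'u) cat) \<longleftrightarrow> small TYPE('u) X \<and> \<kappa> \<le>o |X|"
  by (simp add: set_mono_cat_def)

lemma hom_set_mono_cat: "f \<in> hom (set_mono_cat \<kappa>) X Y \<longleftrightarrow> f \<in> X \<rightarrow>\<^sub>E Y \<and> inj_on f X"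
  by (simp add: set_mono_cat_def)

lemma idn_set_mono_cat: "idn (set_mono_cat \<kappa>) X = (\<lambda>x\<in>X. x)"
  by (simp add: set_mono_cat_def set_cat_def)

lemma cmp_set_mono_cat: "cmp (set_mono_cat \<kappa>) X Y Z g f = compose X g f"
  by (simp add: set_mono_cat_def set_cat_def)

section \<open>Colimits and limits of sets\<close>

lemma set_cat_simps:
  "X \<in> obj (set_cat :: ('u set, 'u \<Rightarrow> 'u) cat) \<longleftrightarrow> small TYPE('u) X"
  "hom (set_cat :: ('u set, 'u \<Rightarrow> 'u) cat) X Y = X \<rightarrow>\<^sub>E Y"
  "idn (set_cat :: ('u set, 'u \<Rightarrow> 'u) cat) X = (\<lambda>x\<in>X. x)"
  "cmp (set_cat :: ('u set, 'u \<Rightarrow> 'u) cat) X Y Z g f = compose X g f"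
  by (simp_all add: set_cat_def)

text \<open>The equivalence relation generated by the arrows of the diagram on the disjoint union of
  its sets; a colimit of sets is the quotient by it. A path grows from a fixed start by one arrow at
  a time, so inductions along it handle finitely many elements.\<close>

inductive zigzag ::
  "('j, 'i) cat \<Rightarrow> ('j, 'i, 'u set, 'u \<Rightarrow> 'u) fctr \<Rightarrow> 'j \<times> 'u \<Rightarrow> 'j \<times> 'u \<Rightarrow> bool"
  for J D where
  refl: "zigzag J D p p"
| forward: "zigzag J D p (i, x) \<Longrightarrow> i \<in> obj J \<Longrightarrow> j \<in> obj J \<Longrightarrow> u \<in> hom J i j \<Longrightarrow> x \<in> fob D i \<Longrightarrow>
    zigzag J D p (j, far D i j u x)"
| backward: "zigzag J D p (j, far D i j u x) \<Longrightarrow> i \<in> obj J \<Longrightarrow> j \<in> obj J \<Longrightarrow> u \<in> hom J i j \<Longrightarrow>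
    x \<in> fob D i \<Longrightarrow> zigzag J D p (i, x)"

lemma is_cocone_set_cat:
  fixes c :: "'u set"
  assumes "is_functor J set_cat D"
  shows "is_cocone J set_cat D c \<iota> \<longleftrightarrow> small TYPE('u) c \<and> (\<forall>i\<in>obj J. \<iota> i \<in> fob D i \<rightarrow>\<^sub>E c) \<and>
    (\<forall>i\<in>obj J. \<forall>j\<in>obj J. \<forall>u\<in>hom J i j. \<forall>x\<in>fob D i. \<iota> j (far D i j u x) = \<iota> i x)"
proof -
  have "compose (fob D i) (\<iota> j) (far D i j u) = \<iota> i \<longleftrightarrow> (\<forall>x\<in>fob D i. \<iota> j (far D i j u x) = \<iota> i x)"
    if "\<iota> i \<in> fob D i \<rightarrow>\<^sub>E c" for i j u
    using that by (auto simp: compose_def fun_eq_iff PiE_iff extensional_def)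
  then show ?thesis
    unfolding is_cocone_def set_cat_simps by blast
qed

text \<open>
  Both parts test the universal property against maps to a set with two elements, so no quotient
  has to be formed.
\<close>

lemma is_colimit_set_catD:
  fixes c :: "'u set"
  assumes D: "is_functor J set_cat D" and colim: "is_colimit J set_cat D c \<iota>"
    and ab: "\<exists>a b :: 'u. a \<noteq> b" and two: "\<And>a b :: 'u. small TYPE('u) {a, b}"
  shows "y \<in> c \<Longrightarrow> \<exists>j\<in>obj J. \<exists>x\<in>fob D j. \<iota> j x = y"
    and "i \<in> obj J \<Longrightarrow> j \<in> obj J \<Longrightarrow> x \<in> fob D i \<Longrightarrow> z \<in> fob D j \<Longrightarrow> \<iota> i x = \<iota> j z \<Longrightarrow>
      zigzag J D (i, x) (j, z)"
proof -
  obtain a b :: 'u where ab: "a \<noteq> b" using assms(3) by blast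
  have coc: "is_cocone J set_cat D c \<iota>"
    using colim by (simp add: is_colimit_def)
  then have \<iota>: "\<And>i. i \<in> obj J \<Longrightarrow> \<iota> i \<in> fob D i \<rightarrow>\<^sub>E c"
    and \<iota>u: "\<And>i j u x. i \<in> obj J \<Longrightarrow> j \<in> obj J \<Longrightarrow> u \<in> hom J i j \<Longrightarrow> x \<in> fob D i \<Longrightarrow>
      \<iota> j (far D i j u x) = \<iota> i x"
    unfolding is_cocone_set_cat[OF D] by blast+
  have Du: "far D i j u x \<in> fob D j"
    if "i \<in> obj J" "j \<in> obj J" "u \<in> hom J i j" "x \<in> fob D i" for i j u x
    using fctr_hom[OF D that(1-3)] that(4) by (auto simp: set_cat_simps)
  have ump: "\<exists>!h. h \<in> c \<rightarrow>\<^sub>E {a, b} \<and> (\<forall>j\<in>obj J. compose (fob D j) h (\<iota> j) = \<kappa> j)"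
    if "is_cocone J set_cat D {a, b} \<kappa>" for \<kappa>
    using colim that unfolding is_colimit_def set_cat_simps by blast
  show "\<exists>j\<in>obj J. \<exists>x\<in>fob D j. \<iota> j x = y" if y: "y \<in> c"
  proof (rule ccontr)
    assume no: "\<not> (\<exists>j\<in>obj J. \<exists>x\<in>fob D j. \<iota> j x = y)"
    let ?\<kappa> = "\<lambda>j. \<lambda>x\<in>fob D j. a"
    have "is_cocone J set_cat D {a, b} ?\<kappa>"
      unfolding is_cocone_set_cat[OF D] using two Du by simp
    from ump[OF this] have uniq: "\<And>h h'. h \<in> c \<rightarrow>\<^sub>E {a, b} \<Longrightarrow> h' \<in> c \<rightarrow>\<^sub>E {a, b} \<Longrightarrow>
      (\<forall>j\<in>obj J. compose (fob D j) h (\<iota> j) = ?\<kappa> j) \<Longrightarrow>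
      (\<forall>j\<in>obj J. compose (fob D j) h' (\<iota> j) = ?\<kappa> j) \<Longrightarrow> h = h'"
      by blast
    have "(\<lambda>x\<in>c. a) = (\<lambda>x\<in>c. if x = y then b else a)"
      by (rule uniq) (use \<iota> no in \<open>auto simp: compose_def fun_eq_iff PiE_iff\<close>)
    from fun_cong[OF this, of y] show False
      using y ab by simp
  qed
  show "zigzag J D (i, x) (j, z)"
    if i: "i \<in> obj J" and j: "j \<in> obj J" and x: "x \<in> fob D i" and z: "z \<in> fob D j" and eq: "\<iota> i x = \<iota> j z"
  proof -
    \<comment> \<open>The indicator of the component of \<open>(i, x)\<close>. It is a cocone
      because \<open>zigzag\<close> is closed under arrows in both directions.\<close>
    let ?\<kappa> = "\<lambda>k. \<lambda>w\<in>fob D k. if zigzag J D (i, x) (k, w) then a else b"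
    have "is_cocone J set_cat D {a, b} ?\<kappa>"
      unfolding is_cocone_set_cat[OF D] using two Du
      by (auto intro: zigzag.forward dest: zigzag.backward)
    from ump[OF this] obtain h where h: "\<And>k. k \<in> obj J \<Longrightarrow> compose (fob D k) h (\<iota> k) = ?\<kappa> k"
      by blast
    have "h (\<iota> i x) = a"
      using fun_cong[OF h[OF i], of x] x by (simp add: compose_def zigzag.refl)
    then have "(if zigzag J D (i, x) (j, z) then a else b) = a"
      using fun_cong[OF h[OF j], of z] z eq by (simp add: compose_def)
    then show ?thesis
      using ab by (auto split: if_splits)
  qed
qed

text \<open>The factorization is defined on chosen representatives. A cocone is constant along
  zigzags, so by \<open>conn\<close> the choice does not matter; by \<open>surj\<close> the
  factorization is unique.\<close>

lemma is_colimit_set_catI: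
  fixes c :: "'u set"
  assumes D: "is_functor J set_cat D" and coc: "is_cocone J set_cat D c \<iota>"
    and surj: "\<And>y. y \<in> c \<Longrightarrow> \<exists>j\<in>obj J. \<exists>x\<in>fob D j. \<iota> j x = y"
    and conn: "\<And>i j x z. i \<in> obj J \<Longrightarrow> j \<in> obj J \<Longrightarrow> x \<in> fob D i \<Longrightarrow> z \<in> fob D j \<Longrightarrow> \<iota> i x = \<iota> j z \<Longrightarrow>
      zigzag J D (i, x) (j, z)"
  shows "is_colimit J set_cat D c \<iota>"
  unfolding is_colimit_def set_cat_simps
proof (intro conjI allI impI coc)
  fix d \<kappa> assume \<kappa>: "is_cocone J set_cat D d \<kappa>"
  have \<iota>: "\<And>i. i \<in> obj J \<Longrightarrow> \<iota> i \<in> fob D i \<rightarrow>\<^sub>E c"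
    using coc unfolding is_cocone_set_cat[OF D] by blast
  have \<kappa>': "\<And>i. i \<in> obj J \<Longrightarrow> \<kappa> i \<in> fob D i \<rightarrow>\<^sub>E d"
    and \<kappa>u: "\<And>i j u x. i \<in> obj J \<Longrightarrow> j \<in> obj J \<Longrightarrow> u \<in> hom J i j \<Longrightarrow> x \<in> fob D i \<Longrightarrow>
      \<kappa> j (far D i j u x) = \<kappa> i x"
    using \<kappa> unfolding is_cocone_set_cat[OF D] by blast+
  have const: "zigzag J D p q \<Longrightarrow> \<kappa> (fst p) (snd p) = \<kappa> (fst q) (snd q)" for p q
    by (induction rule: zigzag.induct) (simp_all add: \<kappa>u)
  define pick where "pick y = (SOME p. fst p \<in> obj J \<and> snd p \<in> fob D (fst p) \<and> \<iota> (fst p) (snd p) = y)" for y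
  have pick: "fst (pick y) \<in> obj J \<and> snd (pick y) \<in> fob D (fst (pick y)) \<and> \<iota> (fst (pick y)) (snd (pick y)) = y"
    if "y \<in> c" for y
    unfolding pick_def by (rule someI_ex) (use surj[OF that] in auto)
  define h where "h = (\<lambda>y\<in>c. \<kappa> (fst (pick y)) (snd (pick y)))"
  have hc: "h \<in> c \<rightarrow>\<^sub>E d"
    using pick \<kappa>' by (fastforce simp: h_def)
  have h\<iota>: "h (\<iota> j x) = \<kappa> j x" if "j \<in> obj J" "x \<in> fob D j" for j x
  proof -
    have y: "\<iota> j x \<in> c" using \<iota> that by blast
    have "zigzag J D (fst (pick (\<iota> j x)), snd (pick (\<iota> j x))) (j, x)"
      by (rule conn) (use pick[OF y] that in auto)
    from const[OF this] show ?thesis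
      using y by (simp add: h_def)
  qed
  show "\<exists>!h. h \<in> c \<rightarrow>\<^sub>E d \<and> (\<forall>j\<in>obj J. compose (fob D j) h (\<iota> j) = \<kappa> j)"
  proof (rule ex1I[of _ h], intro conjI ballI hc)
    fix j assume "j \<in> obj J"
    then show "compose (fob D j) h (\<iota> j) = \<kappa> j"
      using h\<iota> \<kappa>' by (intro extensionalityI[of _ "fob D j"]) (auto simp: compose_def PiE_iff)
  next
    fix g assume g: "g \<in> c \<rightarrow>\<^sub>E d \<and> (\<forall>j\<in>obj J. compose (fob D j) g (\<iota> j) = \<kappa> j)"
    show "g = h"
    proof (rule extensionalityI[of _ c])
      fix y assume "y \<in> c"
      then obtain j x where jx: "j \<in> obj J" "x \<in> fob D j" "\<iota> j x = y" using surj by blast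
      have "compose (fob D j) g (\<iota> j) = \<kappa> j"
        using g jx by blast
      from fun_cong[OF this, of x] have "g (\<iota> j x) = \<kappa> j x"
        using jx by (simp add: compose_def)
      then show "g y = h y" using h\<iota>[OF jx(1,2)] jx(3) by simp
    qed (use g hc in \<open>auto simp: PiE_iff\<close>)
  qed
qed

text \<open>These families are the cones with a one-element vertex, that is, the elements of the
  limit.\<close>

definition compatible :: "('j, 'i) cat \<Rightarrow> ('j, 'i, 'u set, 'u \<Rightarrow> 'u) fctr \<Rightarrow> ('j \<Rightarrow> 'u) \<Rightarrow> bool" where
  "compatible J D x \<longleftrightarrow> (\<forall>j\<in>obj J. x j \<in> fob D j) \<and>
     (\<forall>i\<in>obj J. \<forall>j\<in>obj J. \<forall>u\<in>hom J i j. far D i j u (x i) = x j)"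

lemma is_cone_set_cat:
  fixes c :: "'u set"
  assumes "is_functor J set_cat D"
  shows "is_cone J set_cat D c \<pi> \<longleftrightarrow> small TYPE('u) c \<and> (\<forall>i\<in>obj J. \<pi> i \<in> c \<rightarrow>\<^sub>E fob D i) \<and>
    (\<forall>y\<in>c. compatible J D (\<lambda>i. \<pi> i y))"
proof -
  have "compose c (far D i j u) (\<pi> i) = \<pi> j \<longleftrightarrow> (\<forall>y\<in>c. far D i j u (\<pi> i y) = \<pi> j y)"
    if "\<pi> j \<in> c \<rightarrow>\<^sub>E fob D j" for i j u
    using that by (auto simp: compose_def fun_eq_iff PiE_iff extensional_def)
  then show ?thesis
    unfolding is_cone_def set_cat_simps compatible_def by (auto 0 4)
qed

text \<open>A compatible family is a cone with vertex a singleton, and the factorizations of that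
  cone are the elements lying over the family.\<close>

lemma is_limit_set_catD:
  fixes c :: "'u set"
  assumes D: "is_functor J set_cat D" and lim: "is_limit J set_cat D c \<pi>"
    and sing: "\<And>a :: 'u. small TYPE('u) {a}" and x: "compatible J D x"
  shows "\<exists>!y. y \<in> c \<and> (\<forall>j\<in>obj J. \<pi> j y = x j)"
proof -
  have cone: "is_cone J set_cat D c \<pi>"
    using lim by (simp add: is_limit_def)
  fix a :: 'u
  let ?\<kappa> = "\<lambda>j. \<lambda>w\<in>{a}. x j"
  have "is_cone J set_cat D {a} ?\<kappa>"
    unfolding is_cone_set_cat[OF D] using sing x by (auto simp: compatible_def)
  then have ump: "\<exists>!h. h \<in> {a} \<rightarrow>\<^sub>E c \<and> (\<forall>j\<in>obj J. compose {a} (\<pi> j) h = ?\<kappa> j)"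
    using lim unfolding is_limit_def set_cat_simps by blast
  then obtain h where h: "h \<in> {a} \<rightarrow>\<^sub>E c" "\<And>j. j \<in> obj J \<Longrightarrow> compose {a} (\<pi> j) h = ?\<kappa> j"
    by blast
  show ?thesis
  proof (rule ex1I[of _ "h a"])
    show "h a \<in> c \<and> (\<forall>j\<in>obj J. \<pi> j (h a) = x j)"
      using h(1) fun_cong[OF h(2), of _ a] by (auto simp: compose_def)
  next
    fix y assume y: "y \<in> c \<and> (\<forall>j\<in>obj J. \<pi> j y = x j)"
    then have "(\<lambda>w\<in>{a}. y) \<in> {a} \<rightarrow>\<^sub>E c \<and> (\<forall>j\<in>obj J. compose {a} (\<pi> j) (\<lambda>w\<in>{a}. y) = ?\<kappa> j)"
      by (auto simp: compose_def fun_eq_iff)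
    then have "(\<lambda>w\<in>{a}. y) = h"
      using ump h by blast
    from fun_cong[OF this, of a] show "y = h a" by simp
  qed
qed

lemma is_limit_set_catI:
  fixes c :: "'u set"
  assumes D: "is_functor J set_cat D" and cone: "is_cone J set_cat D c \<pi>"
    and lim: "\<And>x. compatible J D x \<Longrightarrow> \<exists>!y. y \<in> c \<and> (\<forall>j\<in>obj J. \<pi> j y = x j)"
  shows "is_limit J set_cat D c \<pi>"
  unfolding is_limit_def set_cat_simps
proof (intro conjI allI impI cone)
  fix d \<kappa> assume "is_cone J set_cat D d \<kappa>"
  then have \<kappa>: "\<And>i. i \<in> obj J \<Longrightarrow> \<kappa> i \<in> d \<rightarrow>\<^sub>E fob D i"
    and comp: "\<And>y. y \<in> d \<Longrightarrow> compatible J D (\<lambda>i. \<kappa> i y)"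
    unfolding is_cone_set_cat[OF D] by blast+
  have "\<forall>w\<in>d. \<exists>y. y \<in> c \<and> (\<forall>j\<in>obj J. \<pi> j y = \<kappa> j w)"
    using lim[OF comp] by blast
  then obtain h0 where h0: "\<And>w. w \<in> d \<Longrightarrow> h0 w \<in> c" "\<And>w j. w \<in> d \<Longrightarrow> j \<in> obj J \<Longrightarrow> \<pi> j (h0 w) = \<kappa> j w"
    by metis
  define h where "h = restrict h0 d"
  have eq_iff: "compose d (\<pi> j) g = \<kappa> j \<longleftrightarrow> (\<forall>w\<in>d. \<pi> j (g w) = \<kappa> j w)" if "j \<in> obj J" for g j
    using \<kappa>[OF that] by (auto simp: compose_def fun_eq_iff PiE_iff extensional_def)
  show "\<exists>!h. h \<in> d \<rightarrow>\<^sub>E c \<and> (\<forall>j\<in>obj J. compose d (\<pi> j) h = \<kappa> j)"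
  proof (rule ex1I[of _ h])
    show "h \<in> d \<rightarrow>\<^sub>E c \<and> (\<forall>j\<in>obj J. compose d (\<pi> j) h = \<kappa> j)"
      using h0 by (auto simp: eq_iff h_def)
  next
    fix g assume g: "g \<in> d \<rightarrow>\<^sub>E c \<and> (\<forall>j\<in>obj J. compose d (\<pi> j) g = \<kappa> j)"
    show "g = h"
    proof (rule extensionalityI[of _ d])
      fix w assume w: "w \<in> d"
      have "\<forall>j\<in>obj J. \<pi> j (g w) = \<kappa> j w" "g w \<in> c"
        using g w eq_iff by auto
      then show "g w = h w"
        using lim[OF comp[OF w]] h0 w unfolding h_def by (metis restrict_apply')
    qed (use g in \<open>auto simp: PiE_iff h_def\<close>)
  qed
qed

section \<open>Large sets and injections\<close>

text \<open>The shape of a Tarski-Vaught test when no formulas are at hand: the elements of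
  \<open>W\<close> already in \<open>B\<close> are the parameters, the others are witnesses, and a
  single endomorphism fixes the former while pulling the latter into \<open>B\<close>.\<close>

definition homogeneous ::
  "('d, 't \<Rightarrow> 'u \<Rightarrow> 'u) cat \<Rightarrow> 't set \<Rightarrow> ('d \<Rightarrow> 't \<Rightarrow> 'u set) \<Rightarrow> 'd \<Rightarrow> ('t \<Rightarrow> 'u set) \<Rightarrow> bool" where
  "homogeneous D I E R B \<longleftrightarrow> (\<forall>t\<in>I. B t \<subseteq> E R t) \<and>
     (\<forall>W. finite W \<and> (\<forall>(t, x)\<in>W. t \<in> I \<and> x \<in> E R t) \<longrightarrow>
        (\<exists>\<sigma>\<in>hom D R R. \<forall>(t, x)\<in>W. \<sigma> t x \<in> B t \<and> (x \<in> B t \<longrightarrow> \<sigma> t x = x)))"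

text \<open>The chain is part of the predicate, so that the same predicate describes the given
  cocone and the one through which it factors in \<open>chain_cover\<close>.\<close>

definition chain_cocone ::
  "('d, 'm) cat \<Rightarrow> (nat \<Rightarrow> 'd) \<Rightarrow> (nat \<Rightarrow> nat \<Rightarrow> 'm) \<Rightarrow> 'd \<Rightarrow> (nat \<Rightarrow> 'm) \<Rightarrow> bool" where
  "chain_cocone D P u R \<rho> \<longleftrightarrow> (\<forall>n. P n \<in> obj D) \<and> R \<in> obj D \<and>
     (\<forall>m n. m \<le> n \<longrightarrow> u m n \<in> hom D (P m) (P n)) \<and>
     (\<forall>l m n. l \<le> m \<longrightarrow> m \<le> n \<longrightarrow> cmp D (P l) (P m) (P n) (u m n) (u l m) = u l n) \<and>
     (\<forall>n. \<rho> n \<in> hom D (P n) R) \<and>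
     (\<forall>m n. m \<le> n \<longrightarrow> cmp D (P m) (P n) R (\<rho> n) (u m n) = \<rho> m)"

text \<open>
  The common features of points and models: an object \<open>X\<close> has sets of elements \<open>E X t\<close>, indexed
  by the objects \<open>t\<close> of the topos or by the sorts of the signature. Of the colimit of a chain only a
  factorization of each given cocone is needed.
\<close>

locale structured_category =
  fixes D :: "('d, 't \<Rightarrow> 'u \<Rightarrow> 'u) cat" and I :: "'t set" and E :: "'d \<Rightarrow> 't \<Rightarrow> 'u set"
  assumes category: "is_category D"
    and app_in: "X \<in> obj D \<Longrightarrow> Y \<in> obj D \<Longrightarrow> f \<in> hom D X Y \<Longrightarrow> t \<in> I \<Longrightarrow> x \<in> E X t \<Longrightarrow> f t x \<in> E Y t"
    and app_idn: "X \<in> obj D \<Longrightarrow> t \<in> I \<Longrightarrow> x \<in> E X t \<Longrightarrow> idn D X t x = x"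
    and app_cmp: "X \<in> obj D \<Longrightarrow> Y \<in> obj D \<Longrightarrow> Z \<in> obj D \<Longrightarrow> f \<in> hom D X Y \<Longrightarrow> g \<in> hom D Y Z \<Longrightarrow>
      t \<in> I \<Longrightarrow> x \<in> E X t \<Longrightarrow> cmp D X Y Z g f t x = g t (f t x)"
    and hom_eqI: "X \<in> obj D \<Longrightarrow> Y \<in> obj D \<Longrightarrow> f \<in> hom D X Y \<Longrightarrow> g \<in> hom D X Y \<Longrightarrow>
      (\<And>t x. t \<in> I \<Longrightarrow> x \<in> E X t \<Longrightarrow> f t x = g t x) \<Longrightarrow> f = g"
    and chain_cover: "chain_cocone D P u R \<rho> \<Longrightarrow>
      \<exists>Q \<iota>. \<exists>r\<in>hom D Q R. chain_cocone D P u Q \<iota> \<and> (\<forall>n. cmp D (P n) Q R r (\<iota> n) = \<rho> n) \<and>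
        (\<forall>t\<in>I. \<forall>y\<in>E Q t. \<exists>n. \<exists>x\<in>E (P n) t. \<iota> n t x = y)"
    and homogeneous_part: "R \<in> obj D \<Longrightarrow> homogeneous D I E R B \<Longrightarrow>
      \<exists>P\<in>obj D. \<exists>j\<in>hom D P R. \<forall>t\<in>I. \<forall>x\<in>E P t. j t x \<in> B t"

text \<open>An infinite set is not the union of two sets of smaller cardinality. This keeps the
  members of the chain in \<open>finite_support\<close> large.\<close>

lemma card_of_diff_countable:
  assumes "natLeq <o |Y|" "|A| \<le>o natLeq"
  shows "|Y| \<le>o |Y - A|"
proof (rule ccontr)
  assume "\<not> |Y| \<le>o |Y - A|"
  then have "|Y - A| <o |Y|"
    using ordLess_or_ordLeq[OF card_of_Well_order card_of_Well_order] by blast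
  moreover have "|A| <o |Y|" using assms ordLeq_ordLess_trans by blast
  moreover have "\<not> finite Y"
    using assms(1) infinite_iff_natLeq_ordLeq ordLess_imp_ordLeq by blast
  ultimately have "|(Y - A) \<union> A| <o |Y|"
    using card_of_Un_ordLess_infinite by blast
  moreover have "|Y| \<le>o |(Y - A) \<union> A|"
    by (rule card_of_mono1) auto
  ultimately have "|Y| <o |Y|"
    using ordLeq_ordLess_trans by blast
  then show False using ordLess_irreflexive by blast
qed

text \<open>Greedy recursion: each pair is chosen outside the finite set of all points used before.
  In the application \<open>R a b\<close> says that exchanging \<open>a\<close> and \<open>b\<close>
  moves a fixed element.\<close>

lemma ex_disjoint_pairs:
  assumes "\<And>S. finite S \<Longrightarrow> S \<subseteq> Y \<Longrightarrow> \<exists>a\<in>Y - S. \<exists>b\<in>Y - S. R a b"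
  obtains a b :: "nat \<Rightarrow> 'a" where
    "\<And>n. a n \<in> Y" "\<And>n. b n \<in> Y" "\<And>n. R (a n) (b n)"
    "\<And>m n. m \<noteq> n \<Longrightarrow> {a m, b m} \<inter> {a n, b n} = {}"
proof -
  from assms obtain a b where
    ab: "\<And>S. finite S \<Longrightarrow> S \<subseteq> Y \<Longrightarrow> a S \<in> Y - S \<and> b S \<in> Y - S \<and> R (a S) (b S)"
    by metis
  define S where "S = rec_nat {} (\<lambda>_ S. S \<union> {a S, b S})"
  have S0: "S 0 = {}" and S_Suc: "S (Suc n) = S n \<union> {a (S n), b (S n)}" for n
    by (simp_all add: S_def)
  have fin: "finite (S n) \<and> S n \<subseteq> Y" for n
    by (induction n) (use ab in \<open>auto simp: S0 S_Suc\<close>)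
  have ab': "a (S n) \<in> Y - S n" "b (S n) \<in> Y - S n" "R (a (S n)) (b (S n))" for n
    using ab fin by blast+
  have mono: "m \<le> n \<Longrightarrow> S m \<subseteq> S n" for m n
    by (rule lift_Suc_mono_le[of S]) (auto simp: S_Suc)
  have disj: "{a (S m), b (S m)} \<inter> {a (S n), b (S n)} = {}" if "m < n" for m n
  proof -
    have "a (S m) \<in> S n" "b (S m) \<in> S n" using mono[of "Suc m" n] that by (auto simp: S_Suc)
    then show ?thesis using ab'(1,2)[of n] by auto
  qed
  show thesis
  proof (rule that[of "\<lambda>n. a (S n)" "\<lambda>n. b (S n)"])
    show "{a (S m), b (S m)} \<inter> {a (S n), b (S n)} = {}" if "m \<noteq> n" for m n
    proof (cases "m < n")
      case False
      then show ?thesis using disj[of n m] that by (simp add: Int_commute)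
    qed (rule disj)
    show "a (S n) \<in> Y" "b (S n) \<in> Y" "R (a (S n)) (b (S n))" for n
      using ab'[of n] by simp_all
  qed
qed

text \<open>The equivalence is kept as one functor that is fully faithful and essentially
  surjective; preimages of arrows and objects are chosen when they are called for.\<close>

locale structured_equivalence = structured_category D I E
  for D :: "('d, 't \<Rightarrow> 'u \<Rightarrow> 'u) cat" and I :: "'t set" and E :: "'d \<Rightarrow> 't \<Rightarrow> 'u set" +
  fixes \<kappa> :: "'k rel" and F :: "('u set, 'u \<Rightarrow> 'u, 'd, 't \<Rightarrow> 'u \<Rightarrow> 'u) fctr"
  assumes F_functor: "is_functor (set_mono_cat \<kappa>) D F"
    and faithful: "X \<in> obj (set_mono_cat \<kappa>) \<Longrightarrow> Y \<in> obj (set_mono_cat \<kappa>) \<Longrightarrow>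
      f \<in> hom (set_mono_cat \<kappa>) X Y \<Longrightarrow> g \<in> hom (set_mono_cat \<kappa>) X Y \<Longrightarrow>
      far F X Y f = far F X Y g \<Longrightarrow> f = g"
    and full: "X \<in> obj (set_mono_cat \<kappa>) \<Longrightarrow> Y \<in> obj (set_mono_cat \<kappa>) \<Longrightarrow>
      k \<in> hom D (fob F X) (fob F Y) \<Longrightarrow> \<exists>f\<in>hom (set_mono_cat \<kappa>) X Y. far F X Y f = k"
    and ess_surj: "Z \<in> obj D \<Longrightarrow> \<exists>X\<in>obj (set_mono_cat \<kappa>). isomorphic D (fob F X) Z"
begin

abbreviation S :: "('u set, 'u \<Rightarrow> 'u) cat" where
  "S \<equiv> set_mono_cat \<kappa>"

lemma F_obj: "X \<in> obj S \<Longrightarrow> fob F X \<in> obj D"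
  by (rule fctr_obj[OF F_functor])

lemma F_hom: "X \<in> obj S \<Longrightarrow> Y \<in> obj S \<Longrightarrow> f \<in> hom S X Y \<Longrightarrow> far F X Y f \<in> hom D (fob F X) (fob F Y)"
  by (rule fctr_hom[OF F_functor])

lemma F_cmp:
  "X \<in> obj S \<Longrightarrow> Y \<in> obj S \<Longrightarrow> Z \<in> obj S \<Longrightarrow> f \<in> hom S X Y \<Longrightarrow> g \<in> hom S Y Z \<Longrightarrow>
    far F X Z (compose X g f) = cmp D (fob F X) (fob F Y) (fob F Z) (far F Y Z g) (far F X Y f)"
  using fctr_cmp[OF F_functor] by (simp add: cmp_set_mono_cat)

lemma F_app_in:
  "X \<in> obj S \<Longrightarrow> Y \<in> obj S \<Longrightarrow> f \<in> hom S X Y \<Longrightarrow> t \<in> I \<Longrightarrow> x \<in> E (fob F X) t \<Longrightarrow>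
    far F X Y f t x \<in> E (fob F Y) t"
  using app_in F_obj F_hom by blast

lemma F_app_cmp:
  "X \<in> obj S \<Longrightarrow> Y \<in> obj S \<Longrightarrow> Z \<in> obj S \<Longrightarrow> f \<in> hom S X Y \<Longrightarrow> g \<in> hom S Y Z \<Longrightarrow>
    t \<in> I \<Longrightarrow> x \<in> E (fob F X) t \<Longrightarrow>
    far F X Z (compose X g f) t x = far F Y Z g t (far F X Y f t x)"
  by (simp add: F_cmp app_cmp F_obj F_hom)

lemma F_app_idn: "X \<in> obj S \<Longrightarrow> t \<in> I \<Longrightarrow> x \<in> E (fob F X) t \<Longrightarrow> far F X X (\<lambda>y\<in>X. y) t x = x"
  using fctr_idn[OF F_functor] app_idn F_obj by (simp add: idn_set_mono_cat)

text \<open>Let \<open>Q\<close> be the covered object through which the images of the inclusions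
  factor, with \<open>r\<close> from \<open>Q\<close> to \<open>fob F Y\<close>, and let
  \<open>fob F Z\<close> be isomorphic to \<open>Q\<close>. Fullness turns the cocone into
  \<open>Q\<close> into injections \<open>f n\<close> from \<open>A n\<close> to \<open>Z\<close>,
  and \<open>r\<close> into an injection \<open>g\<close> from \<open>Z\<close> to \<open>Y\<close>.
  The \<open>f n\<close> glue to a map \<open>h\<close> on the union, and \<open>g\<close> after
  \<open>h\<close> is the identity. So \<open>x\<close> is the image of an element of
  \<open>fob F Z\<close>, hence of one of \<open>Q\<close>, hence of one at some stage.\<close>

lemma chain_support:
  assumes Y: "Y \<in> obj S" and A: "\<And>n :: nat. A n \<in> obj S" and mono: "\<And>m n. m \<le> n \<Longrightarrow> A m \<subseteq> A n"
    and un: "(\<Union>n. A n) = Y" and t: "t \<in> I" and x: "x \<in> E (fob F Y) t"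
  shows "\<exists>n. \<exists>z\<in>E (fob F (A n)) t. far F (A n) Y (\<lambda>y\<in>A n. y) t z = x"
proof -
  have AY: "A n \<subseteq> Y" for n using un by blast
  have inc: "(\<lambda>y\<in>A m. y) \<in> hom S (A m) Z" if "A m \<subseteq> Z" for m Z
    using that by (auto simp: hom_set_mono_cat inj_on_def)
  define P where "P n = fob F (A n)" for n
  define u where "u m n = far F (A m) (A n) (\<lambda>y\<in>A m. y)" for m n
  define \<rho> where "\<rho> n = far F (A n) Y (\<lambda>y\<in>A n. y)" for n
  have P: "P n \<in> obj D" for n
    by (simp add: P_def F_obj A)
  have R: "fob F Y \<in> obj D" by (rule F_obj[OF Y])
  have u: "u m n \<in> hom D (P m) (P n)" if "m \<le> n" for m n
    unfolding u_def P_def by (rule F_hom[OF A A inc[OF mono[OF that]]])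
  have \<rho>: "\<rho> n \<in> hom D (P n) (fob F Y)" for n
    unfolding \<rho>_def P_def by (rule F_hom[OF A Y inc[OF AY]])
  have comp_inc: "compose (A l) f (\<lambda>y\<in>A l. y) = restrict f (A l)" for l f
    by (auto simp: compose_def)
  have inc_inc: "compose (A l) (\<lambda>y\<in>A m. y) (\<lambda>y\<in>A l. y) = (\<lambda>y\<in>A l. y)" if "l \<le> m" for l m
    using mono[OF that] by (auto simp: compose_def fun_eq_iff)
  have uu: "cmp D (P l) (P m) (P n) (u m n) (u l m) = u l n" if "l \<le> m" "m \<le> n" for l m n
    using F_cmp[OF A A A inc[OF mono[OF that(1)]] inc[OF mono[OF that(2)]]]
    by (simp add: u_def P_def inc_inc[OF that(1)])
  have \<rho>u: "cmp D (P m) (P n) (fob F Y) (\<rho> n) (u m n) = \<rho> m" if "m \<le> n" for m n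
    using F_cmp[OF A A Y inc[OF mono[OF that(1)]] inc[OF AY]]
    by (simp add: u_def P_def \<rho>_def inc_inc[OF that(1)])
  have "chain_cocone D P u (fob F Y) \<rho>"
    using P R u uu \<rho> \<rho>u by (simp add: chain_cocone_def)
  then obtain Q \<iota> r where r: "r \<in> hom D Q (fob F Y)" and "chain_cocone D P u Q \<iota>"
    and r\<iota>: "\<forall>n. cmp D (P n) Q (fob F Y) r (\<iota> n) = \<rho> n"
    and cover: "\<forall>t\<in>I. \<forall>y\<in>E Q t. \<exists>n. \<exists>x\<in>E (P n) t. \<iota> n t x = y"
    using chain_cover by blast
  then have Q: "Q \<in> obj D" and \<iota>: "\<And>n. \<iota> n \<in> hom D (P n) Q"
    and \<iota>u: "\<And>m n. m \<le> n \<Longrightarrow> cmp D (P m) (P n) Q (\<iota> n) (u m n) = \<iota> m"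
    by (simp_all add: chain_cocone_def)
  obtain Z \<theta> \<theta>' where Z: "Z \<in> obj S" and \<theta>: "\<theta> \<in> hom D (fob F Z) Q" and \<theta>': "\<theta>' \<in> hom D Q (fob F Z)"
    and \<theta>\<theta>': "cmp D Q (fob F Z) Q \<theta> \<theta>' = idn D Q"
    using ess_surj[OF Q] by (auto simp: isomorphic_def)
  have FZ: "fob F Z \<in> obj D" by (rule F_obj[OF Z])
  have "\<exists>f\<in>hom S (A n) Z. far F (A n) Z f = cmp D (P n) Q (fob F Z) \<theta>' (\<iota> n)" for n
    using full[OF A Z] cat_cmp[OF category P Q FZ \<iota> \<theta>'] by (simp add: P_def)
  then obtain f where f: "\<And>n. f n \<in> hom S (A n) Z"
    and Ff: "\<And>n. far F (A n) Z (f n) = cmp D (P n) Q (fob F Z) \<theta>' (\<iota> n)"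
    by metis
  \<comment> \<open>The cocone equation for \<open>\<iota>\<close>, read back through the faithful
    \<open>F\<close>: later maps extend earlier ones.\<close>
  have f_restr: "f n y = f m y" if "m \<le> n" "y \<in> A m" for m n y
  proof -
    have "far F (A m) Z (compose (A m) (f n) (\<lambda>y\<in>A m. y)) =
        cmp D (P m) (P n) (fob F Z) (cmp D (P n) Q (fob F Z) \<theta>' (\<iota> n)) (u m n)"
      using F_cmp[OF A A Z inc[OF mono[OF that(1)]] f[of n]] by (simp add: P_def u_def Ff)
    also have "\<dots> = far F (A m) Z (f m)"
      using cat_assoc[OF category P P Q FZ u[OF that(1)] \<iota> \<theta>'] by (simp add: \<iota>u that(1) Ff)
    finally have "far F (A m) Z (restrict (f n) (A m)) = far F (A m) Z (f m)"
      by (simp add: comp_inc)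
    moreover have "restrict (f n) (A m) \<in> hom S (A m) Z"
      using f[of n] mono[OF that(1)] by (auto simp: hom_set_mono_cat inj_on_def PiE_iff subset_iff)
    ultimately have "restrict (f n) (A m) = f m"
      using faithful[OF A Z _ f] by blast
    then show ?thesis
      using that(2) by (metis restrict_apply')
  qed
  obtain g where g: "g \<in> hom S Z Y" and Fg: "far F Z Y g = cmp D (fob F Z) Q (fob F Y) r \<theta>"
    using full[OF Z Y cat_cmp[OF category FZ Q R \<theta> r]] by blast
  have g_app: "far F Z Y g s z = r s (\<theta> s z)" if "s \<in> I" "z \<in> E (fob F Z) s" for s z
    using app_cmp[OF FZ Q R \<theta> r that] by (simp add: Fg)
  have \<theta>\<theta>'_app: "\<theta> s (\<theta>' s q) = q" if "s \<in> I" "q \<in> E Q s" for s q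
    using app_cmp[OF Q FZ Q \<theta>' \<theta> that] app_idn[OF Q that] by (simp add: \<theta>\<theta>')
  have \<iota>_app: "r s (\<iota> n s z) = far F (A n) Y (\<lambda>y\<in>A n. y) s z" if "s \<in> I" "z \<in> E (P n) s" for n s z
    using app_cmp[OF P Q R \<iota> r that] r\<iota> by (simp add: \<rho>_def)
  \<comment> \<open>Under \<open>F\<close> both sides act as the image of the inclusion of
    \<open>A n\<close>: the isomorphism between \<open>Q\<close> and \<open>fob F Z\<close> cancels,
    and \<open>r\<close> after \<open>\<iota> n\<close> is \<open>\<rho> n\<close>.\<close>
  have gf: "g (f n y) = y" if "y \<in> A n" for n y
  proof -
    have gf: "compose (A n) g (f n) \<in> hom S (A n) Y"
      using cat_cmp[OF is_category_set_mono_cat A Z Y f g] by (simp add: cmp_set_mono_cat)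
    have "far F (A n) Y (compose (A n) g (f n)) = far F (A n) Y (\<lambda>y\<in>A n. y)"
    proof (rule hom_eqI[OF P[of n, unfolded P_def] R F_hom[OF A Y gf] F_hom[OF A Y inc[OF AY]]])
      fix s z assume s: "s \<in> I" and z: "z \<in> E (fob F (A n)) s"
      have z': "z \<in> E (P n) s" using z by (simp add: P_def)
      have "far F (A n) Y (compose (A n) g (f n)) s z = far F Z Y g s (far F (A n) Z (f n) s z)"
        by (rule F_app_cmp[OF A Z Y f g s z])
      also have "far F (A n) Z (f n) s z = \<theta>' s (\<iota> n s z)"
        using app_cmp[OF P Q FZ \<iota> \<theta>' s z'] by (simp add: Ff)
      also have "far F Z Y g s \<dots> = r s (\<iota> n s z)"
        using app_in[OF P Q \<iota> s z'] app_in[OF Q FZ \<theta>' s] by (simp add: g_app[OF s] \<theta>\<theta>'_app[OF s])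
      finally show "far F (A n) Y (compose (A n) g (f n)) s z = far F (A n) Y (\<lambda>y\<in>A n. y) s z"
        using \<iota>_app[OF s z'] by simp
    qed
    then have "compose (A n) g (f n) = (\<lambda>y\<in>A n. y)"
      by (rule faithful[OF A Y gf inc[OF AY]])
    from fun_cong[OF this, of y] show ?thesis
      using that by (simp add: compose_def)
  qed
  \<comment> \<open>Any stage containing \<open>y\<close> gives the same value, by
    \<open>f_restr\<close>.\<close>
  define h where "h = (\<lambda>y\<in>Y. f (SOME n. y \<in> A n) y)"
  have h: "h y = f n y" if "y \<in> A n" for n y
  proof -
    have "y \<in> A (SOME n. y \<in> A n)" using that by (rule someI)
    then show ?thesis
      using that AY f_restr[of n "SOME n. y \<in> A n" y] f_restr[of "SOME n. y \<in> A n" n y]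
      by (cases "n \<le> (SOME n. y \<in> A n)") (auto simp: h_def)
  qed
  have gh: "g (h y) = y" if "y \<in> Y" for y
    using that un h gf by fastforce
  have hh: "h \<in> hom S Y Z"
    unfolding hom_set_mono_cat
  proof
    have "h y \<in> Z" if y: "y \<in> Y" for y
    proof -
      obtain n where n: "y \<in> A n" using y un by blast
      then show ?thesis using f[of n] h[OF n] by (auto simp: hom_set_mono_cat)
    qed
    then show "h \<in> Y \<rightarrow>\<^sub>E Z" by (auto simp: h_def)
    show "inj_on h Y" by (rule inj_on_inverseI[of _ g]) (rule gh)
  qed
  have "compose Y g h = (\<lambda>y\<in>Y. y)"
    using gh by (auto simp: compose_def)
  then have gh_x: "far F Z Y g t (far F Y Z h t x) = x"
    using F_app_cmp[OF Y Z Y hh g t x] F_app_idn[OF Y t x] by simp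
  have hx: "far F Y Z h t x \<in> E (fob F Z) t"
    by (rule F_app_in[OF Y Z hh t x])
  then obtain n z where z: "z \<in> E (P n) t" "\<iota> n t z = \<theta> t (far F Y Z h t x)"
    using cover t app_in[OF FZ Q \<theta> t hx] by blast
  have "far F (A n) Y (\<lambda>y\<in>A n. y) t z = x"
    using \<iota>_app[OF t z(1)] g_app[OF t hx] gh_x z(2) by simp
  then show ?thesis
    using z(1) by (auto simp: P_def)
qed


section \<open>Transpositions and finite supports\<close>

abbreviation tr :: "'u set \<Rightarrow> 'u \<Rightarrow> 'u \<Rightarrow> 't \<Rightarrow> 'u \<Rightarrow> 'u" where
  "tr Y a b \<equiv> far F Y Y (restrict (transpose a b) Y)"

text \<open>Transpositions are tested instead of all permutations fixing \<open>W\<close> pointwise: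
  they suffice both to move a support into \<open>V\<close> one point at a time and to locate the
  image of an injection.\<close>

definition supported :: "'u set \<Rightarrow> 't \<Rightarrow> 'u \<Rightarrow> 'u set \<Rightarrow> bool" where
  "supported Y t x W \<longleftrightarrow> finite W \<and> W \<subseteq> Y \<and> (\<forall>a\<in>Y - W. \<forall>b\<in>Y - W. tr Y a b t x = x)"

lemma transpose_hom: "a \<in> Y \<Longrightarrow> b \<in> Y \<Longrightarrow> restrict (transpose a b) Y \<in> hom S Y Y"
  by (auto simp: hom_set_mono_cat transpose_def inj_on_def)

lemma tr_in: "Y \<in> obj S \<Longrightarrow> a \<in> Y \<Longrightarrow> b \<in> Y \<Longrightarrow> t \<in> I \<Longrightarrow> x \<in> E (fob F Y) t \<Longrightarrow> tr Y a b t x \<in> E (fob F Y) t"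
  using F_app_in transpose_hom by blast

text \<open>Conjugation in the symmetric group of \<open>Y\<close>, transferred to elements by
  functoriality.\<close>

lemma tr_conj:
  assumes Y: "Y \<in> obj S" and "a \<in> Y" "b \<in> Y" "c \<in> Y" "d \<in> Y" and t: "t \<in> I" and x: "x \<in> E (fob F Y) t"
  shows "tr Y c d t (tr Y a b t x) = tr Y a b t (tr Y (transpose a b c) (transpose a b d) t x)"
proof -
  let ?c = "transpose a b c" and ?d = "transpose a b d"
  have cd: "?c \<in> Y" "?d \<in> Y" using assms by (auto simp: transpose_def)
  have "compose Y (restrict (transpose c d) Y) (restrict (transpose a b) Y)
      = compose Y (restrict (transpose a b) Y) (restrict (transpose ?c ?d) Y)"
  proof
    fix y
    have "transpose c d (transpose a b y) = transpose a b (transpose ?c ?d y)"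
      using transpose_apply_commute[of "transpose a b" c d y] by simp
    moreover have "transpose a b y \<in> Y" "transpose ?c ?d y \<in> Y" if "y \<in> Y"
      using assms(2,3) cd that by (auto simp: transpose_def)
    ultimately show "compose Y (restrict (transpose c d) Y) (restrict (transpose a b) Y) y
        = compose Y (restrict (transpose a b) Y) (restrict (transpose ?c ?d) Y) y"
      by (simp add: compose_def)
  qed
  then show ?thesis
    using F_app_cmp[OF Y Y Y transpose_hom[OF assms(2,3)] transpose_hom[OF assms(4,5)] t x]
      F_app_cmp[OF Y Y Y transpose_hom[OF cd] transpose_hom[OF assms(2,3)] t x] by simp
qed

text \<open>Conjugating by the exchange of \<open>a\<close> and \<open>b\<close> turns a
  transposition outside the image of \<open>W\<close> into one outside \<open>W\<close>, which fixes
  \<open>x\<close>.\<close>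

lemma supported_tr:
  assumes Y: "Y \<in> obj S" and a: "a \<in> Y" and b: "b \<in> Y" and t: "t \<in> I" and x: "x \<in> E (fob F Y) t"
    and W: "supported Y t x W"
  shows "supported Y t (tr Y a b t x) (transpose a b ` W)"
  unfolding supported_def
proof (intro conjI ballI)
  show "finite (transpose a b ` W)" "transpose a b ` W \<subseteq> Y"
    using W a b by (auto simp: supported_def transpose_def)
next
  fix c d assume c: "c \<in> Y - transpose a b ` W" and d: "d \<in> Y - transpose a b ` W"
  then have "transpose a b c \<in> Y - W" "transpose a b d \<in> Y - W"
    using a b by (auto simp: in_transpose_image_iff) (auto simp: transpose_def)
  then show "tr Y c d t (tr Y a b t x) = tr Y a b t x"
    using W c d by (simp add: tr_conj[OF Y a b _ _ t x] supported_def)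
qed

text \<open>If no finite set supports \<open>x\<close>, there are infinitely many disjoint pairs
  whose transpositions move \<open>x\<close>. Deleting all pairs from the \<open>n\<close>-th on
  yields an increasing chain of large sets with union \<open>Y\<close>, so \<open>x\<close> comes
  from one of them, on which the \<open>n\<close>-th transposition is trivial.\<close>

lemma finite_support:
  assumes Y: "Y \<in> obj S" and unc: "natLeq <o |Y|" and t: "t \<in> I" and x: "x \<in> E (fob F Y) t"
  shows "\<exists>W. supported Y t x W"
proof (rule ccontr)
  assume "\<not> ?thesis"
  then have "\<exists>a\<in>Y - W. \<exists>b\<in>Y - W. tr Y a b t x \<noteq> x" if "finite W" "W \<subseteq> Y" for W
    using that unfolding supported_def by blast
  then obtain a b :: "nat \<Rightarrow> 'u" where a: "\<And>n. a n \<in> Y" and b: "\<And>n. b n \<in> Y"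
    and moved: "\<And>n. tr Y (a n) (b n) t x \<noteq> x"
    and disj: "\<And>m n. m \<noteq> n \<Longrightarrow> {a m, b m} \<inter> {a n, b n} = {}"
    using ex_disjoint_pairs[of Y "\<lambda>a b. tr Y a b t x \<noteq> x"] by metis
  \<comment> \<open>Pair number \<open>n\<close> itself is deleted, so that its transposition fixes
    \<open>A n\<close> pointwise.\<close>
  define A where "A n = Y - (\<Union>i\<in>{n..}. {a i, b i})" for n
  have A: "A n \<in> obj S" for n
  proof -
    have "|range a| \<le>o natLeq" "|range b| \<le>o natLeq"
      by (rule ordLeq_ordIso_trans[OF card_of_image card_of_nat])+
    then have "|range a \<union> range b| \<le>o natLeq"
      using card_of_Un_ordLeq_infinite_Field[OF _ _ _ natLeq_Card_order] by (simp add: Field_natLeq)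
    moreover have "|\<Union>i\<in>{n..}. {a i, b i}| \<le>o |range a \<union> range b|"
      by (rule card_of_mono1) auto
    ultimately have "|\<Union>i\<in>{n..}. {a i, b i}| \<le>o natLeq"
      using ordLeq_transitive by blast
    then have "|Y| \<le>o |A n|"
      unfolding A_def by (rule card_of_diff_countable[OF unc])
    moreover have "|A n| \<le>o |Y|"
      by (rule card_of_mono1) (auto simp: A_def)
    ultimately show ?thesis
      using Y unfolding obj_set_mono_cat small_def
      by (meson ordLeq_ordLess_trans ordLeq_transitive)
  qed
  have mono: "m \<le> n \<Longrightarrow> A m \<subseteq> A n" for m n
    unfolding A_def by (intro Diff_mono UN_mono) auto
  \<comment> \<open>A point lies in at most one pair, hence in every \<open>A n\<close> past the
    index of that pair.\<close>
  have "\<exists>n. y \<in> A n" if "y \<in> Y" for y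
  proof (cases "\<exists>i. y \<in> {a i, b i}")
    case True
    then obtain i where "y \<in> {a i, b i}" by blast
    then have "y \<notin> {a j, b j}" if "j \<ge> Suc i" for j
      using disj[of i j] that by auto
    then show ?thesis using that by (auto simp: A_def intro!: exI[of _ "Suc i"])
  qed (use that in \<open>auto simp: A_def\<close>)
  then have un: "(\<Union>n. A n) = Y" by (auto simp: A_def)
  obtain n z where z: "z \<in> E (fob F (A n)) t" "far F (A n) Y (\<lambda>y\<in>A n. y) t z = x"
    using chain_support[OF Y A mono un t x] by blast
  have inc: "(\<lambda>y\<in>A n. y) \<in> hom S (A n) Y"
    by (auto simp: hom_set_mono_cat inj_on_def A_def)
  have "compose (A n) (restrict (transpose (a n) (b n)) Y) (\<lambda>y\<in>A n. y) = (\<lambda>y\<in>A n. y)"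
    by (auto simp: compose_def fun_eq_iff A_def transpose_def)
  then have "tr Y (a n) (b n) t x = x"
    using F_app_cmp[OF A Y Y inc transpose_hom[OF a[of n] b[of n]] t z(1)] z(2) by simp
  then show False using moved by blast
qed

text \<open>Exchange a point of \<open>W2\<close> outside \<open>V\<close> for a fresh point of
  \<open>V\<close> outside \<open>W1\<close> and \<open>W2\<close>. The number of points of the
  support outside \<open>V\<close> drops by one, and whatever \<open>W1\<close> supports is fixed
  because both exchanged points avoid \<open>W1\<close>. The order of quantifiers matters: one
  \<open>\<sigma>\<close> serves all elements at once.\<close>

lemma move_support:
  assumes Y: "Y \<in> obj S" and V: "V \<subseteq> Y" "infinite V" and "finite W1" "W1 \<subseteq> V" and "finite W2" "W2 \<subseteq> Y"
  shows "\<exists>\<sigma>\<in>hom D (fob F Y) (fob F Y). \<forall>t\<in>I. \<forall>x\<in>E (fob F Y) t.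
    (supported Y t x W1 \<longrightarrow> \<sigma> t x = x) \<and> (supported Y t x W2 \<longrightarrow> (\<exists>W3\<subseteq>V. supported Y t (\<sigma> t x) W3))"
  using \<open>finite W2\<close> \<open>W2 \<subseteq> Y\<close>
proof (induction "card (W2 - V)" arbitrary: W2)
  case 0
  then have "W2 \<subseteq> V" by simp
  then show ?case
    using app_idn F_obj[OF Y] cat_idn[OF category F_obj[OF Y]]
    by (intro bexI[of _ "idn D (fob F Y)"]) auto
next
  case (Suc k)
  then obtain a where a: "a \<in> W2" "a \<notin> V"
    by (metis Diff_iff card_gt_0_iff ex_in_conv zero_less_Suc)
  obtain b where b: "b \<in> V" "b \<notin> W1" "b \<notin> W2"
    using V(2) \<open>finite W1\<close> \<open>finite W2\<close> by (metis Un_iff finite_Un infinite_super subsetI)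
  have aY: "a \<in> Y" and bY: "b \<in> Y" using a b Suc.prems V by auto
  let ?W = "transpose a b ` W2"
  have W: "?W = insert b (W2 - {a})"
    using a b by (auto simp: in_transpose_image_iff) (auto simp: transpose_def split: if_splits)
  have "?W - V = (W2 - V) - {a}"
    using b by (auto simp: W)
  then have "card (?W - V) = k"
    using Suc.hyps(2) Suc.prems a by (simp add: card_Diff_singleton)
  moreover have "finite ?W" "?W \<subseteq> Y"
    using Suc.prems bY by (auto simp: W)
  ultimately obtain \<sigma> where \<sigma>: "\<sigma> \<in> hom D (fob F Y) (fob F Y)"
    and \<sigma>1: "\<And>t x. t \<in> I \<Longrightarrow> x \<in> E (fob F Y) t \<Longrightarrow> supported Y t x W1 \<Longrightarrow> \<sigma> t x = x"
    and \<sigma>2: "\<And>t x. t \<in> I \<Longrightarrow> x \<in> E (fob F Y) t \<Longrightarrow> supported Y t x ?W \<Longrightarrow> \<exists>W3\<subseteq>V. supported Y t (\<sigma> t x) W3"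
    using Suc.hyps(1)[of ?W] by blast
  have \<tau>: "tr Y a b \<in> hom D (fob F Y) (fob F Y)"
    by (rule F_hom[OF Y Y transpose_hom[OF aY bY]])
  let ?\<sigma> = "cmp D (fob F Y) (fob F Y) (fob F Y) \<sigma> (tr Y a b)"
  have FY: "fob F Y \<in> obj D" by (rule F_obj[OF Y])
  have app: "?\<sigma> t x = \<sigma> t (tr Y a b t x)" if "t \<in> I" "x \<in> E (fob F Y) t" for t x
    by (rule app_cmp[OF FY FY FY \<tau> \<sigma> that])
  show ?case
  proof (rule bexI[of _ ?\<sigma>], intro ballI conjI impI)
    fix t x assume t: "t \<in> I" and x: "x \<in> E (fob F Y) t"
    show "?\<sigma> t x = x" if "supported Y t x W1"
    proof -
      have "tr Y a b t x = x"
        using that a b aY bY \<open>W1 \<subseteq> V\<close> by (auto simp: supported_def)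
      then show ?thesis using app[OF t x] \<sigma>1[OF t x that] by simp
    qed
    show "\<exists>W3\<subseteq>V. supported Y t (?\<sigma> t x) W3" if "supported Y t x W2"
      unfolding app[OF t x]
      by (rule \<sigma>2[OF t tr_in[OF Y aY bY t x] supported_tr[OF Y aY bY t x that]])
  qed (rule cat_cmp[OF category FY FY FY \<tau> \<sigma>])
qed

lemma supported_mono: "supported Y t x W \<Longrightarrow> finite W' \<Longrightarrow> W \<subseteq> W' \<Longrightarrow> W' \<subseteq> Y \<Longrightarrow> supported Y t x W'"
  unfolding supported_def by blast

text \<open>\<open>move_support\<close> is applied with \<open>W1\<close> the union of the supports
  of those given elements that already lie in the part, and \<open>W2\<close> the union of the
  supports of all of them.\<close>

lemma homogeneous_supported:
  assumes Y: "Y \<in> obj S" and unc: "natLeq <o |Y|" and V: "V \<subseteq> Y" "infinite V"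
  shows "homogeneous D I E (fob F Y) (\<lambda>t. {x \<in> E (fob F Y) t. \<exists>W\<subseteq>V. supported Y t x W})"
    (is "homogeneous _ _ _ _ ?B")
  unfolding homogeneous_def
proof (intro conjI ballI allI impI)
  fix U assume "finite U \<and> (\<forall>(t, x)\<in>U. t \<in> I \<and> x \<in> E (fob F Y) t)"
  then have U: "finite U" "\<And>t x. (t, x) \<in> U \<Longrightarrow> t \<in> I" "\<And>t x. (t, x) \<in> U \<Longrightarrow> x \<in> E (fob F Y) t"
    by auto
  have ex: "\<exists>W. supported Y t x W \<and> (x \<in> ?B t \<longrightarrow> W \<subseteq> V)" if "(t, x) \<in> U" for t x
  proof (cases "\<exists>W\<subseteq>V. supported Y t x W")
    case False
    then show ?thesis using finite_support[OF Y unc U(2,3)[OF that]] by blast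
  qed blast
  \<comment> \<open>A support inside \<open>V\<close> is preferred whenever there is one; this is
    what puts \<open>W1\<close> inside \<open>V\<close>.\<close>
  define w where "w p = (SOME W. supported Y (fst p) (snd p) W \<and> (snd p \<in> ?B (fst p) \<longrightarrow> W \<subseteq> V))" for p
  have w: "supported Y t x (w (t, x)) \<and> (x \<in> ?B t \<longrightarrow> w (t, x) \<subseteq> V)" if "(t, x) \<in> U" for t x
    unfolding w_def fst_conv snd_conv by (rule someI_ex[OF ex[OF that]])
  define W1 where "W1 = \<Union> (w ` {p \<in> U. snd p \<in> ?B (fst p)})"
  define W2 where "W2 = \<Union> (w ` U)"
  have W1: "w (t, x) \<subseteq> W1" if "(t, x) \<in> U" "x \<in> ?B t" for t x
    unfolding W1_def by (rule Union_upper, rule imageI) (use that in simp)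
  have W2: "w (t, x) \<subseteq> W2" if "(t, x) \<in> U" for t x
    unfolding W2_def by (rule Union_upper, rule imageI) (rule that)
  have "finite (w p)" "w p \<subseteq> Y" if "p \<in> U" for p
    using w[of "fst p" "snd p"] that by (simp_all add: supported_def)
  then have fin: "finite W1" "finite W2" and sub2: "W2 \<subseteq> Y"
    using U(1) unfolding W1_def W2_def by (simp_all add: UN_subset_iff)
  have "w p \<subseteq> V" if "p \<in> U" "snd p \<in> ?B (fst p)" for p
    using w[of "fst p" "snd p"] that by simp
  then have sub1: "W1 \<subseteq> V"
    unfolding W1_def by (simp add: UN_subset_iff)
  obtain \<sigma> where \<sigma>: "\<sigma> \<in> hom D (fob F Y) (fob F Y)"
    and \<sigma>1: "\<And>t x. t \<in> I \<Longrightarrow> x \<in> E (fob F Y) t \<Longrightarrow> supported Y t x W1 \<Longrightarrow> \<sigma> t x = x"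
    and \<sigma>2: "\<And>t x. t \<in> I \<Longrightarrow> x \<in> E (fob F Y) t \<Longrightarrow> supported Y t x W2 \<Longrightarrow> \<exists>W3\<subseteq>V. supported Y t (\<sigma> t x) W3"
    using move_support[OF Y V fin(1) sub1 fin(2) sub2] by blast
  have "\<sigma> t x \<in> ?B t" "x \<in> ?B t \<longrightarrow> \<sigma> t x = x" if tx: "(t, x) \<in> U" for t x
  proof -
    have "supported Y t x W2"
      using supported_mono[OF _ fin(2) W2[OF tx] sub2] w[OF tx] by blast
    then show "\<sigma> t x \<in> ?B t"
      using \<sigma>2 U(2,3)[OF tx] app_in[OF F_obj[OF Y] F_obj[OF Y] \<sigma>] by blast
    show "x \<in> ?B t \<longrightarrow> \<sigma> t x = x"
    proof
      assume "x \<in> ?B t"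
      then have "supported Y t x W1"
        using supported_mono[OF _ fin(1) W1[OF tx]] w[OF tx] sub1 V(1) by blast
      then show "\<sigma> t x = x" using \<sigma>1 U(2,3)[OF tx] by blast
    qed
  qed
  then show "\<exists>\<sigma>\<in>hom D (fob F Y) (fob F Y). \<forall>(t, x)\<in>U. \<sigma> t x \<in> ?B t \<and> (x \<in> ?B t \<longrightarrow> \<sigma> t x = x)"
    using \<sigma> by blast
qed auto

lemma ex_countable_obj:
  assumes Y: "Y \<in> obj S" and unc: "natLeq <o |Y|"
  shows "\<exists>X\<in>obj S. |X| \<le>o natLeq"
proof -
  have "infinite Y"
    using unc infinite_iff_natLeq_ordLeq ordLess_imp_ordLeq by blast
  then obtain e :: "nat \<Rightarrow> 'u" where e: "inj e" "range e \<subseteq> Y"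
    using infinite_countable_subset by blast
  define V where "V = range e"
  have V: "V \<subseteq> Y" "infinite V" and V_le: "|V| \<le>o natLeq"
    using e finite_imageD[of e UNIV] card_of_image[of e UNIV] card_of_nat ordLeq_ordIso_trans
    by (auto simp: V_def)
  \<comment> \<open>A point outside \<open>V\<close> will need a second point outside
    \<open>V\<close> to be exchanged with.\<close>
  have "|Y| \<le>o |Y - V|" by (rule card_of_diff_countable[OF unc V_le])
  then have YV: "infinite (Y - V)"
    using \<open>infinite Y\<close> card_of_ordLeq_infinite by blast
  have FY: "fob F Y \<in> obj D" by (rule F_obj[OF Y])
  obtain P j where P: "P \<in> obj D" and j: "j \<in> hom D P (fob F Y)"
    and jV: "\<And>t x. t \<in> I \<Longrightarrow> x \<in> E P t \<Longrightarrow> \<exists>W\<subseteq>V. supported Y t (j t x) W"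
    using homogeneous_part[OF FY homogeneous_supported[OF Y unc V]] by blast
  obtain X \<theta> where X: "X \<in> obj S" and \<theta>: "\<theta> \<in> hom D (fob F X) P"
    using ess_surj[OF P] by (auto simp: isomorphic_def)
  have FX: "fob F X \<in> obj D" by (rule F_obj[OF X])
  obtain h where h: "h \<in> hom S X Y" and Fh: "far F X Y h = cmp D (fob F X) P (fob F Y) j \<theta>"
    using full[OF X Y cat_cmp[OF category FX P FY \<theta> j]] by blast
  \<comment> \<open>Checked on elements after applying \<open>F\<close>: every value of
    \<open>j\<close> has a support inside \<open>V\<close>, which \<open>a\<close> and
    \<open>b\<close> avoid. Faithfulness brings the equation back to \<open>h\<close>.\<close>
  have fixed: "compose X (restrict (transpose a b) Y) h = h" if "a \<in> Y - V" "b \<in> Y - V" for a b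
  proof -
    have \<tau>: "restrict (transpose a b) Y \<in> hom S Y Y" using transpose_hom that by blast
    have \<tau>h: "compose X (restrict (transpose a b) Y) h \<in> hom S X Y"
      using cat_cmp[OF is_category_set_mono_cat X Y Y h \<tau>] by (simp add: cmp_set_mono_cat)
    have "far F X Y (compose X (restrict (transpose a b) Y) h) = far F X Y h"
    proof (rule hom_eqI[OF FX FY F_hom[OF X Y \<tau>h] F_hom[OF X Y h]])
      fix t x assume t: "t \<in> I" and x: "x \<in> E (fob F X) t"
      have *: "far F X Y h t x = j t (\<theta> t x)"
        using app_cmp[OF FX P FY \<theta> j t x] by (simp add: Fh)
      obtain W where "W \<subseteq> V" "supported Y t (j t (\<theta> t x)) W"
        using jV[OF t app_in[OF FX P \<theta> t x]] by blast
      then show "far F X Y (compose X (restrict (transpose a b) Y) h) t x = far F X Y h t x"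
        using F_app_cmp[OF X Y Y h \<tau> t x] that by (auto simp: * supported_def)
    qed
    then show ?thesis by (rule faithful[OF X Y \<tau>h h])
  qed
  have "h ` X \<subseteq> V"
  proof
    fix a assume "a \<in> h ` X"
    then obtain x where x: "x \<in> X" "h x = a" by blast
    then have aY: "a \<in> Y" using h by (auto simp: hom_set_mono_cat)
    show "a \<in> V"
    proof (rule ccontr)
      assume a: "a \<notin> V"
      \<comment> \<open>Exchanging \<open>a\<close> with another point outside \<open>V\<close>
        would change the value \<open>a\<close> of \<open>h\<close>.\<close>
      obtain b where b: "b \<in> Y - V" "b \<noteq> a"
        using YV by (metis finite.emptyI finite.insertI finite_subset insertCI subsetI)
      have "compose X (restrict (transpose a b) Y) h x = b"
        using x aY by (simp add: compose_def)
      then show False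
        using fixed[of a b] a aY b x by simp
    qed
  qed
  then have "|X| \<le>o |V|"
    using h card_of_ordLeq[of X V] by (auto simp: hom_set_mono_cat)
  then show ?thesis using X V_le ordLeq_transitive by blast
qed

end

lemma (in structured_category) not_equivalent_set_mono_cat:
  fixes \<kappa> :: "'k rel"
  assumes \<kappa>: "Card_order \<kappa>" "natLeq <o \<kappa>" "\<kappa> <o |UNIV :: 'u set|"
  shows "\<not> equivalent (set_mono_cat \<kappa> :: ('u set, 'u \<Rightarrow> 'u) cat) D"
proof
  let ?S = "set_mono_cat \<kappa> :: ('u set, 'u \<Rightarrow> 'u) cat"
  assume eq: "equivalent ?S D"
  obtain F where F: "structured_equivalence D I E \<kappa> F"
    by (rule equivalent_imp_fully_faithful_ess_surj[OF is_category_set_mono_cat category eq])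
      (rule that, unfold_locales, blast+)
  interpret structured_equivalence D I E \<kappa> F by (rule F)
  \<comment> \<open>\<open>\<kappa>\<close> lives on a type of its own; a copy of its field inside
    \<open>'u\<close> serves as the uncountable object \<open>Y\<close>.\<close>
  have *: "|Field \<kappa>| =o \<kappa>" by (rule card_of_Field_ordIso[OF \<kappa>(1)])
  then have "|Field \<kappa>| \<le>o |UNIV :: 'u set|"
    using \<kappa>(3) by (meson ordIso_ordLess_trans ordLess_imp_ordLeq)
  then obtain e :: "'k \<Rightarrow> 'u" where "inj_on e (Field \<kappa>)"
    using card_of_ordLeq[of "Field \<kappa>" "UNIV :: 'u set"] by auto
  then have "|e ` Field \<kappa>| =o |Field \<kappa>|"
    using card_of_ordIso[of "Field \<kappa>" "e ` Field \<kappa>"] inj_on_imp_bij_betw ordIso_symmetric by blast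
  then have Y: "|e ` Field \<kappa>| =o \<kappa>" using * ordIso_transitive by blast
  then have "e ` Field \<kappa> \<in> obj ?S"
    using \<kappa>(3) by (simp add: obj_set_mono_cat small_def ordIso_ordLess_trans ordIso_iff_ordLeq)
  then obtain X where "X \<in> obj ?S" "|X| \<le>o natLeq"
    using ex_countable_obj \<kappa>(2) Y ordIso_symmetric ordLess_ordIso_trans by blast
  then have "\<kappa> \<le>o natLeq" using ordLeq_transitive by (auto simp: obj_set_mono_cat)
  then have "\<kappa> <o \<kappa>" using \<kappa>(2) ordLeq_ordLess_trans by blast
  then show False using ordLess_irreflexive by blast
qed

section \<open>Points\<close>

lemma small_finite: "infinite (UNIV :: 'u set) \<Longrightarrow> finite A \<Longrightarrow> small TYPE('u) A"
  unfolding small_def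
  by (rule finite_ordLess_infinite[OF card_of_Well_order card_of_Well_order]) (simp_all add: Field_card_of)

lemma small_subset: "small TYPE('u) B \<Longrightarrow> A \<subseteq> B \<Longrightarrow> small TYPE('u) A"
  unfolding small_def using card_of_mono1 ordLeq_ordLess_trans by blast

lemma is_functor_comp: "is_functor C D F \<Longrightarrow> is_functor D E G \<Longrightarrow> is_functor C E (comp_fctr G F)"
  by (simp add: is_functor_def comp_fctr_def)

lemma is_cocone_fctr:
  assumes p: "is_functor T C p" and D: "is_functor J T D" and coc: "is_cocone J T D c \<iota>"
  shows "is_cocone J C (comp_fctr p D) (fob p c) (\<lambda>j. far p (fob D j) c (\<iota> j))"
  unfolding is_cocone_def comp_fctr_def fctr.simps
proof (intro conjI ballI)
  have c: "c \<in> obj T" and \<iota>: "\<And>i. i \<in> obj J \<Longrightarrow> \<iota> i \<in> hom T (fob D i) c"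
    and \<iota>u: "\<And>i j u. i \<in> obj J \<Longrightarrow> j \<in> obj J \<Longrightarrow> u \<in> hom J i j \<Longrightarrow>
      cmp T (fob D i) (fob D j) c (\<iota> j) (far D i j u) = \<iota> i"
    using coc by (auto simp: is_cocone_def)
  show "fob p c \<in> obj C" by (rule fctr_obj[OF p c])
  show "far p (fob D i) c (\<iota> i) \<in> hom C (fob p (fob D i)) (fob p c)" if "i \<in> obj J" for i
    by (rule fctr_hom[OF p fctr_obj[OF D that] c \<iota>[OF that]])
  show "cmp C (fob p (fob D i)) (fob p (fob D j)) (fob p c) (far p (fob D j) c (\<iota> j))
      (far p (fob D i) (fob D j) (far D i j u)) = far p (fob D i) c (\<iota> i)"
    if "i \<in> obj J" "j \<in> obj J" "u \<in> hom J i j" for i j u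
    using fctr_cmp[OF p fctr_obj[OF D that(1)] fctr_obj[OF D that(2)] c fctr_hom[OF D that] \<iota>[OF that(2)]]
    by (simp add: \<iota>u[OF that])
qed

lemma is_cone_fctr:
  assumes p: "is_functor T C p" and D: "is_functor J T D" and cone: "is_cone J T D c \<pi>"
  shows "is_cone J C (comp_fctr p D) (fob p c) (\<lambda>j. far p c (fob D j) (\<pi> j))"
  unfolding is_cone_def comp_fctr_def fctr.simps
proof (intro conjI ballI)
  have c: "c \<in> obj T" and \<pi>: "\<And>i. i \<in> obj J \<Longrightarrow> \<pi> i \<in> hom T c (fob D i)"
    and \<pi>u: "\<And>i j u. i \<in> obj J \<Longrightarrow> j \<in> obj J \<Longrightarrow> u \<in> hom J i j \<Longrightarrow>
      cmp T c (fob D i) (fob D j) (far D i j u) (\<pi> i) = \<pi> j"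
    using cone by (auto simp: is_cone_def)
  show "fob p c \<in> obj C" by (rule fctr_obj[OF p c])
  show "far p c (fob D i) (\<pi> i) \<in> hom C (fob p c) (fob p (fob D i))" if "i \<in> obj J" for i
    by (rule fctr_hom[OF p c fctr_obj[OF D that] \<pi>[OF that]])
  show "cmp C (fob p c) (fob p (fob D i)) (fob p (fob D j)) (far p (fob D i) (fob D j) (far D i j u))
      (far p c (fob D i) (\<pi> i)) = far p c (fob D j) (\<pi> j)"
    if "i \<in> obj J" "j \<in> obj J" "u \<in> hom J i j" for i j u
    using fctr_cmp[OF p c fctr_obj[OF D that(1)] fctr_obj[OF D that(2)] \<pi>[OF that(1)] fctr_hom[OF D that]]
    by (simp add: \<pi>u[OF that])
qed

text \<open>Each clause concerns finitely many elements at a time: one element of a colimit, the two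
  ends of a zigzag, or a family over a finite shape. This is what lets the notion pass to
  homogeneous parts and to colimits of chains.\<close>

definition elementwise_point :: "('o, 'a) cat \<Rightarrow> ('o, 'a, 'u set, 'u \<Rightarrow> 'u) fctr \<Rightarrow> bool" where
  "elementwise_point T p \<longleftrightarrow> is_functor T set_cat p \<and>
    (\<forall>(J :: ('u, 'u) cat) D c \<iota>. small_category TYPE('u) J \<and> is_functor J T D \<and> is_colimit J T D c \<iota> \<longrightarrow>
       (\<forall>y\<in>fob p c. \<exists>j\<in>obj J. \<exists>x\<in>fob p (fob D j). far p (fob D j) c (\<iota> j) x = y) \<and>
       (\<forall>i\<in>obj J. \<forall>j\<in>obj J. \<forall>x\<in>fob p (fob D i). \<forall>z\<in>fob p (fob D j).
          far p (fob D i) c (\<iota> i) x = far p (fob D j) c (\<iota> j) z \<longrightarrow>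
          zigzag J (comp_fctr p D) (i, x) (j, z))) \<and>
    (\<forall>(J :: ('u, 'u) cat) D c \<pi>. finite_category J \<and> is_functor J T D \<and> is_limit J T D c \<pi> \<longrightarrow>
       (\<forall>x. compatible J (comp_fctr p D) x \<longrightarrow>
          (\<exists>!y. y \<in> fob p c \<and> (\<forall>j\<in>obj J. far p c (fob D j) (\<pi> j) y = x j))))"

lemma elementwise_point_surj:
  fixes J :: "('u, 'u) cat" and p :: "('o, 'a, 'u set, 'u \<Rightarrow> 'u) fctr"
  assumes "elementwise_point T p" "small_category TYPE('u) J \<and> is_functor J T D \<and> is_colimit J T D c \<iota>"
  shows "y \<in> fob p c \<Longrightarrow> \<exists>j\<in>obj J. \<exists>x\<in>fob p (fob D j). far p (fob D j) c (\<iota> j) x = y"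
  using assms unfolding elementwise_point_def by blast

lemma elementwise_point_zigzag:
  fixes J :: "('u, 'u) cat" and p :: "('o, 'a, 'u set, 'u \<Rightarrow> 'u) fctr"
  assumes "elementwise_point T p" "small_category TYPE('u) J \<and> is_functor J T D \<and> is_colimit J T D c \<iota>"
  shows "i \<in> obj J \<Longrightarrow> j \<in> obj J \<Longrightarrow> x \<in> fob p (fob D i) \<Longrightarrow> z \<in> fob p (fob D j) \<Longrightarrow>
    far p (fob D i) c (\<iota> i) x = far p (fob D j) c (\<iota> j) z \<Longrightarrow> zigzag J (comp_fctr p D) (i, x) (j, z)"
  using assms unfolding elementwise_point_def by blast

lemma elementwise_point_limit:
  fixes J :: "('u, 'u) cat" and p :: "('o, 'a, 'u set, 'u \<Rightarrow> 'u) fctr"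
  assumes p: "elementwise_point T p" and J: "finite_category J \<and> is_functor J T D \<and> is_limit J T D c \<pi>"
    and x: "compatible J (comp_fctr p D) x"
  shows "\<exists>!y. y \<in> fob p c \<and> (\<forall>j\<in>obj J. far p c (fob D j) (\<pi> j) y = x j)"
  by (rule p[unfolded elementwise_point_def, THEN conjunct2, THEN conjunct2, rule_format, OF J x])

text \<open>A functor carries cones to cones and cocones to cocones, so only the universal property
  is at stake, and in sets it is tested on elements.\<close>

lemma is_point_iff_elementwise:
  fixes p :: "('o, 'a, 'u set, 'u \<Rightarrow> 'u) fctr"
  assumes inf: "infinite (UNIV :: 'u set)"
  shows "is_point T p \<longleftrightarrow> elementwise_point T p"
proof
  assume p: "is_point T p"
  then have F: "is_functor T set_cat p" by (simp add: is_point_def)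
  have "\<exists>a b :: 'u. a \<noteq> b"
    using inf by (metis (full_types) UNIV_I ex_new_if_finite finite.emptyI finite.insertI insertI1)
  note colim = is_colimit_set_catD[OF is_functor_comp[OF _ F] _ this small_finite[OF inf]]
  note lim = is_limit_set_catD[OF is_functor_comp[OF _ F] _ small_finite[OF inf]]
  show "elementwise_point T p"
    unfolding elementwise_point_def
  proof (intro conjI allI impI F ballI)
    fix J :: "('u, 'u) cat" and D c \<iota>
    assume J: "small_category TYPE('u) J \<and> is_functor J T D \<and> is_colimit J T D c \<iota>"
    then have D: "is_functor J T D" 
      and *: "is_colimit J set_cat (comp_fctr p D) (fob p c) (\<lambda>j. far p (fob D j) c (\<iota> j))"
      using p by (auto simp: is_point_def preserves_small_colimits_def)
    show "\<exists>j\<in>obj J. \<exists>x\<in>fob p (fob D j). far p (fob D j) c (\<iota> j) x = y" if "y \<in> fob p c" for y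
      using colim(1)[OF D * _ that] by (simp add: comp_fctr_def)
    show "zigzag J (comp_fctr p D) (i, x) (j, z)"
      if "i \<in> obj J" "j \<in> obj J" "x \<in> fob p (fob D i)" "z \<in> fob p (fob D j)"
        "far p (fob D i) c (\<iota> i) x = far p (fob D j) c (\<iota> j) z" for i j x z
      by (rule colim(2)[OF D *]) (use that in \<open>simp_all add: comp_fctr_def\<close>)
  next
    fix J :: "('u, 'u) cat" and D c \<pi> x
    assume J: "finite_category J \<and> is_functor J T D \<and> is_limit J T D c \<pi>"
      and x: "compatible J (comp_fctr p D) x"
    then have D: "is_functor J T D" 
      and *: "is_limit J set_cat (comp_fctr p D) (fob p c) (\<lambda>j. far p c (fob D j) (\<pi> j))"
      using p by (auto simp: is_point_def preserves_finite_limits_def)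
    show "\<exists>!y. y \<in> fob p c \<and> (\<forall>j\<in>obj J. far p c (fob D j) (\<pi> j) y = x j)"
      by (rule lim[OF D * _ x]) simp
  qed
next
  assume p: "elementwise_point T p"
  then have F: "is_functor T set_cat p" by (simp add: elementwise_point_def)
  show "is_point T p"
    unfolding is_point_def preserves_small_colimits_def preserves_finite_limits_def
  proof (intro conjI allI impI F)
    fix J :: "('u, 'u) cat" and D c \<iota>
    assume J: "small_category TYPE('u) J \<and> is_functor J T D \<and> is_colimit J T D c \<iota>"
    then have D: "is_functor J T D" and coc: "is_cocone J T D c \<iota>" by (auto simp: is_colimit_def)
    note surj = elementwise_point_surj[OF p J] and conn = elementwise_point_zigzag[OF p J]
    show "is_colimit J set_cat (comp_fctr p D) (fob p c) (\<lambda>j. far p (fob D j) c (\<iota> j))"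
      by (rule is_colimit_set_catI[OF is_functor_comp[OF D F] is_cocone_fctr[OF F D coc]])
        (use surj conn in \<open>simp_all add: comp_fctr_def\<close>)
  next
    fix J :: "('u, 'u) cat" and D c \<pi>
    assume J: "finite_category J \<and> is_functor J T D \<and> is_limit J T D c \<pi>"
    then have D: "is_functor J T D" and cone: "is_cone J T D c \<pi>" by (auto simp: is_limit_def)
    show "is_limit J set_cat (comp_fctr p D) (fob p c) (\<lambda>j. far p c (fob D j) (\<pi> j))"
      by (rule is_limit_set_catI[OF is_functor_comp[OF D F] is_cone_fctr[OF F D cone] elementwise_point_limit[OF p J]])
  qed
qed

section \<open>The category of points: homogeneous parts and chains\<close>

lemma obj_point_cat: "p \<in> obj (point_cat T) \<longleftrightarrow> is_point T p"
  by (auto simp: point_cat_def full_subcat_def fctr_cat_def is_point_def)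

lemma hom_point_cat:
  assumes p: "is_functor T set_cat p"
  shows "\<alpha> \<in> hom (point_cat T) p q \<longleftrightarrow> \<alpha> \<in> (\<Pi>\<^sub>E t\<in>obj T. fob p t \<rightarrow>\<^sub>E fob q t) \<and>
    (\<forall>t\<in>obj T. \<forall>s\<in>obj T. \<forall>f\<in>hom T t s. \<forall>x\<in>fob p t. \<alpha> s (far p t s f x) = far q t s f (\<alpha> t x))"
  by (auto simp: point_cat_def full_subcat_def fctr_cat_def nat_trans_def set_cat_simps
      compose_def fun_eq_iff restrict_def)

lemma idn_point_cat: "idn (point_cat T) p = (\<lambda>t\<in>obj T. \<lambda>x\<in>fob p t. x)"
  by (simp add: point_cat_def full_subcat_def fctr_cat_def set_cat_simps)

lemma cmp_point_cat: "cmp (point_cat T) p q r \<beta> \<alpha> = (\<lambda>t\<in>obj T. compose (fob p t) (\<beta> t) (\<alpha> t))"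
  by (simp add: point_cat_def full_subcat_def fctr_cat_def set_cat_simps)

lemma set_functor_in:
  "is_functor T set_cat p \<Longrightarrow> t \<in> obj T \<Longrightarrow> s \<in> obj T \<Longrightarrow> f \<in> hom T t s \<Longrightarrow> x \<in> fob p t \<Longrightarrow> far p t s f x \<in> fob p s"
  using fctr_hom[of T set_cat p t s f] by (auto simp: set_cat_simps)

lemma set_functor_idn:
  "is_functor T set_cat p \<Longrightarrow> t \<in> obj T \<Longrightarrow> x \<in> fob p t \<Longrightarrow> far p t t (idn T t) x = x"
  using fctr_idn[of T set_cat p t] by (simp add: set_cat_simps)

lemma set_functor_cmp:
  "is_functor T set_cat p \<Longrightarrow> t \<in> obj T \<Longrightarrow> s \<in> obj T \<Longrightarrow> r \<in> obj T \<Longrightarrow> f \<in> hom T t s \<Longrightarrow> g \<in> hom T s r \<Longrightarrow>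
    x \<in> fob p t \<Longrightarrow> far p t r (cmp T t s r g f) x = far p s r g (far p t s f x)"
  using fctr_cmp[of T set_cat p t s r f g] by (simp add: set_cat_simps compose_def)

lemma set_functorI:
  fixes p :: "('o, 'a, 'u set, 'u \<Rightarrow> 'u) fctr"
  assumes T: "is_category T" and "\<And>t. t \<in> obj T \<Longrightarrow> small TYPE('u) (fob p t)"
    and hom: "\<And>t s f. t \<in> obj T \<Longrightarrow> s \<in> obj T \<Longrightarrow> f \<in> hom T t s \<Longrightarrow> far p t s f \<in> fob p t \<rightarrow>\<^sub>E fob p s"
    and idn: "\<And>t x. t \<in> obj T \<Longrightarrow> x \<in> fob p t \<Longrightarrow> far p t t (idn T t) x = x"
    and cmp: "\<And>t s r f g x. t \<in> obj T \<Longrightarrow> s \<in> obj T \<Longrightarrow> r \<in> obj T \<Longrightarrow> f \<in> hom T t s \<Longrightarrow> g \<in> hom T s r \<Longrightarrow>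
      x \<in> fob p t \<Longrightarrow> far p t r (cmp T t s r g f) x = far p s r g (far p t s f x)"
  shows "is_functor T set_cat p"
  unfolding is_functor_def set_cat_simps
proof (intro conjI ballI)
  show "far p t t (idn T t) = (\<lambda>x\<in>fob p t. x)" if "t \<in> obj T" for t
    by (rule extensionalityI[of _ "fob p t"])
      (use hom[OF that that cat_idn[OF T that]] idn that in \<open>auto simp: PiE_iff\<close>)
  show "far p t r (cmp T t s r g f) = compose (fob p t) (far p s r g) (far p t s f)"
    if "t \<in> obj T" "s \<in> obj T" "r \<in> obj T" "f \<in> hom T t s" "g \<in> hom T s r" for t s r f g
    by (rule extensionalityI[of _ "fob p t"])
      (use hom[OF that(1,3) cat_cmp[OF T that]] cmp[OF that] in \<open>auto simp: PiE_iff compose_def\<close>)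
qed (use assms in blast)+

text \<open>The sets \<open>B t\<close> form a subfunctor of \<open>R\<close>. Each clause is first
  solved in \<open>R\<close>; then an endomorphism fixes the data already in \<open>B\<close> and
  moves the rest of the solution into \<open>B\<close>. By naturality the image is still a
  solution.\<close>

lemma point_homogeneous_part:
  fixes R :: "('o, 'a, 'u set, 'u \<Rightarrow> 'u) fctr"
  assumes T: "is_category T" and inf: "infinite (UNIV :: 'u set)"
    and R: "is_point T R" and B: "homogeneous (point_cat T) (obj T) fob R B"
  shows "\<exists>P\<in>obj (point_cat T). \<exists>j\<in>hom (point_cat T) P R. \<forall>t\<in>obj T. \<forall>x\<in>fob P t. j t x \<in> B t"
proof -
  have RF: "is_functor T set_cat R" and Re: "elementwise_point T R"
    using R is_point_iff_elementwise[OF inf] by (auto simp: is_point_def)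
  have BR: "B t \<subseteq> fob R t" if "t \<in> obj T" for t
    using B that unfolding homogeneous_def by blast
  have move: "\<exists>\<sigma>\<in>hom (point_cat T) R R. \<forall>(t, x)\<in>W. \<sigma> t x \<in> B t \<and> (x \<in> B t \<longrightarrow> \<sigma> t x = x)"
    if "finite W" "\<And>t x. (t, x) \<in> W \<Longrightarrow> t \<in> obj T \<and> x \<in> fob R t" for W
    using B that unfolding homogeneous_def by blast
  have nat: "\<sigma> s (far R t s f x) = far R t s f (\<sigma> t x)"
    if "\<sigma> \<in> hom (point_cat T) R R" "t \<in> obj T" "s \<in> obj T" "f \<in> hom T t s" "x \<in> fob R t" for \<sigma> t s f x
    using that hom_point_cat[OF RF] by blast
  have \<sigma>_in: "\<sigma> t x \<in> fob R t"
    if "\<sigma> \<in> hom (point_cat T) R R" "t \<in> obj T" "x \<in> fob R t" for \<sigma> t x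
    using that hom_point_cat[OF RF] by blast
  \<comment> \<open>The endomorphism fixes \<open>x\<close>, so by naturality it fixes the image of
    \<open>x\<close>, which it also sends into \<open>B s\<close>.\<close>
  have closed: "far R t s f x \<in> B s" if t: "t \<in> obj T" "s \<in> obj T" "f \<in> hom T t s" and x: "x \<in> B t" for t s f x
  proof -
    have xR: "x \<in> fob R t" using x BR t by blast
    obtain \<sigma> where \<sigma>: "\<sigma> \<in> hom (point_cat T) R R"
      and "\<forall>(t, x)\<in>{(t, x), (s, far R t s f x)}. \<sigma> t x \<in> B t \<and> (x \<in> B t \<longrightarrow> \<sigma> t x = x)"
      using move[of "{(t, x), (s, far R t s f x)}"] t xR set_functor_in[OF RF t xR] by auto
    then have "\<sigma> s (far R t s f x) \<in> B s" "\<sigma> t x = x" using x by auto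
    then show ?thesis using nat[OF \<sigma> t xR] by simp
  qed
  define P where "P = \<lparr> fob = B, far = (\<lambda>t s f. restrict (far R t s f) (B t)) \<rparr>"
  have P: "fob P = B" "far P t s f = restrict (far R t s f) (B t)" for t s f
    by (simp_all add: P_def)
  have PF: "is_functor T set_cat P"
  proof (rule set_functorI[OF T], unfold P)
    fix t assume t: "t \<in> obj T"
    show "small TYPE('u) (B t)"
      using fctr_obj[OF RF t] BR[OF t] small_subset by (auto simp: set_cat_simps)
    show "restrict (far R t t (idn T t)) (B t) x = x" if "x \<in> B t" for x
      using that set_functor_idn[OF RF t] BR[OF t] by auto
  next
    fix t s f assume "t \<in> obj T" "s \<in> obj T" "f \<in> hom T t s"
    then show "restrict (far R t s f) (B t) \<in> B t \<rightarrow>\<^sub>E B s"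
      using closed by auto
  next
    fix t s r f g x
    assume *: "t \<in> obj T" "s \<in> obj T" "r \<in> obj T" "f \<in> hom T t s" "g \<in> hom T s r" and x: "x \<in> B t"
    then have "x \<in> fob R t" using BR by blast
    then show "restrict (far R t r (cmp T t s r g f)) (B t) x =
        restrict (far R s r g) (B s) (restrict (far R t s f) (B t) x)"
      using set_functor_cmp[OF RF *] x closed * by simp
  qed
  have "elementwise_point T P"
    unfolding elementwise_point_def
  proof (intro conjI allI impI PF ballI)
    fix J :: "('u, 'u) cat" and D c \<iota>
    assume J: "small_category TYPE('u) J \<and> is_functor J T D \<and> is_colimit J T D c \<iota>"
    then have D: "is_functor J T D" and c: "c \<in> obj T"
      and \<iota>: "\<And>j. j \<in> obj J \<Longrightarrow> \<iota> j \<in> hom T (fob D j) c"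
      by (auto simp: is_colimit_def is_cocone_def)
    have Dj: "fob D j \<in> obj T" if "j \<in> obj J" for j by (rule fctr_obj[OF D that])
    note surj = elementwise_point_surj[OF Re J] and conn = elementwise_point_zigzag[OF Re J]
    show "\<exists>j\<in>obj J. \<exists>x\<in>fob P (fob D j). far P (fob D j) c (\<iota> j) x = y" if "y \<in> fob P c" for y
    proof -
      have y: "y \<in> B c" using that by (simp add: P)
      then have yR: "y \<in> fob R c" using BR[OF c] by blast
      from surj[OF yR] obtain j x where j: "j \<in> obj J" and x: "x \<in> fob R (fob D j)"
        and xy: "far R (fob D j) c (\<iota> j) x = y" by blast
      obtain \<sigma> where \<sigma>: "\<sigma> \<in> hom (point_cat T) R R"
        and "\<forall>(t, x)\<in>{(c, y), (fob D j, x)}. \<sigma> t x \<in> B t \<and> (x \<in> B t \<longrightarrow> \<sigma> t x = x)"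
        using move[of "{(c, y), (fob D j, x)}"] c yR Dj[OF j] x by auto
      then have "\<sigma> c y = y" and \<sigma>x: "\<sigma> (fob D j) x \<in> fob P (fob D j)" using y by (auto simp: P)
      then have "far P (fob D j) c (\<iota> j) (\<sigma> (fob D j) x) = y"
        using nat[OF \<sigma> Dj[OF j] c \<iota>[OF j] x] xy by (simp add: P)
      then show ?thesis using j \<sigma>x by blast
    qed
    \<comment> \<open>\<open>W\<close> collects the elements at which the zigzag follows an arrow.
      It is found before \<open>\<sigma>\<close>, so that \<open>\<sigma>\<close> can afterwards be
      chosen for \<open>W\<close> and the two ends together.\<close>
    have transport: "\<exists>W. finite W \<and> (\<forall>(t, x)\<in>W. t \<in> obj T \<and> x \<in> fob R t) \<and>
        (\<forall>\<sigma>\<in>hom (point_cat T) R R. (\<forall>(t, x)\<in>W. \<sigma> t x \<in> B t) \<longrightarrow>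
          zigzag J (comp_fctr P D) (fst a, \<sigma> (fob D (fst a)) (snd a)) (fst b, \<sigma> (fob D (fst b)) (snd b)))"
      if "zigzag J (comp_fctr R D) a b" for a b
      using that
    proof (induction rule: zigzag.induct)
      case (refl a)
      show ?case by (rule exI[of _ "{}"]) (auto intro: zigzag.refl)
    next
      case (forward a i x j u)
      then have x: "x \<in> fob R (fob D i)" by (simp add: comp_fctr_def)
      note u = fctr_hom[OF D forward.hyps(2-4)] and D' = Dj[OF forward.hyps(2)] Dj[OF forward.hyps(3)]
      obtain W where W: "finite W" "\<forall>(t, x)\<in>W. t \<in> obj T \<and> x \<in> fob R t" and
        *: "\<And>\<sigma>. \<sigma> \<in> hom (point_cat T) R R \<Longrightarrow> (\<forall>(t, x)\<in>W. \<sigma> t x \<in> B t) \<Longrightarrow>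
          zigzag J (comp_fctr P D) (fst a, \<sigma> (fob D (fst a)) (snd a)) (i, \<sigma> (fob D i) x)"
        using forward.IH by auto
      have "zigzag J (comp_fctr P D) (fst a, \<sigma> (fob D (fst a)) (snd a))
          (j, \<sigma> (fob D j) (far (comp_fctr R D) i j u x))"
        if \<sigma>: "\<sigma> \<in> hom (point_cat T) R R" "\<forall>(t, x)\<in>insert (fob D i, x) W. \<sigma> t x \<in> B t" for \<sigma>
        using zigzag.forward[OF *[OF \<sigma>(1)] forward.hyps(2-4)] \<sigma>(2) nat[OF \<sigma>(1) D' u x]
        by (simp add: comp_fctr_def P)
      then show ?case
        using W x D' by (intro exI[of _ "insert (fob D i, x) W"]) simp
    next
      case (backward a j i u x)
      then have x: "x \<in> fob R (fob D i)" by (simp add: comp_fctr_def)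
      note u = fctr_hom[OF D backward.hyps(2-4)] and D' = Dj[OF backward.hyps(2)] Dj[OF backward.hyps(3)]
      obtain W where W: "finite W" "\<forall>(t, x)\<in>W. t \<in> obj T \<and> x \<in> fob R t" and
        *: "\<And>\<sigma>. \<sigma> \<in> hom (point_cat T) R R \<Longrightarrow> (\<forall>(t, x)\<in>W. \<sigma> t x \<in> B t) \<Longrightarrow>
          zigzag J (comp_fctr P D) (fst a, \<sigma> (fob D (fst a)) (snd a))
            (j, \<sigma> (fob D j) (far (comp_fctr R D) i j u x))"
        using backward.IH by auto
      have "zigzag J (comp_fctr P D) (fst a, \<sigma> (fob D (fst a)) (snd a)) (i, \<sigma> (fob D i) x)"
        if \<sigma>: "\<sigma> \<in> hom (point_cat T) R R" "\<forall>(t, x)\<in>insert (fob D i, x) W. \<sigma> t x \<in> B t" for \<sigma>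
      proof (rule zigzag.backward[OF _ backward.hyps(2-4)])
        show "zigzag J (comp_fctr P D) (fst a, \<sigma> (fob D (fst a)) (snd a))
            (j, far (comp_fctr P D) i j u (\<sigma> (fob D i) x))"
          using *[OF \<sigma>(1)] \<sigma>(2) nat[OF \<sigma>(1) D' u x] by (simp add: comp_fctr_def P)
        show "\<sigma> (fob D i) x \<in> fob (comp_fctr P D) i"
          using \<sigma>(2) by (simp add: comp_fctr_def P)
      qed
      then show ?case
        using W x D' by (intro exI[of _ "insert (fob D i, x) W"]) simp
    qed
    show "zigzag J (comp_fctr P D) (i, x) (j, z)"
      if i: "i \<in> obj J" and j: "j \<in> obj J" and x: "x \<in> fob P (fob D i)" and z: "z \<in> fob P (fob D j)"
        and eq: "far P (fob D i) c (\<iota> i) x = far P (fob D j) c (\<iota> j) z" for i j x z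
    proof -
      have x: "x \<in> B (fob D i)" and z: "z \<in> B (fob D j)" using x z by (simp_all add: P)
      have xR: "x \<in> fob R (fob D i)" and zR: "z \<in> fob R (fob D j)" using x z BR Dj i j by blast+
      have "far R (fob D i) c (\<iota> i) x = far R (fob D j) c (\<iota> j) z" using eq x z by (simp add: P)
      from transport[OF conn[OF i j xR zR this]] obtain W
        where W: "finite W" "\<forall>(t, x)\<in>W. t \<in> obj T \<and> x \<in> fob R t" and
        *: "\<And>\<sigma>. \<sigma> \<in> hom (point_cat T) R R \<Longrightarrow> (\<forall>(t, x)\<in>W. \<sigma> t x \<in> B t) \<Longrightarrow>
          zigzag J (comp_fctr P D) (i, \<sigma> (fob D i) x) (j, \<sigma> (fob D j) z)"
        by auto
      \<comment> \<open>The ends are included so that \<open>\<sigma>\<close> fixes them; the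
        transported zigzag then joins the original elements.\<close>
      let ?W = "insert (fob D i, x) (insert (fob D j, z) W)"
      have "finite ?W" "\<And>t x. (t, x) \<in> ?W \<Longrightarrow> t \<in> obj T \<and> x \<in> fob R t"
        using W xR zR Dj[OF i] Dj[OF j] by auto
      from move[OF this] obtain \<sigma> where "\<sigma> \<in> hom (point_cat T) R R"
        and "\<forall>(t, x)\<in>?W. \<sigma> t x \<in> B t \<and> (x \<in> B t \<longrightarrow> \<sigma> t x = x)"
        by blast
      then show ?thesis using *[of \<sigma>] x z by auto
    qed
  next
    fix J :: "('u, 'u) cat" and D c \<pi> x
    assume J: "finite_category J \<and> is_functor J T D \<and> is_limit J T D c \<pi>"
      and x: "compatible J (comp_fctr P D) x"
    then have D: "is_functor J T D" and c: "c \<in> obj T" and fin: "finite (obj J)"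
      and \<pi>: "\<And>j. j \<in> obj J \<Longrightarrow> \<pi> j \<in> hom T c (fob D j)"
      by (auto simp: is_limit_def is_cone_def finite_category_def)
    have Dj: "fob D j \<in> obj T" if "j \<in> obj J" for j by (rule fctr_obj[OF D that])
    have xB: "x j \<in> B (fob D j)" if "j \<in> obj J" for j
      using x that by (simp add: compatible_def comp_fctr_def P)
    have xR: "x j \<in> fob R (fob D j)" if "j \<in> obj J" for j
      using xB BR Dj that by blast
    have "compatible J (comp_fctr R D) x"
      using x xB xR by (simp add: compatible_def comp_fctr_def P)
    note lim = elementwise_point_limit[OF Re J this]
    from lim obtain y where y: "y \<in> fob R c" "\<forall>j\<in>obj J. far R c (fob D j) (\<pi> j) y = x j" by blast
    have uniq: "y' = y" if "y' \<in> fob R c" "\<forall>j\<in>obj J. far R c (fob D j) (\<pi> j) y' = x j" for y'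
      using lim y that by blast
    \<comment> \<open>\<open>\<sigma>\<close> fixes the family and moves \<open>y\<close> into
      \<open>B c\<close>. The moved element lies over the same family, so uniqueness in
      \<open>R\<close> makes it equal to \<open>y\<close>.\<close>
    let ?W = "insert (c, y) ((\<lambda>j. (fob D j, x j)) ` obj J)"
    have "finite ?W" "\<And>t x. (t, x) \<in> ?W \<Longrightarrow> t \<in> obj T \<and> x \<in> fob R t"
      using fin c y xR Dj by auto
    from move[OF this] obtain \<sigma> where \<sigma>: "\<sigma> \<in> hom (point_cat T) R R"
      and \<sigma>W: "\<forall>(t, x)\<in>?W. \<sigma> t x \<in> B t \<and> (x \<in> B t \<longrightarrow> \<sigma> t x = x)"
      by blast
    have "\<sigma> c y = y"
    proof (rule uniq[OF \<sigma>_in[OF \<sigma> c y(1)]], intro ballI)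
      fix j assume j: "j \<in> obj J"
      then show "far R c (fob D j) (\<pi> j) (\<sigma> c y) = x j"
        using nat[OF \<sigma> c Dj[OF j] \<pi>[OF j] y(1)] y(2) xB[OF j] \<sigma>W by auto
    qed
    then have yB: "y \<in> B c" using \<sigma>W by auto
    show "\<exists>!y. y \<in> fob P c \<and> (\<forall>j\<in>obj J. far P c (fob D j) (\<pi> j) y = x j)"
    proof (rule ex1I[of _ y])
      show "y \<in> fob P c \<and> (\<forall>j\<in>obj J. far P c (fob D j) (\<pi> j) y = x j)"
        using y yB by (simp add: P)
      show "y' = y" if "y' \<in> fob P c \<and> (\<forall>j\<in>obj J. far P c (fob D j) (\<pi> j) y' = x j)" for y'
        by (rule uniq) (use that BR[OF c] in \<open>auto simp: P\<close>)
    qed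
  qed
  then have "P \<in> obj (point_cat T)"
    by (simp add: obj_point_cat is_point_iff_elementwise[OF inf])
  moreover have "(\<lambda>t\<in>obj T. \<lambda>x\<in>B t. x) \<in> hom (point_cat T) P R" (is "?j \<in> _")
    unfolding hom_point_cat[OF PF] using subsetD[OF BR] closed by (auto simp: P)
  moreover have "\<forall>t\<in>obj T. \<forall>x\<in>fob P t. ?j t x \<in> B t"
    by (simp add: P)
  ultimately show ?thesis by blast
qed

text \<open>A directed colimit realized inside \<open>'u\<close>: each class of the disjoint union
  is represented by the code of a chosen member. Pairs of a stage and an element can be coded
  because the universe is infinite, and regularity keeps the countable union of small images
  small.\<close>

lemma ex_chain_colimit:
  fixes A :: "nat \<Rightarrow> 'u set"
  assumes inacc: "inaccessible TYPE('u)" and small: "\<And>n. small TYPE('u) (A n)"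
    and u: "\<And>m n x. m \<le> n \<Longrightarrow> x \<in> A m \<Longrightarrow> u m n x \<in> A n"
    and uu: "\<And>l m n x. l \<le> m \<Longrightarrow> m \<le> n \<Longrightarrow> x \<in> A l \<Longrightarrow> u m n (u l m x) = u l n x"
  shows "\<exists>(Q :: 'u set) \<iota>. small TYPE('u) Q \<and> (\<forall>n. \<forall>x\<in>A n. \<iota> n x \<in> Q) \<and> (\<forall>y\<in>Q. \<exists>n. \<exists>x\<in>A n. y = \<iota> n x) \<and>
    (\<forall>m n. \<forall>x\<in>A m. \<forall>y\<in>A n. \<iota> m x = \<iota> n y \<longleftrightarrow> (\<exists>k\<ge>m. k \<ge> n \<and> u m k x = u n k y))"
proof -
  let ?U = "|UNIV :: 'u set|"
  have nat_less: "|UNIV :: nat set| <o ?U"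
    using inacc card_of_nat ordIso_ordLess_trans by (auto simp: inaccessible_def)
  then have inf: "infinite (UNIV :: 'u set)"
    using card_of_ordLeq_infinite[of "UNIV :: nat set"] ordLess_imp_ordLeq by blast
  have "|(UNIV :: nat set) \<times> (UNIV :: 'u set)| \<le>o ?U"
    using card_of_Times_infinite[OF inf UNIV_not_empty ordLess_imp_ordLeq[OF nat_less]] ordIso_iff_ordLeq
    by blast
  then obtain enc :: "nat \<times> 'u \<Rightarrow> 'u" where enc: "inj enc"
    using card_of_ordLeq[of "UNIV \<times> UNIV" "UNIV :: 'u set"] by auto
  \<comment> \<open>Two elements are identified when they meet at a later stage. Membership of
    \<open>q\<close> is built in, so a representative picked by \<open>SOME\<close> is a genuine
    element of its stage, and transitivity has it for the middle pair.\<close>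
  define r where "r p q \<longleftrightarrow> snd q \<in> A (fst q) \<and>
    (\<exists>k\<ge>fst p. k \<ge> fst q \<and> u (fst p) k (snd p) = u (fst q) k (snd q))" for p q
  have refl: "r p p" if "snd p \<in> A (fst p)" for p
    using that by (auto simp: r_def)
  have sym: "r q p" if "r p q" "snd p \<in> A (fst p)" for p q
    using that by (auto simp: r_def)
  have trans: "r p s" if pq: "r p q" and qs: "r q s" and p: "snd p \<in> A (fst p)" for p q s
  proof -
    obtain k where k: "k \<ge> fst p" "k \<ge> fst q" "u (fst p) k (snd p) = u (fst q) k (snd q)" "snd q \<in> A (fst q)"
      using pq by (auto simp: r_def)
    obtain l where l: "l \<ge> fst q" "l \<ge> fst s" "u (fst q) l (snd q) = u (fst s) l (snd s)" "snd s \<in> A (fst s)"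
      using qs by (auto simp: r_def)
    have "u (fst p) (max k l) (snd p) = u k (max k l) (u (fst p) k (snd p))"
      using uu[of "fst p" k "max k l" "snd p"] p k by simp
    also have "\<dots> = u l (max k l) (u (fst q) l (snd q))"
      using uu[of "fst q" k "max k l" "snd q"] uu[of "fst q" l "max k l" "snd q"] k l by simp
    also have "\<dots> = u (fst s) (max k l) (snd s)"
      using uu[of "fst s" l "max k l" "snd s"] l by simp
    finally show ?thesis
      using k l by (auto simp: r_def intro!: exI[of _ "max k l"])
  qed
  define \<iota> where "\<iota> n x = enc (SOME q. r (n, x) q)" for n x
  define Q where "Q = (\<Union>n. \<iota> n ` A n)"
  have "\<iota> m x = \<iota> n y \<longleftrightarrow> r (m, x) (n, y)" if x: "x \<in> A m" and y: "y \<in> A n" for m n x y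
  proof
    assume "r (m, x) (n, y)"
    \<comment> \<open>Equivalent pairs define the same predicate, hence \<open>SOME\<close> picks
      the same representative for both.\<close>
    then have "r (m, x) q \<longleftrightarrow> r (n, y) q" for q
      using trans[of "(m, x)" "(n, y)" q] trans[of "(n, y)" "(m, x)" q] sym[of "(m, x)" "(n, y)"] x y
      by auto
    then show "\<iota> m x = \<iota> n y" by (simp add: \<iota>_def)
  next
    assume "\<iota> m x = \<iota> n y"
    then have eq: "(SOME q. r (m, x) q) = (SOME q. r (n, y) q)"
      using enc by (simp add: \<iota>_def inj_eq)
    have "r (m, x) (SOME q. r (m, x) q)" "r (n, y) (SOME q. r (n, y) q)"
      using someI[of "r (m, x)" "(m, x)"] someI[of "r (n, y)" "(n, y)"] refl x y by auto
    then show "r (m, x) (n, y)"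
      using eq trans[of "(m, x)" "SOME q. r (n, y) q" "(n, y)"] sym[of "(n, y)"] x y by auto
  qed
  moreover have "small TYPE('u) Q"
  proof -
    have st: "stable ?U"
      by (rule regularCard_stable[OF card_of_Card_order])
        (use inacc inf in \<open>simp_all add: inaccessible_def Field_card_of\<close>)
    have im: "|\<iota> n ` A n| <o ?U" for n
      using small[of n] card_of_image[of "\<iota> n" "A n"] unfolding small_def by (rule ordLeq_ordLess_trans[rotated])
    show ?thesis
      unfolding small_def Q_def by (rule stable_UNION[OF st nat_less im])
  qed
  ultimately show ?thesis
    by - (rule exI[of _ Q], rule exI[of _ \<iota>], auto simp: Q_def r_def)
qed

text \<open>Each property persists once it holds, so the largest of finitely many stages works for
  all.\<close>

lemma finite_common_bound:
  assumes "finite A" "\<And>a. a \<in> A \<Longrightarrow> \<exists>k :: nat. P a k" "\<And>a k l. a \<in> A \<Longrightarrow> P a k \<Longrightarrow> k \<le> l \<Longrightarrow> P a l"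
  shows "\<exists>k. \<forall>a\<in>A. P a k"
proof -
  obtain f where f: "\<And>a. a \<in> A \<Longrightarrow> P a (f a)" using assms(2) by metis
  have "P a (Max (f ` A))" if "a \<in> A" for a
    by (rule assms(3)[OF that f[OF that]]) (use assms(1) that in simp)
  then show ?thesis by blast
qed

text \<open>\<open>Q\<close> is the pointwise directed colimit. It inherits the colimit clauses
  since every element and every identification already occurs at some stage, and the limit clause
  since a finite shape imposes finitely many equations on finitely many elements, all of which hold
  at a common stage.\<close>

lemma point_chain_cover:
  fixes R :: "('o, 'a, 'u set, 'u \<Rightarrow> 'u) fctr"
  assumes T: "is_category T" and inacc: "inaccessible TYPE('u)"
    and chain: "chain_cocone (point_cat T) P u R \<rho>"
  shows "\<exists>Q \<iota>. \<exists>r\<in>hom (point_cat T) Q R. chain_cocone (point_cat T) P u Q \<iota> \<and>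
    (\<forall>n. cmp (point_cat T) (P n) Q R r (\<iota> n) = \<rho> n) \<and>
    (\<forall>t\<in>obj T. \<forall>y\<in>fob Q t. \<exists>n. \<exists>x\<in>fob (P n) t. \<iota> n t x = y)"
proof -
  have inf: "infinite (UNIV :: 'u set)"
    using inacc infinite_iff_natLeq_ordLeq ordLess_imp_ordLeq by (auto simp: inaccessible_def)
  have P: "is_point T (P n)" and R: "is_point T R"
    and u: "m \<le> n \<Longrightarrow> u m n \<in> hom (point_cat T) (P m) (P n)"
    and uu: "l \<le> m \<Longrightarrow> m \<le> n \<Longrightarrow> cmp (point_cat T) (P l) (P m) (P n) (u m n) (u l m) = u l n"
    and \<rho>: "\<rho> n \<in> hom (point_cat T) (P n) R"
    and \<rho>u: "m \<le> n \<Longrightarrow> cmp (point_cat T) (P m) (P n) R (\<rho> n) (u m n) = \<rho> m" for l m n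
    using chain by (simp_all add: chain_cocone_def obj_point_cat)
  have PF: "is_functor T set_cat (P n)" and Pe: "elementwise_point T (P n)" for n
    using P is_point_iff_elementwise[OF inf] by (auto simp: is_point_def)
  have RF: "is_functor T set_cat R"
    using R by (simp add: is_point_def)
  have u_in: "u m n t x \<in> fob (P n) t" if "m \<le> n" "t \<in> obj T" "x \<in> fob (P m) t" for m n t x
    using u[OF that(1)] that(2,3) unfolding hom_point_cat[OF PF] by blast
  have u_nat: "u m n s (far (P m) t s f x) = far (P n) t s f (u m n t x)"
    if "m \<le> n" "t \<in> obj T" "s \<in> obj T" "f \<in> hom T t s" "x \<in> fob (P m) t" for m n t s f x
    using u[OF that(1)] that(2-) unfolding hom_point_cat[OF PF] by blast
  have uu_app: "u m n t (u l m t x) = u l n t x" if "l \<le> m" "m \<le> n" "t \<in> obj T" "x \<in> fob (P l) t" for l m n t x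
    using fun_cong[OF fun_cong[OF uu[OF that(1,2)]], of t x] that(3,4) by (simp add: cmp_point_cat compose_def)
  have \<rho>_in: "\<rho> n t x \<in> fob R t" if "t \<in> obj T" "x \<in> fob (P n) t" for n t x
    using \<rho>[of n] that unfolding hom_point_cat[OF PF] by blast
  have \<rho>_nat: "\<rho> n s (far (P n) t s f x) = far R t s f (\<rho> n t x)"
    if "t \<in> obj T" "s \<in> obj T" "f \<in> hom T t s" "x \<in> fob (P n) t" for n t s f x
    using \<rho>[of n] that unfolding hom_point_cat[OF PF] by blast
  have \<rho>u_app: "\<rho> n t (u m n t x) = \<rho> m t x" if "m \<le> n" "t \<in> obj T" "x \<in> fob (P m) t" for m n t x
    using fun_cong[OF fun_cong[OF \<rho>u[OF that(1)]], of t x] that(2,3) by (simp add: cmp_point_cat compose_def)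
  \<comment> \<open>The set and its legs are packed into one pair, so that a single choice over
    \<open>t\<close> fixes both.\<close>
  define colim where "colim t C \<longleftrightarrow> small TYPE('u) (fst C :: 'u set) \<and>
      (\<forall>n. \<forall>x\<in>fob (P n) t. snd C n x \<in> fst C) \<and> (\<forall>y\<in>fst C. \<exists>n. \<exists>x\<in>fob (P n) t. y = snd C n x) \<and>
      (\<forall>m n. \<forall>x\<in>fob (P m) t. \<forall>y\<in>fob (P n) t.
         snd C m x = snd C n y \<longleftrightarrow> (\<exists>k\<ge>m. k \<ge> n \<and> u m k t x = u n k t y))" for t C
  have "\<exists>C. colim t C" if t: "t \<in> obj T" for t
    unfolding colim_def split_paired_Ex fst_conv snd_conv
    by (rule ex_chain_colimit[OF inacc])
      (use fctr_obj[OF PF t] u_in uu_app t in \<open>auto simp: set_cat_simps\<close>)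
  then obtain C where C: "\<And>t. t \<in> obj T \<Longrightarrow> colim t (C t)" by metis
  define A where "A t = fst (C t)" for t
  define i where "i n t = snd (C t) n" for n t
  have A_small: "small TYPE('u) (A t)" and i_in: "x \<in> fob (P n) t \<Longrightarrow> i n t x \<in> A t"
    and i_eq: "x \<in> fob (P m) t \<Longrightarrow> z \<in> fob (P n) t \<Longrightarrow>
      i m t x = i n t z \<longleftrightarrow> (\<exists>k\<ge>m. k \<ge> n \<and> u m k t x = u n k t z)" if "t \<in> obj T" for t m n x z
    using C[OF that] by (simp_all add: colim_def A_def i_def)
  have cover: "\<exists>n. \<exists>x\<in>fob (P n) t. y = i n t x" if "t \<in> obj T" "y \<in> A t" for t y
    using C that by (simp add: colim_def A_def i_def)
  have i_u: "i n t (u m n t x) = i m t x" if "m \<le> n" "t \<in> obj T" "x \<in> fob (P m) t" for m n t x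
    using i_eq[OF that(2) u_in[OF that] that(3)] uu_app[OF that(1) order.refl that(2,3)] that(1) by auto
  \<comment> \<open>Compatible families factor through the pointwise colimit. This gives both the
    action of \<open>Q\<close> on arrows and the comparison map to \<open>R\<close>.\<close>
  have lift: "\<exists>h. \<forall>n. \<forall>x\<in>fob (P n) t. h (i n t x) = g n x"
    if t: "t \<in> obj T" and g: "\<And>m n x. m \<le> n \<Longrightarrow> x \<in> fob (P m) t \<Longrightarrow> g n (u m n t x) = (g m x :: 'u)" for t g
  proof -
    define p where "p y = (SOME p. snd p \<in> fob (P (fst p)) t \<and> i (fst p) t (snd p) = y)" for y
    have "g (fst (p (i n t x))) (snd (p (i n t x))) = g n x" if x: "x \<in> fob (P n) t" for n x
    proof -
      let ?p = "p (i n t x)"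
      have p: "snd ?p \<in> fob (P (fst ?p)) t \<and> i (fst ?p) t (snd ?p) = i n t x"
        unfolding p_def by (rule someI[of _ "(n, x)"]) (use x in simp)
      then obtain k where k: "k \<ge> fst ?p" "k \<ge> n" "u (fst ?p) k t (snd ?p) = u n k t x"
        using i_eq[OF t _ x] by blast
      then show ?thesis using g[OF k(1), of "snd ?p"] g[OF k(2) x] p by simp
    qed
    then show ?thesis by (intro exI[of _ "\<lambda>y. g (fst (p y)) (snd (p y))"]) blast
  qed
  have "\<exists>h. \<forall>n. \<forall>x\<in>fob (P n) t. h (i n t x) = i n s (far (P n) t s f x)"
    if "t \<in> obj T" "s \<in> obj T" "f \<in> hom T t s" for t s f
    by (rule lift[OF that(1)])
      (use that u_nat i_u set_functor_in[OF PF] in \<open>simp add: u_nat[symmetric]\<close>)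
  then obtain H where H: "\<And>t s f n x. t \<in> obj T \<Longrightarrow> s \<in> obj T \<Longrightarrow> f \<in> hom T t s \<Longrightarrow> x \<in> fob (P n) t \<Longrightarrow>
      H t s f (i n t x) = i n s (far (P n) t s f x)"
    by metis
  have "\<exists>h. \<forall>n. \<forall>x\<in>fob (P n) t. h (i n t x) = \<rho> n t x" if "t \<in> obj T" for t
    by (rule lift[OF that]) (use that \<rho>u_app in simp)
  then obtain r0 where r0: "\<And>t n x. t \<in> obj T \<Longrightarrow> x \<in> fob (P n) t \<Longrightarrow> r0 t (i n t x) = \<rho> n t x"
    by metis
  define Q where "Q = \<lparr> fob = A, far = (\<lambda>t s f. restrict (H t s f) (A t)) \<rparr>"
  have Qob: "fob Q t = A t" for t by (simp add: Q_def)
  have Qar: "far Q t s f (i n t x) = i n s (far (P n) t s f x)"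
    if "t \<in> obj T" "s \<in> obj T" "f \<in> hom T t s" "x \<in> fob (P n) t" for t s f n x
    using H[OF that] i_in that by (simp add: Q_def)
  have QF: "is_functor T set_cat Q"
  proof (rule set_functorI[OF T])
    show "small TYPE('u) (fob Q t)" if "t \<in> obj T" for t
      using A_small that by (simp add: Qob)
  next
    fix t s f assume f: "t \<in> obj T" "s \<in> obj T" "f \<in> hom T t s"
    have "far Q t s f y \<in> A s" if y: "y \<in> A t" for y
    proof -
      obtain n x where "x \<in> fob (P n) t" "y = i n t x" using cover[OF f(1) y] by blast
      then show ?thesis using Qar[OF f] i_in[OF f(2)] set_functor_in[OF PF f] by simp
    qed
    then show "far Q t s f \<in> fob Q t \<rightarrow>\<^sub>E fob Q s"
      by (auto simp: Qob) (simp add: Q_def)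
  next
    fix t y assume t: "t \<in> obj T" and y: "y \<in> fob Q t"
    then obtain n x where x: "x \<in> fob (P n) t" "y = i n t x" using cover[OF t] Qob by blast
    then show "far Q t t (idn T t) y = y"
      using Qar[OF t t cat_idn[OF T t] x(1)] set_functor_idn[OF PF t x(1)] by simp
  next
    fix t s r f g y
    assume *: "t \<in> obj T" "s \<in> obj T" "r \<in> obj T" "f \<in> hom T t s" "g \<in> hom T s r" and y: "y \<in> fob Q t"
    then obtain n x where x: "x \<in> fob (P n) t" "y = i n t x" using cover[OF *(1)] Qob by blast
    show "far Q t r (cmp T t s r g f) y = far Q s r g (far Q t s f y)"
      using Qar[OF *(1,3) cat_cmp[OF T *] x(1)] Qar[OF *(1,2,4) x(1)]
        Qar[OF *(2,3,5) set_functor_in[OF PF *(1,2,4) x(1)]] set_functor_cmp[OF PF * x(1)] x(2) by simp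
  qed
  have "elementwise_point T Q"
    unfolding elementwise_point_def
  proof (intro conjI allI impI QF ballI)
    fix J :: "('u, 'u) cat" and D c \<iota>
    assume J: "small_category TYPE('u) J \<and> is_functor J T D \<and> is_colimit J T D c \<iota>"
    then have D: "is_functor J T D" and c: "c \<in> obj T"
      and \<iota>: "\<And>j. j \<in> obj J \<Longrightarrow> \<iota> j \<in> hom T (fob D j) c"
      by (auto simp: is_colimit_def is_cocone_def)
    have Dj: "fob D j \<in> obj T" if "j \<in> obj J" for j by (rule fctr_obj[OF D that])
    note surj = elementwise_point_surj[OF Pe J] and conn = elementwise_point_zigzag[OF Pe J]
    show "\<exists>j\<in>obj J. \<exists>x\<in>fob Q (fob D j). far Q (fob D j) c (\<iota> j) x = y" if y: "y \<in> fob Q c" for y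
    proof -
      obtain n x where x: "x \<in> fob (P n) c" "y = i n c x" using cover[OF c] y Qob by blast
      obtain j z where j: "j \<in> obj J" and z: "z \<in> fob (P n) (fob D j)" and zx: "far (P n) (fob D j) c (\<iota> j) z = x"
        using surj[OF x(1)] by blast
      have "far Q (fob D j) c (\<iota> j) (i n (fob D j) z) = y"
        using Qar[OF Dj[OF j] c \<iota>[OF j] z] zx x(2) by simp
      then show ?thesis using j i_in[OF Dj[OF j] z] Qob by blast
    qed
    \<comment> \<open>The legs \<open>i n\<close> are natural, so they carry zigzags over
      \<open>P n\<close> to zigzags over \<open>Q\<close>.\<close>
    have transport: "zigzag J (comp_fctr Q D) (fst a, i n (fob D (fst a)) (snd a)) (fst b, i n (fob D (fst b)) (snd b))"
      if "zigzag J (comp_fctr (P n) D) a b" for n a b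
      using that
    proof (induction rule: zigzag.induct)
      case (refl a)
      show ?case by (rule zigzag.refl)
    next
      case (forward a k x j v)
      note v = Dj[OF forward.hyps(2)] Dj[OF forward.hyps(3)] fctr_hom[OF D forward.hyps(2-4)]
      have x: "x \<in> fob (P n) (fob D k)" using forward by (simp add: comp_fctr_def)
      have "zigzag J (comp_fctr Q D) (fst a, i n (fob D (fst a)) (snd a)) (k, i n (fob D k) x)"
        using forward.IH by simp
      from zigzag.forward[OF this forward.hyps(2-4)] show ?case
        using Qar[OF v x] i_in[OF v(1) x] by (simp add: comp_fctr_def Qob)
    next
      case (backward a j k v x)
      note v = Dj[OF backward.hyps(2)] Dj[OF backward.hyps(3)] fctr_hom[OF D backward.hyps(2-4)]
      have x: "x \<in> fob (P n) (fob D k)" using backward by (simp add: comp_fctr_def)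
      have "zigzag J (comp_fctr Q D) (fst a, i n (fob D (fst a)) (snd a))
          (j, far (comp_fctr Q D) k j v (i n (fob D k) x))"
        using backward.IH Qar[OF v x] by (simp add: comp_fctr_def)
      from zigzag.backward[OF this backward.hyps(2-4)] show ?case
        using i_in[OF v(1) x] by (simp add: comp_fctr_def Qob)
    qed
    show "zigzag J (comp_fctr Q D) (k, a) (j, b)"
      if k: "k \<in> obj J" and j: "j \<in> obj J" and a: "a \<in> fob Q (fob D k)" and b: "b \<in> fob Q (fob D j)"
        and eq: "far Q (fob D k) c (\<iota> k) a = far Q (fob D j) c (\<iota> j) b" for k j a b
    proof -
      obtain m x where x: "x \<in> fob (P m) (fob D k)" "a = i m (fob D k) x"
        using cover[OF Dj[OF k]] a Qob by blast
      obtain n z where z: "z \<in> fob (P n) (fob D j)" "b = i n (fob D j) z"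
        using cover[OF Dj[OF j]] b Qob by blast
      have x': "far (P m) (fob D k) c (\<iota> k) x \<in> fob (P m) c"
        by (rule set_functor_in[OF PF Dj[OF k] c \<iota>[OF k] x(1)])
      have z': "far (P n) (fob D j) c (\<iota> j) z \<in> fob (P n) c"
        by (rule set_functor_in[OF PF Dj[OF j] c \<iota>[OF j] z(1)])
      have "i m c (far (P m) (fob D k) c (\<iota> k) x) = i n c (far (P n) (fob D j) c (\<iota> j) z)"
        using eq x z Qar[OF Dj[OF k] c \<iota>[OF k] x(1)] Qar[OF Dj[OF j] c \<iota>[OF j] z(1)] by simp
      \<comment> \<open>Equality in the colimit is equality at some stage \<open>l\<close>, and
        there the point \<open>P l\<close> supplies a zigzag.\<close>
      then obtain l where l: "l \<ge> m" "l \<ge> n"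
        and "u m l c (far (P m) (fob D k) c (\<iota> k) x) = u n l c (far (P n) (fob D j) c (\<iota> j) z)"
        using i_eq[OF c x' z'] by blast
      then have "far (P l) (fob D k) c (\<iota> k) (u m l (fob D k) x) = far (P l) (fob D j) c (\<iota> j) (u n l (fob D j) z)"
        using u_nat[OF l(1) Dj[OF k] c \<iota>[OF k] x(1)] u_nat[OF l(2) Dj[OF j] c \<iota>[OF j] z(1)] by simp
      from transport[OF conn[OF k j u_in[OF l(1) Dj[OF k] x(1)] u_in[OF l(2) Dj[OF j] z(1)] this]]
      show ?thesis
        using i_u[OF l(1) Dj[OF k] x(1)] i_u[OF l(2) Dj[OF j] z(1)] x(2) z(2) by simp
    qed
  next
    fix J :: "('u, 'u) cat" and D c \<pi> x
    assume J: "finite_category J \<and> is_functor J T D \<and> is_limit J T D c \<pi>"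
      and x: "compatible J (comp_fctr Q D) x"
    then have D: "is_functor J T D" and c: "c \<in> obj T" and fin: "finite (obj J)"
      and finh: "\<And>k j. k \<in> obj J \<Longrightarrow> j \<in> obj J \<Longrightarrow> finite (hom J k j)"
      and \<pi>: "\<And>j. j \<in> obj J \<Longrightarrow> \<pi> j \<in> hom T c (fob D j)"
      by (auto simp: is_limit_def is_cone_def finite_category_def)
    have Dj: "fob D j \<in> obj T" if "j \<in> obj J" for j by (rule fctr_obj[OF D that])
    have Dh: "far D k j v \<in> hom T (fob D k) (fob D j)" if "k \<in> obj J" "j \<in> obj J" "v \<in> hom J k j" for k j v
      by (rule fctr_hom[OF D that])
    have xA: "x j \<in> A (fob D j)" if "j \<in> obj J" for j
      using x that by (simp add: compatible_def comp_fctr_def Qob)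
    have xv: "far Q (fob D k) (fob D j) (far D k j v) (x k) = x j"
      if "k \<in> obj J" "j \<in> obj J" "v \<in> hom J k j" for k j v
      using x that by (simp add: compatible_def comp_fctr_def)
    have "\<exists>N. \<forall>j\<in>obj J. \<exists>y\<in>fob (P N) (fob D j). x j = i N (fob D j) y"
    proof (rule finite_common_bound[OF fin cover[OF Dj xA]])
      fix j k l assume j: "j \<in> obj J" and kl: "k \<le> l" and "\<exists>y\<in>fob (P k) (fob D j). x j = i k (fob D j) y"
      then obtain y where y: "y \<in> fob (P k) (fob D j)" "x j = i k (fob D j) y" by blast
      then show "\<exists>y\<in>fob (P l) (fob D j). x j = i l (fob D j) y"
        using u_in[OF kl Dj[OF j] y(1)] i_u[OF kl Dj[OF j] y(1)] by (intro bexI[of _ "u k l (fob D j) y"]) simp_all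
    qed
    then obtain N y where y: "\<And>j. j \<in> obj J \<Longrightarrow> y j \<in> fob (P N) (fob D j)"
      and xy: "\<And>j. j \<in> obj J \<Longrightarrow> x j = i N (fob D j) (y j)"
      by metis
    \<comment> \<open>Representatives of a compatible family at stage \<open>N\<close> may satisfy
      its equations only from a later stage on; there are finitely many arrows, so one stage serves
      all.\<close>
    define good where "good kjv K \<longleftrightarrow> (case kjv of (k, j, v) \<Rightarrow> N \<le> K \<and>
      u N K (fob D j) (far (P N) (fob D k) (fob D j) (far D k j v) (y k)) = u N K (fob D j) (y j))" for kjv K
    have "\<exists>K. \<forall>kjv\<in>(SIGMA k:obj J. SIGMA j:obj J. hom J k j). good kjv K"
    proof (rule finite_common_bound)
      show "finite (SIGMA k:obj J. SIGMA j:obj J. hom J k j)"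
        using fin finh by (intro finite_SigmaI) auto
    next
      fix kjv assume "kjv \<in> (SIGMA k:obj J. SIGMA j:obj J. hom J k j)"
      then obtain k j v where kjv: "kjv = (k, j, v)" and k: "k \<in> obj J" and j: "j \<in> obj J" and v: "v \<in> hom J k j"
        by auto
      have "i N (fob D j) (far (P N) (fob D k) (fob D j) (far D k j v) (y k)) = i N (fob D j) (y j)"
        using xv[OF k j v] Qar[OF Dj[OF k] Dj[OF j] Dh[OF k j v] y[OF k]] xy k j by simp
      then show "\<exists>K. good kjv K"
        using i_eq[OF Dj[OF j] set_functor_in[OF PF Dj[OF k] Dj[OF j] Dh[OF k j v] y[OF k]] y[OF j]]
        by (auto simp: good_def kjv)
    next
      fix kjv K L assume "kjv \<in> (SIGMA k:obj J. SIGMA j:obj J. hom J k j)" "good kjv K" and KL: "(K :: nat) \<le> L"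
      then obtain k j v where kjv: "kjv = (k, j, v)" and k: "k \<in> obj J" and j: "j \<in> obj J" and v: "v \<in> hom J k j"
        and NK: "N \<le> K"
        and eq: "u N K (fob D j) (far (P N) (fob D k) (fob D j) (far D k j v) (y k)) = u N K (fob D j) (y j)"
        by (auto simp: good_def)
      have "u N L (fob D j) (far (P N) (fob D k) (fob D j) (far D k j v) (y k)) = u N L (fob D j) (y j)"
        using uu_app[OF NK KL Dj[OF j] set_functor_in[OF PF Dj[OF k] Dj[OF j] Dh[OF k j v] y[OF k]]]
          uu_app[OF NK KL Dj[OF j] y[OF j]] eq by simp
      then show "good kjv L" using NK KL by (simp add: good_def kjv)
    qed
    then obtain K0 where K0: "\<And>k j v. k \<in> obj J \<Longrightarrow> j \<in> obj J \<Longrightarrow> v \<in> hom J k j \<Longrightarrow> good (k, j, v) K0"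
      by blast
    \<comment> \<open>For an empty shape the bound \<open>K0\<close> carries no information, not
      even \<open>N \<le> K0\<close>; otherwise an identity arrow provides that inequality.\<close>
    define K where "K = (if obj J = {} then N else K0)"
    have NK: "N \<le> K"
    proof (cases "obj J = {}")
      case False
      then obtain j where j: "j \<in> obj J" by blast
      then have "idn J j \<in> hom J j j" using J by (auto simp: finite_category_def intro: cat_idn)
      from K0[OF j j this] show ?thesis using False by (simp add: good_def K_def)
    qed (simp add: K_def)
    define z where "z j = u N K (fob D j) (y j)" for j
    have z: "z j \<in> fob (P K) (fob D j)" if "j \<in> obj J" for j
      unfolding z_def by (rule u_in[OF NK Dj[OF that] y[OF that]])
    have xz: "x j = i K (fob D j) (z j)" if "j \<in> obj J" for j
      using i_u[OF NK Dj[OF that] y[OF that]] xy[OF that] by (simp add: z_def)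
    have "far (P K) (fob D k) (fob D j) (far D k j v) (z k) = z j"
      if "k \<in> obj J" "j \<in> obj J" "v \<in> hom J k j" for k j v
    proof -
      have "K = K0" using that(1) by (auto simp: K_def)
      then show ?thesis
        using K0[OF that] u_nat[OF NK Dj[OF that(1)] Dj[OF that(2)] Dh[OF that] y[OF that(1)]]
        by (simp add: good_def z_def)
    qed
    then have "compatible J (comp_fctr (P K) D) z"
      using z by (simp add: compatible_def comp_fctr_def)
    from elementwise_point_limit[OF Pe J this] obtain w where w: "w \<in> fob (P K) c"
      "\<And>j. j \<in> obj J \<Longrightarrow> far (P K) c (fob D j) (\<pi> j) w = z j"
      by blast
    show "\<exists>!y. y \<in> fob Q c \<and> (\<forall>j\<in>obj J. far Q c (fob D j) (\<pi> j) y = x j)"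
    proof (rule ex_ex1I)
      show "\<exists>y. y \<in> fob Q c \<and> (\<forall>j\<in>obj J. far Q c (fob D j) (\<pi> j) y = x j)"
        using i_in[OF c w(1)] Qar[OF c Dj \<pi> w(1)] w(2) xz by (intro exI[of _ "i K c w"]) (simp add: Qob)
    next
      fix a b
      assume a: "a \<in> fob Q c \<and> (\<forall>j\<in>obj J. far Q c (fob D j) (\<pi> j) a = x j)"
        and b: "b \<in> fob Q c \<and> (\<forall>j\<in>obj J. far Q c (fob D j) (\<pi> j) b = x j)"
      obtain m v where v: "v \<in> fob (P m) c" "a = i m c v" using cover[OF c] a Qob by blast
      obtain n w where w: "w \<in> fob (P n) c" "b = i n c w" using cover[OF c] b Qob by blast
      \<comment> \<open>The projections of both elements agree at a common stage for all
        \<open>j\<close>; uniqueness of the limit at that stage then identifies the elements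
        themselves.\<close>
      have "\<exists>l. \<forall>j\<in>obj J. l \<ge> m \<and> l \<ge> n \<and>
        u m l (fob D j) (far (P m) c (fob D j) (\<pi> j) v) = u n l (fob D j) (far (P n) c (fob D j) (\<pi> j) w)"
      proof (rule finite_common_bound[OF fin])
        fix j assume j: "j \<in> obj J"
        have "i m (fob D j) (far (P m) c (fob D j) (\<pi> j) v) = i n (fob D j) (far (P n) c (fob D j) (\<pi> j) w)"
          using conjunct2[OF a] conjunct2[OF b] j v(2) w(2)
            Qar[OF c Dj[OF j] \<pi>[OF j] v(1)] Qar[OF c Dj[OF j] \<pi>[OF j] w(1)] by simp
        then show "\<exists>l. l \<ge> m \<and> l \<ge> n \<and>
          u m l (fob D j) (far (P m) c (fob D j) (\<pi> j) v) = u n l (fob D j) (far (P n) c (fob D j) (\<pi> j) w)"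
          using i_eq[OF Dj[OF j] set_functor_in[OF PF c Dj[OF j] \<pi>[OF j] v(1)]
              set_functor_in[OF PF c Dj[OF j] \<pi>[OF j] w(1)]] by blast
      next
        fix j l l' assume j: "j \<in> obj J" and ll: "l \<le> l'" and l: "l \<ge> m \<and> l \<ge> n \<and>
          u m l (fob D j) (far (P m) c (fob D j) (\<pi> j) v) = u n l (fob D j) (far (P n) c (fob D j) (\<pi> j) w)"
        then have "m \<le> l" "n \<le> l" by simp_all
        then show "l' \<ge> m \<and> l' \<ge> n \<and>
          u m l' (fob D j) (far (P m) c (fob D j) (\<pi> j) v) = u n l' (fob D j) (far (P n) c (fob D j) (\<pi> j) w)"
          using uu_app[OF \<open>m \<le> l\<close> ll Dj[OF j] set_functor_in[OF PF c Dj[OF j] \<pi>[OF j] v(1)]]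
            uu_app[OF \<open>n \<le> l\<close> ll Dj[OF j] set_functor_in[OF PF c Dj[OF j] \<pi>[OF j] w(1)]] l ll by simp
      qed
      then obtain l0 where l0: "\<And>j. j \<in> obj J \<Longrightarrow> l0 \<ge> m \<and> l0 \<ge> n \<and>
        u m l0 (fob D j) (far (P m) c (fob D j) (\<pi> j) v) = u n l0 (fob D j) (far (P n) c (fob D j) (\<pi> j) w)"
        by blast
      \<comment> \<open>Again an empty shape gives no bound, so a stage above \<open>m\<close> and
        \<open>n\<close> is supplied by hand.\<close>
      define l where "l = (if obj J = {} then max m n else l0)"
      have ml: "m \<le> l" and nl: "n \<le> l" using l0 by (auto simp: l_def)
      have v': "u m l c v \<in> fob (P l) c" and w': "u n l c w \<in> fob (P l) c"
        using u_in[OF ml c v(1)] u_in[OF nl c w(1)] .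
      have proj: "far (P l) c (fob D j) (\<pi> j) (u m l c v) = far (P l) c (fob D j) (\<pi> j) (u n l c w)"
        if j: "j \<in> obj J" for j
      proof -
        have "l = l0" using j by (auto simp: l_def)
        then show ?thesis
          using l0[OF j] u_nat[OF ml c Dj[OF j] \<pi>[OF j] v(1)] u_nat[OF nl c Dj[OF j] \<pi>[OF j] w(1)]
          by simp
      qed
      have "is_cone J set_cat (comp_fctr (P l) D) (fob (P l) c) (\<lambda>j. far (P l) c (fob D j) (\<pi> j))"
        using is_cone_fctr[OF PF D] J by (simp add: is_limit_def)
      then have "compatible J (comp_fctr (P l) D) (\<lambda>j. far (P l) c (fob D j) (\<pi> j) (u m l c v))"
        using v' by (simp add: is_cone_set_cat[OF is_functor_comp[OF D PF]])
      from elementwise_point_limit[OF Pe J this] have "u m l c v = u n l c w"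
        using v' w' proj by metis
      then have "i l c (u m l c v) = i l c (u n l c w)" by simp
      then show "a = b" using i_u[OF ml c v(1)] i_u[OF nl c w(1)] v(2) w(2) by simp
    qed
  qed
  then have Q: "is_point T Q" by (simp add: is_point_iff_elementwise[OF inf])
  define \<iota> where "\<iota> n = (\<lambda>t\<in>obj T. restrict (i n t) (fob (P n) t))" for n
  define r where "r = (\<lambda>t\<in>obj T. restrict (r0 t) (A t))"
  have \<iota>: "\<iota> n \<in> hom (point_cat T) (P n) Q" for n
    unfolding hom_point_cat[OF PF] using i_in Qar set_functor_in[OF PF] by (simp add: \<iota>_def Qob)
  have r: "r \<in> hom (point_cat T) Q R"
    unfolding hom_point_cat[OF QF]
  proof (intro conjI ballI)
    show "r \<in> (\<Pi>\<^sub>E t\<in>obj T. fob Q t \<rightarrow>\<^sub>E fob R t)"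
      using cover r0 \<rho>_in by (fastforce simp: r_def Qob)
  next
    fix t s f y assume f: "t \<in> obj T" "s \<in> obj T" "f \<in> hom T t s" and y: "y \<in> fob Q t"
    obtain n x where x: "x \<in> fob (P n) t" "y = i n t x" using cover[OF f(1)] y Qob by blast
    note x' = set_functor_in[OF PF f x(1)]
    show "r s (far Q t s f y) = far R t s f (r t y)"
      using Qar[OF f x(1)] x(2) r0[OF f(1) x(1)] r0[OF f(2) x'] \<rho>_nat[OF f x(1)]
        i_in[OF f(1) x(1)] i_in[OF f(2) x'] f by (simp add: r_def)
  qed
  have "cmp (point_cat T) (P m) (P n) Q (\<iota> n) (u m n) = \<iota> m" if mn: "m \<le> n" for m n
  proof -
    have "compose (fob (P m) t) (\<iota> n t) (u m n t) = \<iota> m t" if t: "t \<in> obj T" for t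
      using u_in[OF mn t] i_u[OF mn t] t by (auto simp: compose_def \<iota>_def fun_eq_iff)
    then show ?thesis by (auto simp: cmp_point_cat fun_eq_iff \<iota>_def)
  qed
  then have "chain_cocone (point_cat T) P u Q \<iota>"
    using P Q u uu \<iota> by (simp add: chain_cocone_def obj_point_cat)
  moreover have "cmp (point_cat T) (P n) Q R r (\<iota> n) = \<rho> n" for n
  proof -
    have \<rho>PiE: "\<rho> n \<in> (\<Pi>\<^sub>E t\<in>obj T. fob (P n) t \<rightarrow>\<^sub>E fob R t)"
      using \<rho>[of n] unfolding hom_point_cat[OF PF] by blast
    have "compose (fob (P n) t) (r t) (\<iota> n t) = \<rho> n t" if t: "t \<in> obj T" for t
      by (rule extensionalityI[of _ "fob (P n) t"])
        (use \<rho>PiE t i_in[OF t] r0[OF t] in \<open>auto simp: compose_def \<iota>_def r_def PiE_iff\<close>)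
    then show ?thesis
      by (intro extensionalityI[of _ "obj T"]) (use \<rho>PiE in \<open>auto simp: cmp_point_cat PiE_iff\<close>)
  qed
  moreover have "\<exists>n. \<exists>x\<in>fob (P n) t. \<iota> n t x = y" if "t \<in> obj T" "y \<in> fob Q t" for t y
    using cover[of t y] that by (auto simp: \<iota>_def Qob)
  ultimately show ?thesis using r by blast
qed

lemma structured_category_point_cat:
  fixes T :: "('o, 'a) cat"
  assumes T: "is_category T" and inacc: "inaccessible TYPE('u)"
  shows "structured_category (point_cat T :: (('o, 'a, 'u set, 'u \<Rightarrow> 'u) fctr, 'o \<Rightarrow> 'u \<Rightarrow> 'u) cat) (obj T) fob"
    (is "structured_category ?C _ _")
proof
  have inf: "infinite (UNIV :: 'u set)"
    using inacc infinite_iff_natLeq_ordLeq ordLess_imp_ordLeq by (auto simp: inaccessible_def)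
  have F: "is_functor T set_cat p" if "p \<in> obj ?C" for p
    using that by (simp add: obj_point_cat is_point_def)
  show "is_category ?C"
    unfolding point_cat_def
    by (rule is_category_full_subcat[OF is_category_fctr_cat[OF T is_category_set_cat]])
  show "f t x \<in> fob q t"
    if "p \<in> obj ?C" "q \<in> obj ?C" "f \<in> hom ?C p q" "t \<in> obj T" "x \<in> fob p t" for p q f t x
    using that(3-) unfolding hom_point_cat[OF F[OF that(1)]] by blast
  show "idn ?C p t x = x" if "p \<in> obj ?C" "t \<in> obj T" "x \<in> fob p t" for p t x
    using that by (simp add: idn_point_cat)
  show "cmp ?C p q r g f t x = g t (f t x)" if "t \<in> obj T" "x \<in> fob p t" for p q r f g t x
    using that by (simp add: cmp_point_cat compose_def)
  show "f = g" if "p \<in> obj ?C" "f \<in> hom ?C p q" "g \<in> hom ?C p q"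
    and eq: "\<And>t x. t \<in> obj T \<Longrightarrow> x \<in> fob p t \<Longrightarrow> f t x = g t x" for p q f g
  proof -
    have fg: "f \<in> (\<Pi>\<^sub>E t\<in>obj T. fob p t \<rightarrow>\<^sub>E fob q t)" "g \<in> (\<Pi>\<^sub>E t\<in>obj T. fob p t \<rightarrow>\<^sub>E fob q t)"
      using that(2,3) unfolding hom_point_cat[OF F[OF that(1)]] by blast+
    show ?thesis
      by (rule PiE_ext[OF fg], rule PiE_ext[OF PiE_mem[OF fg(1)] PiE_mem[OF fg(2)]]) (use eq in auto)
  qed
  show "\<exists>Q \<iota>. \<exists>r\<in>hom ?C Q R. chain_cocone ?C P u Q \<iota> \<and> (\<forall>n. cmp ?C (P n) Q R r (\<iota> n) = \<rho> n) \<and>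
        (\<forall>t\<in>obj T. \<forall>y\<in>fob Q t. \<exists>n. \<exists>x\<in>fob (P n) t. \<iota> n t x = y)"
    if "chain_cocone ?C P u R \<rho>" for P u R \<rho>
    by (rule point_chain_cover[OF T inacc that])
  show "\<exists>P\<in>obj ?C. \<exists>j\<in>hom ?C P R. \<forall>t\<in>obj T. \<forall>x\<in>fob P t. j t x \<in> B t"
    if "R \<in> obj ?C" "homogeneous ?C (obj T) fob R B" for R B
    by (rule point_homogeneous_part[OF T inf _ that(2)]) (use that(1) in \<open>simp add: obj_point_cat\<close>)
qed

section \<open>Models and elementary embeddings\<close>

lemma is_formula_simps:
  "is_formula \<Sigma> (Neg \<phi>) \<longleftrightarrow> is_formula \<Sigma> \<phi>"
  "is_formula \<Sigma> (Ex n s \<phi>) \<longleftrightarrow> s \<in> sorts \<Sigma> \<and> is_formula \<Sigma> \<phi>"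
  "is_formula \<Sigma> (All n s \<phi>) \<longleftrightarrow> s \<in> sorts \<Sigma> \<and> is_formula \<Sigma> \<phi>"
  by (auto simp: is_formula_def)

lemma is_formula_Conj: "is_formula \<Sigma> (Conj K \<phi>) \<Longrightarrow> k \<in> K \<Longrightarrow> is_formula \<Sigma> (\<phi> k)"
  by (auto simp: is_formula_def intro: finite_subset[rotated])

lemma is_formula_Disj: "is_formula \<Sigma> (Disj K \<phi>) \<Longrightarrow> k \<in> K \<Longrightarrow> is_formula \<Sigma> (\<phi> k)"
  by (auto simp: is_formula_def intro: finite_subset[rotated])

lemma trm_val_carr_update: "trm_val (M\<lparr>carr := B\<rparr>) v t = trm_val M v t"
proof (induction t)
  case (App f ts)
  then have "map (trm_val (M\<lparr>carr := B\<rparr>) v) ts = map (trm_val M v) ts" by simp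
  then show ?case by (simp only: trm_val.simps) simp
qed simp

definition tarski_vaught ::
  "('s, 'f, 'r) fo_sig \<Rightarrow> ('s, 'f, 'r, 'u) struct \<Rightarrow> ('s \<Rightarrow> 'u set) \<Rightarrow> bool" where
  "tarski_vaught \<Sigma> M B \<longleftrightarrow> (\<forall>s\<in>sorts \<Sigma>. B s \<subseteq> carr M s) \<and>
    (\<forall>(\<phi> :: ('s, 'f, 'r, 'u) fml) n s v. is_formula \<Sigma> \<phi> \<and> s \<in> sorts \<Sigma> \<and>
       (\<forall>(m, s')\<in>free_vars \<phi> - {(n, s)}. v (m, s') \<in> B s') \<and> (\<exists>a\<in>carr M s. sat M \<phi> (v((n, s) := a))) \<longrightarrow>
       (\<exists>b\<in>B s. sat M \<phi> (v((n, s) := b))))"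

lemma tarski_vaughtD:
  fixes \<phi> :: "('s, 'f, 'r, 'u) fml"
  assumes "tarski_vaught \<Sigma> M B" "is_formula \<Sigma> \<phi>" "s \<in> sorts \<Sigma>"
    and "\<And>m s'. (m, s') \<in> free_vars \<phi> \<Longrightarrow> (m, s') \<noteq> (n, s) \<Longrightarrow> v (m, s') \<in> B s'"
    and "a \<in> carr M s" "sat M \<phi> (v((n, s) := a))"
  shows "\<exists>b\<in>B s. sat M \<phi> (v((n, s) := b))"
proof -
  have "\<forall>(m, s')\<in>free_vars \<phi> - {(n, s)}. v (m, s') \<in> B s'"
    using assms(4) by auto
  then show ?thesis using assms unfolding tarski_vaught_def by blast
qed

text \<open>Only quantifiers see the carrier. There the criterion supplies a witness in
  \<open>B\<close>; for a universal quantifier it is applied to the negated formula and supplies a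
  counterexample.\<close>

lemma sat_carr_update:
  fixes \<phi> :: "('s, 'f, 'r, 'u) fml"
  assumes tv: "tarski_vaught \<Sigma> M B"
    and "is_formula \<Sigma> \<phi>" "\<And>n s. (n, s) \<in> free_vars \<phi> \<Longrightarrow> v (n, s) \<in> B s"
  shows "sat (M\<lparr>carr := B\<rparr>) \<phi> v \<longleftrightarrow> sat M \<phi> v"
  using assms(2,3)
proof (induction \<phi> arbitrary: v)
  case (Eq t u)
  then show ?case by (simp add: trm_val_carr_update)
next
  case (Rel r ts)
  have "map (trm_val (M\<lparr>carr := B\<rparr>) v) ts = map (trm_val M v) ts"
    by (simp add: trm_val_carr_update)
  then show ?case by (simp only: sat.simps) simp
next
  case (Neg \<phi>)
  then show ?case by (simp add: is_formula_simps)
next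
  case (Conj K \<phi>)
  have "sat (M\<lparr>carr := B\<rparr>) (\<phi> k) v \<longleftrightarrow> sat M (\<phi> k) v" if "k \<in> K" for k
    using Conj.IH[OF rangeI is_formula_Conj[OF Conj.prems(1) that]] Conj.prems(2) that by auto
  then show ?case by simp
next
  case (Disj K \<phi>)
  have "sat (M\<lparr>carr := B\<rparr>) (\<phi> k) v \<longleftrightarrow> sat M (\<phi> k) v" if "k \<in> K" for k
    using Disj.IH[OF rangeI is_formula_Disj[OF Disj.prems(1) that]] Disj.prems(2) that by auto
  then show ?case by simp
next
  case (Ex n s \<phi>)
  then have s: "s \<in> sorts \<Sigma>" and \<phi>: "is_formula \<Sigma> \<phi>" by (simp_all add: is_formula_simps)
  have v: "v (m, s') \<in> B s'" if "(m, s') \<in> free_vars \<phi>" "(m, s') \<noteq> (n, s)" for m s'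
    using Ex.prems(2) that by simp
  have IH: "sat (M\<lparr>carr := B\<rparr>) \<phi> (v((n, s) := b)) \<longleftrightarrow> sat M \<phi> (v((n, s) := b))" if "b \<in> B s" for b
    by (rule Ex.IH[OF \<phi>]) (use v that in auto)
  have "B s \<subseteq> carr M s" using tv s by (simp add: tarski_vaught_def)
  moreover have "\<exists>b\<in>B s. sat M \<phi> (v((n, s) := b))" if "a \<in> carr M s" "sat M \<phi> (v((n, s) := a))" for a
    using tarski_vaughtD[OF tv \<phi> s v that] by blast
  ultimately show ?case using IH by (simp del: fun_upd_apply) blast
next
  case (All n s \<phi>)
  then have s: "s \<in> sorts \<Sigma>" and \<phi>: "is_formula \<Sigma> \<phi>" "is_formula \<Sigma> (Neg \<phi>)"
    by (simp_all add: is_formula_simps)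
  have v: "v (m, s') \<in> B s'" if "(m, s') \<in> free_vars \<phi>" "(m, s') \<noteq> (n, s)" for m s'
    using All.prems(2) that by simp
  have IH: "sat (M\<lparr>carr := B\<rparr>) \<phi> (v((n, s) := b)) \<longleftrightarrow> sat M \<phi> (v((n, s) := b))" if "b \<in> B s" for b
    by (rule All.IH[OF \<phi>(1)]) (use v that in auto)
  have "B s \<subseteq> carr M s" using tv s by (simp add: tarski_vaught_def)
  moreover have "\<exists>b\<in>B s. \<not> sat M \<phi> (v((n, s) := b))" if "a \<in> carr M s" "\<not> sat M \<phi> (v((n, s) := a))" for a
    using tarski_vaughtD[OF tv \<phi>(2) s, of n v a] v that by auto
  ultimately show ?case using IH by (simp del: fun_upd_apply) blast
qed

text \<open>Closure under the operations comes from the criterion for the formula \<open>x = f x\<^sub>0 \<dots> x\<^sub>k\<close>.\<close>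

lemma is_model_carr_update:
  fixes M :: "('s, 'f, 'r, 'u) struct"
  assumes \<Sigma>: "small_signature TYPE('u) \<Sigma>" and Th: "is_theory \<Sigma> Th" and M: "is_model \<Sigma> Th M"
    and tv: "tarski_vaught \<Sigma> M B"
  shows "is_model \<Sigma> Th (M\<lparr>carr := B\<rparr>)"
proof -
  have BM: "B s \<subseteq> carr M s" if "s \<in> sorts \<Sigma>" for s
    using tv that by (simp add: tarski_vaught_def)
  have str: "is_structure \<Sigma> M" using M by (simp add: is_model_def)
  have closed: "fun_int M f as \<in> B (fun_res \<Sigma> f)"
    if f: "f \<in> funs \<Sigma>" and as: "list_all2 (\<lambda>a s. a \<in> B s) as (fun_args \<Sigma> f)" for f as
  proof -
    let ?ss = "fun_args \<Sigma> f" and ?r = "fun_res \<Sigma> f"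
    let ?k = "length ?ss"
    let ?ts = "map (\<lambda>i. Var i (?ss ! i)) [0..<?k]"
    \<comment> \<open>The result variable is numbered by the arity, so it differs from all argument
      variables, even those of the same sort.\<close>
    let ?\<phi> = "Eq (Var ?k ?r) (App f ?ts) :: ('s, 'f, 'r, 'u) fml"
    let ?v = "\<lambda>(i, s). as ! i"
    have len: "length as = ?k" using as by (rule list_all2_lengthD)
    have sorts: "set ?ss \<subseteq> sorts \<Sigma>" "?r \<in> sorts \<Sigma>"
      using \<Sigma> f by (auto simp: small_signature_def)
    have as': "as ! i \<in> B (?ss ! i)" if "i < ?k" for i
      using list_all2_nthD2[OF as that] .
    have "list_all2 (has_sort \<Sigma>) ?ts ?ss"
      using sorts(1) by (auto simp: list_all2_conv_all_nth intro!: has_sort.intros(1))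
    then have "has_sort \<Sigma> (App f ?ts) ?r"
      by (rule has_sort.intros(2)[OF f])
    moreover have "has_sort \<Sigma> (Var ?k ?r) ?r"
      by (rule has_sort.intros(1)[OF sorts(2)])
    ultimately have \<phi>: "is_formula \<Sigma> ?\<phi>"
      by (auto simp: is_formula_def)
    have args: "map (trm_val M (?v((?k, ?r) := b))) ?ts = as" for b
      by (rule nth_equalityI) (simp_all add: len)
    have "list_all2 (\<lambda>a s. a \<in> carr M s) as ?ss"
      using as BM sorts(1) len by (auto simp: list_all2_conv_all_nth subset_iff)
    then have "fun_int M f as \<in> carr M ?r"
      using str f by (simp add: is_structure_def)
    \<comment> \<open>The value of the operation is the only witness, so the witness found in
      \<open>B\<close> must be that value.\<close>
    moreover have sat_iff: "sat M ?\<phi> (?v((?k, ?r) := b)) \<longleftrightarrow> b = fun_int M f as" for b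
      by (simp only: sat.simps trm_val.simps args) simp
    ultimately have "\<exists>b\<in>B ?r. sat M ?\<phi> (?v((?k, ?r) := b))"
      by (intro tarski_vaughtD[OF tv \<phi> sorts(2)]) (use as' in auto)
    then show ?thesis
      unfolding sat_iff by blast
  qed
  have "small TYPE('u) (B s)" if "s \<in> sorts \<Sigma>" for s
    by (rule small_subset[OF _ BM[OF that]]) (use str that in \<open>simp add: is_structure_def\<close>)
  then have "is_structure \<Sigma> (M\<lparr>carr := B\<rparr>)"
    using closed by (simp add: is_structure_def)
  moreover have "sat (M\<lparr>carr := B\<rparr>) \<phi> v" if "\<phi> \<in> Th" for \<phi> v
  proof -
    have "is_formula \<Sigma> \<phi>" "free_vars \<phi> = {}"
      using Th that by (auto simp: is_theory_def is_sentence_def is_formula_def)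
    then show ?thesis
      using sat_carr_update[OF tv, of \<phi> v] M that by (simp add: is_model_def)
  qed
  ultimately show ?thesis by (simp add: is_model_def)
qed

text \<open>The valuation \<open>w\<close> has to be the image of \<open>v\<close> only on the free
  variables, so updated valuations can be compared directly.\<close>

lemma elementary_sat:
  fixes \<phi> :: "('s, 'f, 'r, 'u) fml"
  assumes "h \<in> elementary_embeddings \<Sigma> M N" "is_formula \<Sigma> \<phi>"
    and "\<And>n s. (n, s) \<in> free_vars \<phi> \<Longrightarrow> v (n, s) \<in> carr M s"
    and "\<And>n s. (n, s) \<in> free_vars \<phi> \<Longrightarrow> w (n, s) = h s (v (n, s))"
  shows "sat M \<phi> v \<longleftrightarrow> sat N \<phi> w"
proof -
  have "sat M \<phi> v \<longleftrightarrow> sat N \<phi> (\<lambda>(n, s). h s (v (n, s)))"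
    using assms(1-3) unfolding elementary_embeddings_def by blast
  also have "\<dots> \<longleftrightarrow> sat N \<phi> w"
    by (rule sat_cong) (use assms(4) in auto)
  finally show ?thesis .
qed

lemma elementary_in:
  "h \<in> elementary_embeddings \<Sigma> M N \<Longrightarrow> s \<in> sorts \<Sigma> \<Longrightarrow> x \<in> carr M s \<Longrightarrow> h s x \<in> carr N s"
  by (auto simp: elementary_embeddings_def PiE_iff)

text \<open>Truth in \<open>N\<close> and in its substructure on \<open>B\<close> agree at elements
  of \<open>B\<close>, so restricting the codomain keeps elementarity.\<close>

lemma elementary_to_carr_update:
  fixes M :: "('s, 'f, 'r, 'u) struct"
  assumes tv: "tarski_vaught \<Sigma> N B" and h: "h \<in> elementary_embeddings \<Sigma> M N"
    and B: "\<And>s x. s \<in> sorts \<Sigma> \<Longrightarrow> x \<in> carr M s \<Longrightarrow> h s x \<in> B s"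
  shows "h \<in> elementary_embeddings \<Sigma> M (N\<lparr>carr := B\<rparr>)"
  unfolding elementary_embeddings_def
proof (intro CollectI conjI allI impI)
  show "h \<in> (\<Pi>\<^sub>E s\<in>sorts \<Sigma>. carr M s \<rightarrow>\<^sub>E carr (N\<lparr>carr := B\<rparr>) s)"
  proof -
    have "h \<in> (\<Pi>\<^sub>E s\<in>sorts \<Sigma>. carr M s \<rightarrow>\<^sub>E carr N s)"
      using h by (simp add: elementary_embeddings_def)
    then show ?thesis using B by (simp add: PiE_iff)
  qed
next
  fix \<phi> :: "('s, 'f, 'r, 'u) fml" and v
  assume *: "is_formula \<Sigma> \<phi> \<and> (\<forall>(n, s)\<in>free_vars \<phi>. v (n, s) \<in> carr M s)"
  then have v: "v (n, s) \<in> carr M s" "s \<in> sorts \<Sigma>" if "(n, s) \<in> free_vars \<phi>" for n s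
    using free_vars_sorts[of \<Sigma> \<phi>] that by (auto simp: is_formula_def)
  have "sat M \<phi> v \<longleftrightarrow> sat N \<phi> (\<lambda>(n, s). h s (v (n, s)))"
    by (rule elementary_sat[OF h]) (use * in auto)
  also have "\<dots> \<longleftrightarrow> sat (N\<lparr>carr := B\<rparr>) \<phi> (\<lambda>(n, s). h s (v (n, s)))"
    by (rule sat_carr_update[OF tv, symmetric]) (use * v B in auto)
  finally show "sat M \<phi> v \<longleftrightarrow> sat (N\<lparr>carr := B\<rparr>) \<phi> (\<lambda>(n, s). h s (v (n, s)))" .
qed

lemma elementary_carr_update_inclusion:
  fixes M :: "('s, 'f, 'r, 'u) struct"
  assumes tv: "tarski_vaught \<Sigma> M B"
  shows "(\<lambda>s\<in>sorts \<Sigma>. \<lambda>x\<in>B s. x) \<in> elementary_embeddings \<Sigma> (M\<lparr>carr := B\<rparr>) M"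
  unfolding elementary_embeddings_def
proof (intro CollectI conjI allI impI)
  show "(\<lambda>s\<in>sorts \<Sigma>. \<lambda>x\<in>B s. x) \<in> (\<Pi>\<^sub>E s\<in>sorts \<Sigma>. carr (M\<lparr>carr := B\<rparr>) s \<rightarrow>\<^sub>E carr M s)"
    using tv unfolding tarski_vaught_def by (simp add: subset_iff)
next
  fix \<phi> :: "('s, 'f, 'r, 'u) fml" and v
  assume *: "is_formula \<Sigma> \<phi> \<and> (\<forall>(n, s)\<in>free_vars \<phi>. v (n, s) \<in> carr (M\<lparr>carr := B\<rparr>) s)"
  then have fs: "free_vars \<phi> \<subseteq> UNIV \<times> sorts \<Sigma>"
    using free_vars_sorts by (auto simp: is_formula_def)
  have "sat (M\<lparr>carr := B\<rparr>) \<phi> v \<longleftrightarrow> sat M \<phi> v"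
    by (rule sat_carr_update[OF tv]) (use * in auto)
  also have "\<dots> \<longleftrightarrow> sat M \<phi> (\<lambda>(n, s). (\<lambda>s\<in>sorts \<Sigma>. \<lambda>x\<in>B s. x) s (v (n, s)))"
    by (rule sat_cong) (use * fs in auto)
  finally show "sat (M\<lparr>carr := B\<rparr>) \<phi> v \<longleftrightarrow> sat M \<phi> (\<lambda>(n, s). (\<lambda>s\<in>sorts \<Sigma>. \<lambda>x\<in>B s. x) s (v (n, s)))" .
qed

section \<open>The category of models: homogeneous parts and chains\<close>

lemma model_cat_simps:
  "M \<in> obj (model_cat \<Sigma> Th) \<longleftrightarrow> is_model \<Sigma> Th M"
  "hom (model_cat \<Sigma> Th) = elementary_embeddings \<Sigma>"
  "idn (model_cat \<Sigma> Th) M = (\<lambda>s\<in>sorts \<Sigma>. \<lambda>x\<in>carr M s. x)"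
  "cmp (model_cat \<Sigma> Th) M N K g h = (\<lambda>s\<in>sorts \<Sigma>. compose (carr M s) (g s) (h s))"
  by (simp_all add: model_cat_def)

text \<open>A formula has finitely many free variables, so its parameters together with a witness
  form a finite set. The endomorphism given by homogeneity is elementary and fixes the parameters,
  so it sends the witness to another one, lying in \<open>B\<close>.\<close>

lemma homogeneous_tarski_vaught:
  fixes Th :: "('s, 'f, 'r, 'u) fml set"
  assumes B: "homogeneous (model_cat \<Sigma> Th) (sorts \<Sigma>) carr R B"
  shows "tarski_vaught \<Sigma> R B"
  unfolding tarski_vaught_def
proof (intro conjI allI impI)
  show BR: "\<forall>s\<in>sorts \<Sigma>. B s \<subseteq> carr R s"
    using B by (simp add: homogeneous_def)
  fix \<phi> :: "('s, 'f, 'r, 'u) fml" and n s v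
  assume *: "is_formula \<Sigma> \<phi> \<and> s \<in> sorts \<Sigma> \<and>
       (\<forall>(m, s')\<in>free_vars \<phi> - {(n, s)}. v (m, s') \<in> B s') \<and> (\<exists>a\<in>carr R s. sat R \<phi> (v((n, s) := a)))"
  then have \<phi>: "is_formula \<Sigma> \<phi>" and s: "s \<in> sorts \<Sigma>"
    and v: "\<And>m s'. (m, s') \<in> free_vars \<phi> - {(n, s)} \<Longrightarrow> v (m, s') \<in> B s'"
    by auto
  obtain a where a: "a \<in> carr R s" "sat R \<phi> (v((n, s) := a))" using * by blast
  have fs: "s' \<in> sorts \<Sigma>" if "(m, s') \<in> free_vars \<phi>" for m s'
    using \<phi> free_vars_sorts[of \<Sigma> \<phi>] that by (auto simp: is_formula_def)
  have vR: "v (m, s') \<in> carr R s'" if "(m, s') \<in> free_vars \<phi> - {(n, s)}" for m s'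
    using v[OF that] BR fs that by blast
  let ?W = "insert (s, a) ((\<lambda>(m, s'). (s', v (m, s'))) ` (free_vars \<phi> - {(n, s)}))"
  have "finite ?W" using \<phi> by (simp add: is_formula_def)
  moreover have "\<forall>(t, x)\<in>?W. t \<in> sorts \<Sigma> \<and> x \<in> carr R t"
    using s a vR fs by auto
  ultimately obtain \<sigma> where \<sigma>: "\<sigma> \<in> elementary_embeddings \<Sigma> R R"
    and \<sigma>W: "\<forall>(t, x)\<in>?W. \<sigma> t x \<in> B t \<and> (x \<in> B t \<longrightarrow> \<sigma> t x = x)"
    using B unfolding homogeneous_def model_cat_simps by blast
  have fixed: "\<sigma> s' (v (m, s')) = v (m, s')" if "(m, s') \<in> free_vars \<phi> - {(n, s)}" for m s'
    using \<sigma>W v[OF that] that by fastforce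
  have "sat R \<phi> (v((n, s) := a)) \<longleftrightarrow> sat R \<phi> (v((n, s) := \<sigma> s a))"
    by (rule elementary_sat[OF \<sigma> \<phi>]) (use a(1) vR fixed in auto)
  then show "\<exists>b\<in>B s. sat R \<phi> (v((n, s) := b))"
    using a(2) \<sigma>W by auto
qed

text \<open>The union of the stages is formed inside \<open>R\<close>. The finitely many parameters
  of a formula come from one stage \<open>P k\<close>; since \<open>\<rho> k\<close> is elementary,
  the existential statement already holds in \<open>P k\<close>, and the image of a witness there
  lies in the union.\<close>

lemma chain_tarski_vaught:
  fixes Th :: "('s, 'f, 'r, 'u) fml set"
  assumes chain: "chain_cocone (model_cat \<Sigma> Th) P u R \<rho>"
  shows "tarski_vaught \<Sigma> R (\<lambda>s. \<Union>k. \<rho> k s ` carr (P k) s)" (is "tarski_vaught _ _ ?B")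
  unfolding tarski_vaught_def
proof (intro conjI allI impI)
  have \<rho>: "\<And>k. \<rho> k \<in> elementary_embeddings \<Sigma> (P k) R"
    and u: "\<And>k l. k \<le> l \<Longrightarrow> u k l \<in> elementary_embeddings \<Sigma> (P k) (P l)"
    and \<rho>u: "\<And>k l. k \<le> l \<Longrightarrow> (\<lambda>s\<in>sorts \<Sigma>. compose (carr (P k) s) (\<rho> l s) (u k l s)) = \<rho> k"
    using chain by (simp_all add: chain_cocone_def model_cat_simps)
  have mono: "\<rho> k s ` carr (P k) s \<subseteq> \<rho> l s ` carr (P l) s" if "k \<le> l" "s \<in> sorts \<Sigma>" for k l s
  proof
    fix y assume "y \<in> \<rho> k s ` carr (P k) s"
    then obtain x where x: "x \<in> carr (P k) s" "y = \<rho> k s x" by blast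
    then have "y = \<rho> l s (u k l s x)"
      using fun_cong[OF fun_cong[OF \<rho>u[OF that(1)]], of s x] that(2) by (simp add: compose_def)
    then show "y \<in> \<rho> l s ` carr (P l) s"
      using elementary_in[OF u[OF that(1)] that(2) x(1)] by blast
  qed
  show "\<forall>s\<in>sorts \<Sigma>. ?B s \<subseteq> carr R s"
    using elementary_in[OF \<rho>] by blast
  fix \<phi> :: "('s, 'f, 'r, 'u) fml" and n s v
  assume *: "is_formula \<Sigma> \<phi> \<and> s \<in> sorts \<Sigma> \<and>
       (\<forall>(m, s')\<in>free_vars \<phi> - {(n, s)}. v (m, s') \<in> ?B s') \<and> (\<exists>a\<in>carr R s. sat R \<phi> (v((n, s) := a)))"
  then have \<phi>: "is_formula \<Sigma> \<phi>" and s: "s \<in> sorts \<Sigma>" and ex: "sat R (Ex n s \<phi>) v"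
    by auto
  have v: "\<forall>p\<in>free_vars \<phi> - {(n, s)}. v p \<in> ?B (snd p)"
    using *[unfolded case_prod_unfold prod.collapse] by blast
  have fs: "s' \<in> sorts \<Sigma>" if "(m, s') \<in> free_vars \<phi>" for m s'
    using \<phi> free_vars_sorts[of \<Sigma> \<phi>] that by (auto simp: is_formula_def)
  have "\<exists>k. \<forall>p\<in>free_vars \<phi> - {(n, s)}. v p \<in> \<rho> k (snd p) ` carr (P k) (snd p)"
  proof (rule finite_common_bound)
    show "finite (free_vars \<phi> - {(n, s)})" using \<phi> by (simp add: is_formula_def)
    show "\<exists>k. v p \<in> \<rho> k (snd p) ` carr (P k) (snd p)" if "p \<in> free_vars \<phi> - {(n, s)}" for p
      using bspec[OF v that] by simp
    show "v p \<in> \<rho> l (snd p) ` carr (P l) (snd p)"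
      if "p \<in> free_vars \<phi> - {(n, s)}" "v p \<in> \<rho> k (snd p) ` carr (P k) (snd p)" "k \<le> l" for p k l
      using mono[OF that(3), of "snd p"] fs[of "fst p" "snd p"] that(1,2) by auto
  qed
  then obtain k where k: "\<forall>p\<in>free_vars \<phi> - {(n, s)}. \<exists>x. x \<in> carr (P k) (snd p) \<and> v p = \<rho> k (snd p) x"
    by blast
  obtain w where w: "\<And>p. p \<in> free_vars \<phi> - {(n, s)} \<Longrightarrow> w p \<in> carr (P k) (snd p)"
    and vw: "\<And>p. p \<in> free_vars \<phi> - {(n, s)} \<Longrightarrow> v p = \<rho> k (snd p) (w p)"
    using bchoice[OF k] by blast
  have "sat (P k) (Ex n s \<phi>) w \<longleftrightarrow> sat R (Ex n s \<phi>) v"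
    by (rule elementary_sat[OF \<rho>]) (use \<phi> s w vw in \<open>fastforce simp: is_formula_simps\<close>)+
  then obtain b where b: "b \<in> carr (P k) s" "sat (P k) \<phi> (w((n, s) := b))"
    using ex by auto
  have "sat (P k) \<phi> (w((n, s) := b)) \<longleftrightarrow> sat R \<phi> (v((n, s) := \<rho> k s b))"
    by (rule elementary_sat[OF \<rho> \<phi>]) (use b(1) w vw in fastforce)+
  then show "\<exists>b\<in>?B s. sat R \<phi> (v((n, s) := b))"
    using b by blast
qed

text \<open>Both the covered object of a chain and the homogeneous part are \<open>R\<close> with a
  smaller carrier, so both reduce to the Tarski-Vaught criterion; the legs of the chain are the maps
  \<open>\<rho>\<close> with restricted codomain.\<close>

lemma structured_category_model_cat:
  fixes Th :: "('s, 'f, 'r, 'u) fml set"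
  assumes \<Sigma>: "small_signature TYPE('u) \<Sigma>" and Th: "is_theory \<Sigma> Th"
  shows "structured_category (model_cat \<Sigma> Th) (sorts \<Sigma>) carr" (is "structured_category ?C _ _")
proof
  show "is_category ?C" by (rule is_category_model_cat)
  show "f s x \<in> carr N s" if "f \<in> hom ?C M N" "s \<in> sorts \<Sigma>" "x \<in> carr M s" for M N f s x
    using that elementary_in by (simp add: model_cat_simps)
  show "idn ?C M s x = x" if "s \<in> sorts \<Sigma>" "x \<in> carr M s" for M s x
    using that by (simp add: model_cat_simps)
  show "cmp ?C M N K g f s x = g s (f s x)" if "s \<in> sorts \<Sigma>" "x \<in> carr M s" for M N K f g s x
    using that by (simp add: model_cat_simps compose_def)
  show "f = g" if f: "f \<in> hom ?C M N" and g: "g \<in> hom ?C M N"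
    and eq: "\<And>s x. s \<in> sorts \<Sigma> \<Longrightarrow> x \<in> carr M s \<Longrightarrow> f s x = g s x" for M N f g
  proof -
    have fg: "f \<in> (\<Pi>\<^sub>E s\<in>sorts \<Sigma>. carr M s \<rightarrow>\<^sub>E carr N s)" "g \<in> (\<Pi>\<^sub>E s\<in>sorts \<Sigma>. carr M s \<rightarrow>\<^sub>E carr N s)"
      using f g by (auto simp: model_cat_simps elementary_embeddings_def)
    show ?thesis
      by (rule PiE_ext[OF fg], rule PiE_ext[OF PiE_mem[OF fg(1)] PiE_mem[OF fg(2)]]) (use eq in auto)
  qed
  show "\<exists>Q \<iota>. \<exists>r\<in>hom ?C Q R. chain_cocone ?C P u Q \<iota> \<and> (\<forall>n. cmp ?C (P n) Q R r (\<iota> n) = \<rho> n) \<and>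
        (\<forall>s\<in>sorts \<Sigma>. \<forall>y\<in>carr Q s. \<exists>n. \<exists>x\<in>carr (P n) s. \<iota> n s x = y)"
    if chain: "chain_cocone ?C P u R \<rho>" for P u R \<rho>
  proof -
    let ?B = "\<lambda>s. \<Union>k. \<rho> k s ` carr (P k) s"
    let ?Q = "R\<lparr>carr := ?B\<rparr>" and ?r = "\<lambda>s\<in>sorts \<Sigma>. \<lambda>x\<in>?B s. x"
    note tv = chain_tarski_vaught[OF chain]
    have R: "is_model \<Sigma> Th R" and \<rho>: "\<And>n. \<rho> n \<in> elementary_embeddings \<Sigma> (P n) R"
      using chain by (simp_all add: chain_cocone_def model_cat_simps)
    have "\<rho> n \<in> elementary_embeddings \<Sigma> (P n) ?Q" for n
      by (rule elementary_to_carr_update[OF tv \<rho>]) blast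
    then have "chain_cocone ?C P u ?Q \<rho>"
      using chain is_model_carr_update[OF \<Sigma> Th R tv] by (simp add: chain_cocone_def model_cat_simps)
    moreover have "cmp ?C (P n) ?Q R ?r (\<rho> n) = \<rho> n" for n
    proof -
      have \<rho>PiE: "\<rho> n \<in> (\<Pi>\<^sub>E s\<in>sorts \<Sigma>. carr (P n) s \<rightarrow>\<^sub>E carr R s)"
        using \<rho>[of n] by (simp add: elementary_embeddings_def)
      have "compose (carr (P n) s) (?r s) (\<rho> n s) = \<rho> n s" if s: "s \<in> sorts \<Sigma>" for s
        by (rule extensionalityI[of _ "carr (P n) s"])
          (use \<rho>PiE s in \<open>auto simp: compose_def PiE_iff\<close>)
      then show ?thesis
        by (intro extensionalityI[of _ "sorts \<Sigma>"]) (use \<rho>PiE in \<open>auto simp: model_cat_simps PiE_iff\<close>)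
    qed
    moreover have "?r \<in> hom ?C ?Q R"
      using elementary_carr_update_inclusion[OF tv] by (simp add: model_cat_simps)
    moreover have "\<exists>n. \<exists>x\<in>carr (P n) s. \<rho> n s x = y" if "y \<in> carr ?Q s" for s y
      using that by auto
    ultimately show ?thesis by blast
  qed
  show "\<exists>P\<in>obj ?C. \<exists>j\<in>hom ?C P R. \<forall>s\<in>sorts \<Sigma>. \<forall>x\<in>carr P s. j s x \<in> B s"
    if R: "R \<in> obj ?C" and B: "homogeneous ?C (sorts \<Sigma>) carr R B" for R B
  proof -
    note tv = homogeneous_tarski_vaught[OF B]
    show ?thesis
    proof (rule bexI[of _ "R\<lparr>carr := B\<rparr>"], rule bexI[of _ "\<lambda>s\<in>sorts \<Sigma>. \<lambda>x\<in>B s. x"])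
      show "R\<lparr>carr := B\<rparr> \<in> obj ?C"
        using is_model_carr_update[OF \<Sigma> Th _ tv] R by (simp add: model_cat_simps)
      show "(\<lambda>s\<in>sorts \<Sigma>. \<lambda>x\<in>B s. x) \<in> hom ?C (R\<lparr>carr := B\<rparr>) R"
        using elementary_carr_update_inclusion[OF tv] by (simp add: model_cat_simps)
    qed simp
  qed
qed

theorem corollary2p9:
  fixes \<kappa> :: "'k rel"
  assumes "inaccessible TYPE('u)"
    and "Card_order \<kappa>" and "natLeq <o \<kappa>" and "\<kappa> <o |UNIV :: 'u set|"
  shows "(\<forall>T :: ('o, 'a) cat. grothendieck_topos TYPE('u) T \<longrightarrow>
            \<not> equivalent (set_mono_cat \<kappa> :: ('u set, 'u \<Rightarrow> 'u) cat)
                (point_cat T :: (('o, 'a, 'u set, 'u \<Rightarrow> 'u) fctr, 'o \<Rightarrow> 'u \<Rightarrow> 'u) cat)) \<and>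
         (\<forall>(\<Sigma> :: ('s, 'f, 'r) fo_sig) (Th :: ('s, 'f, 'r, 'u) fml set).
            small_signature TYPE('u) \<Sigma> \<and> is_theory \<Sigma> Th \<longrightarrow>
            \<not> equivalent (set_mono_cat \<kappa> :: ('u set, 'u \<Rightarrow> 'u) cat) (model_cat \<Sigma> Th))"
proof (intro conjI allI impI)
  fix T :: "('o, 'a) cat"
  assume "grothendieck_topos TYPE('u) T"
  then have "is_category T" by (simp add: grothendieck_topos_def)
  then show "\<not> equivalent (set_mono_cat \<kappa> :: ('u set, 'u \<Rightarrow> 'u) cat)
      (point_cat T :: (('o, 'a, 'u set, 'u \<Rightarrow> 'u) fctr, 'o \<Rightarrow> 'u \<Rightarrow> 'u) cat)"
    by (rule structured_category.not_equivalent_set_mono_cat[OF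
          structured_category_point_cat[OF _ assms(1)] assms(2-4)])
next
  fix \<Sigma> :: "('s, 'f, 'r) fo_sig" and Th :: "('s, 'f, 'r, 'u) fml set"
  assume "small_signature TYPE('u) \<Sigma> \<and> is_theory \<Sigma> Th"
  then show "\<not> equivalent (set_mono_cat \<kappa> :: ('u set, 'u \<Rightarrow> 'u) cat) (model_cat \<Sigma> Th)"
    using structured_category.not_equivalent_set_mono_cat[OF structured_category_model_cat assms(2-4)]
    by blast
qed

end
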